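(* There exists a finite set of finite directed graphs $\{C_1,\dots,C_k\}$ such that the binary embeddability relation $\{(G,G')\in\mathcal{D}^2 : G\leq G'\}$ is first-order definable in the structure $(\mathcal{D};\sqsubseteq,C_1,\dots,C_k)$. Consequently, every relation that is first-order definable in $(\mathcal{D};\leq)$ is first-order definable in $(\mathcal{D};\sqsubseteq,C_1,\dots,C_k)$.
   Context: A directed graph (digraph) is a pair $G=(V,E)$ with $V$ a nonempty set and $E\subseteq V^2$ (loops allowed). $\mathcal{D}$ is the set of isomorphism types of finite digraphs. $G\leq G'$ ($G$ is embeddable into $G'$) if there is an injective map $\varphi:V(G)\to V(G')$ with $(v_1,v_2)\in E(G)\Rightarrow(\varphi(v_1),\varphi(v_2))\in E(G')$. $G\sqsubseteq G'$ ($G$ is a substructure of $G'$) if $G$ is isomorphic to an induced substructure of $G'$ on some subset of its vertices. A relation $R\subseteq\mathcal{D}^n$ is first-order definable in $(\mathcal{D};\sqsubseteq,C_1,\dots,C_k)$ if there is a first-order formula in the language of partial orders, with the constants $C_1,\dots,C_k$ (interpreted as the given digraphs), whose set of satisfying $n$-tuples is exactly $R$; similarly for $(\mathcal{D};\leq)$ (without constants). *)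

theory Defs
  imports "Graph_Theory.Pair_Digraph" "Graph_Theory.Digraph_Isomorphism"
begin

text \<open>
  A finite digraph is a \<^term>\<open>pair_fin_digraph\<close> (loops allowed, arcs are pairs of vertices)
  whose vertex set is nonempty.
\<close>

definition finite_digraph :: "'a pair_pre_digraph \<Rightarrow> bool" where
  "finite_digraph G \<longleftrightarrow> pair_fin_digraph G \<and> pverts G \<noteq> {}"

definition embeddable :: "'a pair_pre_digraph \<Rightarrow> 'b pair_pre_digraph \<Rightarrow> bool" where
  "embeddable G H \<longleftrightarrow>
    (\<exists>f. inj_on f (pverts G) \<and> f ` pverts G \<subseteq> pverts H \<and>
         (\<forall>u v. (u, v) \<in> parcs G \<longrightarrow> (f u, f v) \<in> parcs H))"

definition isomorphic :: "'a pair_pre_digraph \<Rightarrow> 'b pair_pre_digraph \<Rightarrow> bool" where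
  "isomorphic G H \<longleftrightarrow> digraph_iso (with_proj G) (with_proj H)"

definition substructure :: "'a pair_pre_digraph \<Rightarrow> 'b pair_pre_digraph \<Rightarrow> bool" where
  "substructure G H \<longleftrightarrow>
    (\<exists>K. induced_subgraph (with_proj K) (with_proj H) \<and> isomorphic G K)"

text \<open>
  The library isomorphisms carry a separate map on arcs; for digraphs whose arcs are pairs it is
  determined by the map on vertices.
\<close>

lemma isomorphic_iff:
  "isomorphic G H \<longleftrightarrow> pair_wf_digraph G \<and>
    (\<exists>f. inj_on f (pverts G) \<and> pverts H = f ` pverts G \<and> parcs H = map_prod f f ` parcs G)"
  (is "?L \<longleftrightarrow> ?R")
proof
  assume ?L
  then obtain h where h: "pre_digraph.digraph_isomorphism (with_proj G) h"
      and H: "with_proj H = app_iso h (with_proj G)"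
    unfolding isomorphic_def digraph_iso_def by blast
  have "iso_tail h = fst" "iso_head h = snd"
    using H by (simp_all add: with_proj_def app_iso_def)
  with h have wf: "wf_digraph (with_proj G)" and inj: "inj_on (iso_verts h) (pverts G)"
      and ia: "\<And>a. a \<in> parcs G \<Longrightarrow> iso_arcs h a = map_prod (iso_verts h) (iso_verts h) a"
    unfolding pre_digraph.digraph_isomorphism_def by (auto simp: prod_eq_iff)
  have "pverts H = iso_verts h ` pverts G" "parcs H = iso_arcs h ` parcs G"
    using H by (simp_all add: with_proj_def app_iso_def)
  moreover have "iso_arcs h ` parcs G = map_prod (iso_verts h) (iso_verts h) ` parcs G"
    using ia by (rule image_cong[OF refl])
  moreover have "pair_wf_digraph G"
    using wf by (simp add: wf_digraph_wp_iff)
  ultimately show ?R using inj by auto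
next
  assume ?R
  then obtain f where wf: "pair_wf_digraph G" and inj: "inj_on f (pverts G)"
      and V: "pverts H = f ` pverts G" and E: "parcs H = map_prod f f ` parcs G"
    by blast
  interpret pair_wf_digraph G by (rule wf)
  have "inj_on (map_prod f f) (parcs G)"
    using map_prod_inj_on[OF inj inj] by (rule inj_on_subset) (auto simp: wellformed')
  then have "pre_digraph.digraph_isomorphism (with_proj G)
      \<lparr>iso_verts = f, iso_arcs = map_prod f f, iso_head = snd, iso_tail = fst\<rparr>"
    using inj wf by (simp add: pre_digraph.digraph_isomorphism_def wf_digraph_wp_iff)
  moreover have "with_proj H = app_iso
      \<lparr>iso_verts = f, iso_arcs = map_prod f f, iso_head = snd, iso_tail = fst\<rparr> (with_proj G)"
    by (simp add: with_proj_def app_iso_def V E)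
  ultimately show ?L
    unfolding isomorphic_def digraph_iso_def by blast
qed

lemma isomorphic_refl: "pair_wf_digraph G \<Longrightarrow> isomorphic G G"
  unfolding isomorphic_iff by (auto intro!: exI[of _ id] simp: map_prod.id)

lemma isomorphic_sym:
  assumes "isomorphic G H" shows "isomorphic H G"
proof -
  obtain f where wf: "pair_wf_digraph G" and inj: "inj_on f (pverts G)"
      and V: "pverts H = f ` pverts G" and E: "parcs H = map_prod f f ` parcs G"
    using assms unfolding isomorphic_iff by blast
  let ?g = "the_inv_into (pverts G) f"
  interpret pair_wf_digraph G by (rule wf)
  have g: "\<And>v. v \<in> pverts G \<Longrightarrow> ?g (f v) = v"
    using inj by (rule the_inv_into_f_f)
  have "pair_wf_digraph H"
    by unfold_locales (auto simp: V E dest: in_arcsD1 in_arcsD2)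
  moreover have "inj_on ?g (pverts H)"
    using inj V by (simp add: inj_on_the_inv_into)
  moreover have "pverts G = ?g ` pverts H"
    by (simp add: V image_image g)
  moreover have "map_prod ?g ?g ` parcs H = id ` parcs G"
    unfolding E image_image
    by (rule image_cong) (auto simp: g wellformed')
  ultimately show ?thesis
    unfolding isomorphic_iff by (intro conjI exI[of _ ?g]) simp_all
qed

lemma isomorphic_trans:
  assumes "isomorphic G H" "isomorphic H K" shows "isomorphic G K"
proof -
  obtain f g where wf: "pair_wf_digraph G" and inj: "inj_on f (pverts G)" "inj_on g (f ` pverts G)"
      and H: "pverts H = f ` pverts G" "parcs H = map_prod f f ` parcs G"
      and K: "pverts K = g ` pverts H" "parcs K = map_prod g g ` parcs H"
    using assms unfolding isomorphic_iff by auto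
  have "parcs K = map_prod (g \<circ> f) (g \<circ> f) ` parcs G"
    unfolding K H map_prod_compose image_comp ..
  moreover have "pverts K = (g \<circ> f) ` pverts G"
    unfolding K H image_comp ..
  ultimately show ?thesis
    unfolding isomorphic_iff using wf comp_inj_on[OF inj] by blast
qed

lemma isomorphic_imp_embeddable: "isomorphic G H \<Longrightarrow> embeddable G H"
  unfolding isomorphic_iff embeddable_def by force

lemma embeddable_trans:
  assumes "embeddable G H" "embeddable H K" shows "embeddable G K"
proof -
  obtain f g where "inj_on f (pverts G)" "f ` pverts G \<subseteq> pverts H" "inj_on g (pverts H)"
      "g ` pverts H \<subseteq> pverts K" "\<forall>u v. (u, v) \<in> parcs G \<longrightarrow> (f u, f v) \<in> parcs H"
      "\<forall>u v. (u, v) \<in> parcs H \<longrightarrow> (g u, g v) \<in> parcs K"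
    using assms unfolding embeddable_def by auto
  then show ?thesis
    unfolding embeddable_def
    by (intro exI[of _ "g \<circ> f"]) (auto intro: comp_inj_on inj_on_subset)
qed

lemma substructure_isomorphic_left:
  "isomorphic G G' \<Longrightarrow> substructure G' H \<Longrightarrow> substructure G H"
  unfolding substructure_def by (blast intro: isomorphic_trans)

lemma substructure_isomorphic_right:
  assumes "substructure G H" "isomorphic H H'" shows "substructure G H'"
proof -
  obtain K where K: "induced_subgraph (with_proj K) (with_proj H)" "isomorphic G K"
    using assms unfolding substructure_def by auto
  obtain f where f: "inj_on f (pverts H)" "pverts H' = f ` pverts H"
      "parcs H' = map_prod f f ` parcs H"
    using assms unfolding isomorphic_iff by auto
  have wf: "pair_wf_digraph K" "pair_wf_digraph H" and sub: "pverts K \<subseteq> pverts H"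
    and arcs: "parcs K = {e \<in> parcs H. fst e \<in> pverts K \<and> snd e \<in> pverts K}"
    using K(1) by (auto simp: induced_subgraph_def subgraph_def wf_digraph_wp_iff)
  interpret H: pair_wf_digraph H by (rule wf)
  interpret K: pair_wf_digraph K by (rule wf)
  have wfH': "pair_wf_digraph H'"
    by unfold_locales (auto simp: f dest: H.in_arcsD1 H.in_arcsD2)
  define K' where "K' = \<lparr>pverts = f ` pverts K, parcs = map_prod f f ` parcs K\<rparr>"
  have wfK': "pair_wf_digraph K'"
    by unfold_locales (auto simp: K'_def dest: K.in_arcsD1 K.in_arcsD2)
  have iso: "isomorphic K K'"
    unfolding isomorphic_iff K'_def using wf(1) inj_on_subset[OF f(1) sub] by auto
  have mem: "v \<in> pverts K" if "f v \<in> f ` pverts K" "v \<in> pverts H" for v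
    using that f(1) sub by (auto dest: inj_onD)
  have mem': "(u, v) \<in> parcs K \<longleftrightarrow> (u, v) \<in> parcs H \<and> u \<in> pverts K \<and> v \<in> pverts K" for u v
    by (subst arcs) simp
  have "parcs K' = {e \<in> parcs H'. fst e \<in> pverts K' \<and> snd e \<in> pverts K'}"
  proof (intro subset_antisym subrelI)
    fix x y assume "(x, y) \<in> parcs K'"
    then obtain u v where "(u, v) \<in> parcs K" "x = f u" "y = f v"
      by (auto simp: K'_def)
    then show "(x, y) \<in> {e \<in> parcs H'. fst e \<in> pverts K' \<and> snd e \<in> pverts K'}"
      unfolding mem' K'_def f by auto
  next
    fix x y assume "(x, y) \<in> {e \<in> parcs H'. fst e \<in> pverts K' \<and> snd e \<in> pverts K'}"
    then have xy: "(x, y) \<in> map_prod f f ` parcs H" and fK: "x \<in> f ` pverts K" "y \<in> f ` pverts K"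
      by (simp_all add: K'_def f)
    obtain u v where uv: "(u, v) \<in> parcs H" "x = f u" "y = f v"
      using xy by auto
    have "u \<in> pverts K"
      using mem[OF fK(1)[unfolded uv(2)] H.in_arcsD1[OF uv(1)]] .
    moreover have "v \<in> pverts K"
      using mem[OF fK(2)[unfolded uv(3)] H.in_arcsD2[OF uv(1)]] .
    ultimately have "(u, v) \<in> parcs K"
      unfolding mem' using uv(1) by simp
    then show "(x, y) \<in> parcs K'"
      unfolding K'_def uv by auto
  qed
  moreover have "pverts K' \<subseteq> pverts H'"
    using sub by (auto simp: K'_def f)
  ultimately have "induced_subgraph (with_proj K') (with_proj H')"
    using wfK' wfH'
    by (simp add: induced_subgraph_def subgraph_def compatible_def wf_digraph_wp_iff)
  then show ?thesis
    unfolding substructure_def using isomorphic_trans[OF K(2) iso] by (intro exI[of _ K'] conjI)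
qed

text \<open>
  Isomorphism types of finite digraphs.  Representatives are taken with natural numbers as
  vertices; by the following lemma every finite digraph has such a representative.
\<close>

lemma finite_digraph_nat_representative:
  fixes G :: "'a pair_pre_digraph"
  assumes "finite_digraph G"
  shows "\<exists>H :: nat pair_pre_digraph. finite_digraph H \<and> isomorphic G H"
proof -
  interpret pair_fin_digraph G
    using assms by (simp add: finite_digraph_def)
  obtain f :: "'a \<Rightarrow> nat" where f: "inj_on f (pverts G)"
    using finite_imp_inj_to_nat_seg[OF pair_finite_verts] by blast
  let ?H = "\<lparr>pverts = f ` pverts G, parcs = map_prod f f ` parcs G\<rparr>"
  have "pair_fin_digraph ?H"
    by unfold_locales
      (auto dest: in_arcsD1 in_arcsD2 intro: pair_finite_verts pair_finite_arcs)
  moreover have "isomorphic G ?H"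
    unfolding isomorphic_iff using f pair_wf_digraph_axioms by auto
  ultimately show ?thesis
    using assms unfolding finite_digraph_def by (intro exI[of _ ?H]) auto
qed

definition iso_rel :: "nat pair_pre_digraph \<Rightarrow> nat pair_pre_digraph \<Rightarrow> bool" where
  "iso_rel G H \<longleftrightarrow> finite_digraph G \<and> finite_digraph H \<and> isomorphic G H"

quotient_type digraph_type = "nat pair_pre_digraph" / partial: iso_rel
proof (rule part_equivpI)
  let ?G = "\<lparr>pverts = {0 :: nat}, parcs = {}\<rparr>"
  have "pair_fin_digraph ?G" by unfold_locales auto
  then have "iso_rel ?G ?G"
    by (auto simp: iso_rel_def finite_digraph_def pair_fin_digraph_def intro: isomorphic_refl)
  then show "\<exists>G. iso_rel G G" ..
  show "symp iso_rel"
    by (rule sympI) (auto simp: iso_rel_def intro: isomorphic_sym)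
  show "transp iso_rel"
    by (rule transpI) (auto simp: iso_rel_def intro: isomorphic_trans)
qed

lift_definition embeddable_type :: "digraph_type \<Rightarrow> digraph_type \<Rightarrow> bool" (infix "\<preceq>" 50)
  is "embeddable :: nat pair_pre_digraph \<Rightarrow> nat pair_pre_digraph \<Rightarrow> bool"
  unfolding iso_rel_def
  by (meson embeddable_trans isomorphic_imp_embeddable isomorphic_sym)

lift_definition substructure_type :: "digraph_type \<Rightarrow> digraph_type \<Rightarrow> bool" (infix "\<sqsubseteq>" 50)
  is "substructure :: nat pair_pre_digraph \<Rightarrow> nat pair_pre_digraph \<Rightarrow> bool"
  unfolding iso_rel_def
  by (meson isomorphic_sym substructure_isomorphic_left substructure_isomorphic_right)

text \<open>
  First-order logic with equality over one binary relation symbol and constant symbols indexed by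
  natural numbers.  The universe of a structure is the whole type \<^typ>\<open>'a\<close>.
\<close>

datatype fo_term = Var nat | Const nat

datatype fo_formula =
    Le fo_term fo_term
  | Eq fo_term fo_term
  | Neg fo_formula
  | Conj fo_formula fo_formula
  | Exists nat fo_formula

fun term_vars :: "fo_term \<Rightarrow> nat set" where
  "term_vars (Var x) = {x}"
| "term_vars (Const i) = {}"

fun term_consts :: "fo_term \<Rightarrow> nat set" where
  "term_consts (Var x) = {}"
| "term_consts (Const i) = {i}"

fun free_vars :: "fo_formula \<Rightarrow> nat set" where
  "free_vars (Le s t) = term_vars s \<union> term_vars t"
| "free_vars (Eq s t) = term_vars s \<union> term_vars t"
| "free_vars (Neg \<phi>) = free_vars \<phi>"
| "free_vars (Conj \<phi> \<psi>) = free_vars \<phi> \<union> free_vars \<psi>"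
| "free_vars (Exists x \<phi>) = free_vars \<phi> - {x}"

fun consts_of :: "fo_formula \<Rightarrow> nat set" where
  "consts_of (Le s t) = term_consts s \<union> term_consts t"
| "consts_of (Eq s t) = term_consts s \<union> term_consts t"
| "consts_of (Neg \<phi>) = consts_of \<phi>"
| "consts_of (Conj \<phi> \<psi>) = consts_of \<phi> \<union> consts_of \<psi>"
| "consts_of (Exists x \<phi>) = consts_of \<phi>"

fun term_val :: "'a list \<Rightarrow> (nat \<Rightarrow> 'a) \<Rightarrow> fo_term \<Rightarrow> 'a" where
  "term_val cs e (Var x) = e x"
| "term_val cs e (Const i) = cs ! i"

fun satisfies :: "('a \<Rightarrow> 'a \<Rightarrow> bool) \<Rightarrow> 'a list \<Rightarrow> (nat \<Rightarrow> 'a) \<Rightarrow> fo_formula \<Rightarrow> bool" where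
  "satisfies r cs e (Le s t) \<longleftrightarrow> r (term_val cs e s) (term_val cs e t)"
| "satisfies r cs e (Eq s t) \<longleftrightarrow> term_val cs e s = term_val cs e t"
| "satisfies r cs e (Neg \<phi>) \<longleftrightarrow> \<not> satisfies r cs e \<phi>"
| "satisfies r cs e (Conj \<phi> \<psi>) \<longleftrightarrow> satisfies r cs e \<phi> \<and> satisfies r cs e \<psi>"
| "satisfies r cs e (Exists x \<phi>) \<longleftrightarrow> (\<exists>a. satisfies r cs (e(x := a)) \<phi>)"

text \<open>
  \<open>fo_definable r cs n R\<close>: the \<open>n\<close>-ary relation \<open>R\<close>, given as a set of lists of length \<open>n\<close>, is
  first-order definable in the structure with relation \<open>r\<close> and list of constants \<open>cs\<close>.  The variables
  \<open>0, \<dots>, n - 1\<close> stand for the components of a tuple.  The conditions on free variables and on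
  constant symbols ensure that \<open>!\<close> is only used at valid positions.
\<close>

definition fo_definable :: "('a \<Rightarrow> 'a \<Rightarrow> bool) \<Rightarrow> 'a list \<Rightarrow> nat \<Rightarrow> 'a list set \<Rightarrow> bool" where
  "fo_definable r cs n R \<longleftrightarrow>
    (\<exists>\<phi>. free_vars \<phi> \<subseteq> {..<n} \<and> consts_of \<phi> \<subseteq> {..<length cs} \<and>
         R = {as. length as = n \<and> satisfies r cs (\<lambda>x. as ! x) \<phi>})"

end

theory Submission
  imports Defs
begin

text \<open>
  A digraph \<open>G\<close> is coded by a larger digraph consisting of \<open>G\<close> and of two frames: a loopless
  transitive tournament \<open>A\<close> and a looped arcless set \<open>B\<close>.  Every vertex of \<open>G\<close> sends an arc to
  exactly one vertex of \<open>A\<close>, its place, different vertices having different places, and arcs to all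
  vertices of \<open>B\<close>.  With the types of \<open>A\<close> and \<open>B\<close> as parameters, the one-vertex extensions of the
  frames are recognised by patterns of bounded size, so that finitely many constants suffice, and
  they force the copies of the frames to be unique.  This makes \<open>A \<union> G\<close> and \<open>B \<union> G\<close> definable, and
  \<open>G\<close> is their largest common substructure.  In \<open>A \<union> G\<close> a vertex of \<open>G\<close> is named by its place, so
  quantifiers over vertices become quantifiers over one- and two-vertex extensions of \<open>A\<close>.  Hence
  \<open>G \<preceq> H\<close> holds iff \<open>G\<close> and \<open>H\<close> have codes over the same \<open>A\<close> such that the map preserving places
  preserves arcs and loops.
\<close>

section \<open>Definable predicates on environments\<close>

text \<open>A formula about isomorphism types has no access to vertices, and two digraphs cannot be
  compared vertex by vertex unless something common to both names their vertices. A finite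
  transitive tournament does this because it is rigid: its only automorphism is the identity, so a
  place is a number with the same meaning in the code of \<open>G\<close> and in the code of
  \<open>H\<close>. The second frame only serves to cut \<open>G\<close> out again; it is looped
  while the first is loopless, which keeps the two apart in a common substructure. Two defects of
  types shape the formulas. A two-vertex extension does not order its new vertices, so arcs are
  described relative to the order of the places. One-vertex extensions with the same place but
  different loops have different types, so equality of their places is expressed through a common
  upper cover.\<close>

definition definable :: "('a \<Rightarrow> 'a \<Rightarrow> bool) \<Rightarrow> 'a list \<Rightarrow> ((nat \<Rightarrow> 'a) \<Rightarrow> bool) \<Rightarrow> bool" where
  "definable r cs P \<longleftrightarrow>
    (\<exists>\<phi>. consts_of \<phi> \<subseteq> {..<length cs} \<and> (\<forall>e. satisfies r cs e \<phi> \<longleftrightarrow> P e))"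

lemma finite_free_vars: "finite (free_vars \<phi>)"
proof -
  have "finite (term_vars t)" for t by (cases t) auto
  then show ?thesis by (induction \<phi>) auto
qed

lemma satisfies_cong:
  "(\<And>x. x \<in> free_vars \<phi> \<Longrightarrow> e x = e' x) \<Longrightarrow> satisfies r cs e \<phi> \<longleftrightarrow> satisfies r cs e' \<phi>"
proof (induction \<phi> arbitrary: e e')
  case (Le s t) then show ?case by (cases s; cases t) auto
next
  case (Eq s t) then show ?case by (cases s; cases t) auto
next
  case (Neg \<phi>)
  have "satisfies r cs e \<phi> \<longleftrightarrow> satisfies r cs e' \<phi>" by (rule Neg.IH) (simp add: Neg.prems)
  then show ?case by simp
next
  case (Conj \<phi> \<psi>)
  have "satisfies r cs e \<phi> \<longleftrightarrow> satisfies r cs e' \<phi>" "satisfies r cs e \<psi> \<longleftrightarrow> satisfies r cs e' \<psi>"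
    by (rule Conj.IH, simp add: Conj.prems)+
  then show ?case by simp
next
  case (Exists x \<phi>)
  have "satisfies r cs (e(x := a)) \<phi> \<longleftrightarrow> satisfies r cs (e'(x := a)) \<phi>" for a
    by (rule Exists.IH) (simp add: Exists.prems)
  then show ?case by simp
qed

text \<open>The map \<open>f\<close> need not be injective, so under a quantifier the bound variable
  is replaced by one outside the \<open>f\<close>-image of the free variables of the body. The
  statement is existential because nothing else about this fresh choice matters.\<close>

lemma satisfies_rename:
  "\<exists>\<psi>. consts_of \<psi> = consts_of \<phi> \<and> (\<forall>e. satisfies r cs e \<psi> \<longleftrightarrow> satisfies r cs (e \<circ> f) \<phi>)"
proof (induction \<phi> arbitrary: f)
  case (Le s t)
  let ?r = "\<lambda>t. case t of Var x \<Rightarrow> Var (f x) | Const i \<Rightarrow> Const i"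
  show ?case by (intro exI[of _ "Le (?r s) (?r t)"]) (cases s; cases t; simp)
next
  case (Eq s t)
  let ?r = "\<lambda>t. case t of Var x \<Rightarrow> Var (f x) | Const i \<Rightarrow> Const i"
  show ?case by (intro exI[of _ "Eq (?r s) (?r t)"]) (cases s; cases t; simp)
next
  case (Neg \<phi>)
  from Neg[of f] obtain \<psi> where "consts_of \<psi> = consts_of \<phi>"
    "\<forall>e. satisfies r cs e \<psi> \<longleftrightarrow> satisfies r cs (e \<circ> f) \<phi>" by blast
  then show ?case by (intro exI[of _ "Neg \<psi>"]) (simp add: o_def)
next
  case (Conj \<phi>1 \<phi>2)
  from Conj.IH(1)[of f] obtain \<psi>1 where 1: "consts_of \<psi>1 = consts_of \<phi>1"
    "\<forall>e. satisfies r cs e \<psi>1 \<longleftrightarrow> satisfies r cs (e \<circ> f) \<phi>1" by blast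
  from Conj.IH(2)[of f] obtain \<psi>2 where 2: "consts_of \<psi>2 = consts_of \<phi>2"
    "\<forall>e. satisfies r cs e \<psi>2 \<longleftrightarrow> satisfies r cs (e \<circ> f) \<phi>2" by blast
  from 1 2 show ?case by (intro exI[of _ "Conj \<psi>1 \<psi>2"]) (simp add: o_def)
next
  case (Exists x \<phi>)
  obtain y where y: "y \<notin> f ` free_vars \<phi>"
    using ex_new_if_finite[OF infinite_UNIV_nat] finite_free_vars by blast
  from Exists.IH[of "f(x := y)"] obtain \<psi> where \<psi>: "consts_of \<psi> = consts_of \<phi>"
    "\<And>e. satisfies r cs e \<psi> \<longleftrightarrow> satisfies r cs (e \<circ> f(x := y)) \<phi>" by blast
  have "satisfies r cs (e(y := a)) \<psi> \<longleftrightarrow> satisfies r cs ((e \<circ> f)(x := a)) \<phi>" for e a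
    unfolding \<psi>(2) by (rule satisfies_cong) (use y in auto)
  then show ?case using \<psi>(1) by (intro exI[of _ "Exists y \<psi>"]) (simp add: o_def)
qed

lemma definable_le: "definable r cs (\<lambda>e. r (e i) (e j))"
  unfolding definable_def by (intro exI[of _ "Le (Var i) (Var j)"]) simp

lemma definable_eq: "definable r cs (\<lambda>e. e i = e j)"
  unfolding definable_def by (intro exI[of _ "Eq (Var i) (Var j)"]) simp

lemma definable_const_le:
  assumes "c \<in> set cs" shows "definable r cs (\<lambda>e. r c (e i))"
proof -
  obtain k where "k < length cs" "cs ! k = c" using assms by (auto simp: in_set_conv_nth)
  then show ?thesis
    unfolding definable_def by (intro exI[of _ "Le (Const k) (Var i)"]) simp
qed

lemma definable_not:
  assumes "definable r cs P" shows "definable r cs (\<lambda>e. \<not> P e)"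
proof -
  obtain \<phi> where "consts_of \<phi> \<subseteq> {..<length cs}" "\<forall>e. satisfies r cs e \<phi> \<longleftrightarrow> P e"
    using assms unfolding definable_def by blast
  then show ?thesis unfolding definable_def by (intro exI[of _ "Neg \<phi>"]) simp
qed

lemma definable_conj:
  assumes "definable r cs P" "definable r cs Q" shows "definable r cs (\<lambda>e. P e \<and> Q e)"
proof -
  obtain \<phi> \<psi> where "consts_of \<phi> \<subseteq> {..<length cs}" "\<forall>e. satisfies r cs e \<phi> \<longleftrightarrow> P e"
    "consts_of \<psi> \<subseteq> {..<length cs}" "\<forall>e. satisfies r cs e \<psi> \<longleftrightarrow> Q e"
    using assms unfolding definable_def by blast
  then show ?thesis unfolding definable_def by (intro exI[of _ "Conj \<phi> \<psi>"]) simp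
qed

lemma definable_disj:
  assumes "definable r cs P" "definable r cs Q" shows "definable r cs (\<lambda>e. P e \<or> Q e)"
proof -
  have "definable r cs (\<lambda>e. \<not> (\<not> P e \<and> \<not> Q e))"
    by (intro definable_not definable_conj assms)
  then show ?thesis by simp
qed

lemma definable_imp:
  assumes "definable r cs P" "definable r cs Q" shows "definable r cs (\<lambda>e. P e \<longrightarrow> Q e)"
  unfolding imp_conv_disj by (intro definable_not definable_disj assms)

lemma definable_iff:
  assumes "definable r cs P" "definable r cs Q" shows "definable r cs (\<lambda>e. P e \<longleftrightarrow> Q e)"
  unfolding iff_conv_conj_imp by (intro definable_conj definable_imp assms)

lemma definable_False: "definable r cs (\<lambda>e. False)"
  using definable_conj[OF definable_eq[of r cs 0 0] definable_not[OF definable_eq[of r cs 0 0]]]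
  by simp

lemma definable_exists_update:
  assumes "definable r cs P" shows "definable r cs (\<lambda>e. \<exists>a. P (e(x := a)))"
proof -
  obtain \<phi> where "consts_of \<phi> \<subseteq> {..<length cs}" "\<forall>e. satisfies r cs e \<phi> \<longleftrightarrow> P e"
    using assms unfolding definable_def by blast
  then show ?thesis unfolding definable_def by (intro exI[of _ "Exists x \<phi>"]) simp
qed

text \<open>The premise of the next rule treats the bound variable as the de Bruijn index \<open>0\<close>.\<close>

lemma definable_ex:
  assumes "definable r cs (\<lambda>e. P (\<lambda>n. e (Suc n)) (e 0))"
  shows "definable r cs (\<lambda>e. \<exists>a. P e a)"
proof -
  obtain \<phi> where \<phi>: "consts_of \<phi> \<subseteq> {..<length cs}"
    "\<And>e. satisfies r cs e \<phi> \<longleftrightarrow> P (\<lambda>n. e (Suc n)) (e 0)"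
    using assms unfolding definable_def by blast
  \<comment> \<open>The map \<open>f\<close> below undoes the shift of the premise: index 0 goes to
    the fresh \<open>y\<close>, and \<open>Suc m\<close> to \<open>m\<close>. The predecessors of
    the free variables contain every index that \<open>f\<close> reaches from them besides
    \<open>y\<close>.\<close>
  obtain y where y: "y \<notin> (\<lambda>n. n - 1) ` free_vars \<phi>"
    using ex_new_if_finite[OF infinite_UNIV_nat] finite_free_vars by blast
  define f where "f n = (case n of 0 \<Rightarrow> y | Suc m \<Rightarrow> m)" for n
  obtain \<psi> where \<psi>: "consts_of \<psi> = consts_of \<phi>"
    "\<And>e. satisfies r cs e \<psi> \<longleftrightarrow> satisfies r cs (e \<circ> f) \<phi>"
    using satisfies_rename by blast
  have "satisfies r cs (e(y := a)) \<psi> \<longleftrightarrow> P e a" for e a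
  proof -
    have "satisfies r cs (e(y := a)) \<psi> \<longleftrightarrow> satisfies r cs (case_nat a e) \<phi>"
      unfolding \<psi>(2) by (rule satisfies_cong) (use y in \<open>force simp: f_def split: nat.splits\<close>)
    then show ?thesis by (simp add: \<phi>(2))
  qed
  then show ?thesis using \<phi>(1) \<psi>(1)
    unfolding definable_def by (intro exI[of _ "Exists y \<psi>"]) simp
qed

lemma definable_all:
  assumes "definable r cs (\<lambda>e. P (\<lambda>n. e (Suc n)) (e 0))"
  shows "definable r cs (\<lambda>e. \<forall>a. P e a)"
proof -
  have "definable r cs (\<lambda>e. \<not> (\<exists>a. \<not> P e a))"
    by (intro definable_not definable_ex assms)
  then show ?thesis by simp
qed

lemma definable_finite_lower:
  assumes "finite C" "C \<subseteq> set cs" shows "definable r cs (\<lambda>e. \<exists>c\<in>C. r c (e i))"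
  using assms
proof (induction C rule: finite_induct)
  case (insert c C)
  then have "definable r cs (\<lambda>e. r c (e i) \<or> (\<exists>c\<in>C. r c (e i)))"
    by (intro definable_disj definable_const_le) auto
  then show ?case by simp
qed (simp add: definable_False)

section \<open>From environment predicates to relations on tuples\<close>

lemma close_formula:
  assumes "finite A"
  shows "\<exists>\<psi>. free_vars \<psi> = free_vars \<phi> - A \<and> consts_of \<psi> = consts_of \<phi> \<and>
    (\<forall>e. satisfies r cs e \<psi> \<longleftrightarrow> (\<exists>e'. (\<forall>x. x \<notin> A \<longrightarrow> e' x = e x) \<and> satisfies r cs e' \<phi>))"
  using assms
proof (induction A rule: finite_induct)
  case empty
  have "e' = e" if "\<forall>x. e' x = e x" for e e' :: "nat \<Rightarrow> 'a" using that by auto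
  then show ?case by (intro exI[of _ \<phi>]) auto
next
  case (insert y A)
  then obtain \<psi> where \<psi>: "free_vars \<psi> = free_vars \<phi> - A" "consts_of \<psi> = consts_of \<phi>"
    "\<And>e. satisfies r cs e \<psi> \<longleftrightarrow> (\<exists>e'. (\<forall>x. x \<notin> A \<longrightarrow> e' x = e x) \<and> satisfies r cs e' \<phi>)" by blast
  have "(\<exists>a e'. (\<forall>x. x \<notin> A \<longrightarrow> e' x = (e(y := a)) x) \<and> satisfies r cs e' \<phi>) \<longleftrightarrow>
    (\<exists>e'. (\<forall>x. x \<notin> insert y A \<longrightarrow> e' x = e x) \<and> satisfies r cs e' \<phi>)" for e
  proof
    assume "\<exists>a e'. (\<forall>x. x \<notin> A \<longrightarrow> e' x = (e(y := a)) x) \<and> satisfies r cs e' \<phi>"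
    then obtain a e' where "\<forall>x. x \<notin> A \<longrightarrow> e' x = (e(y := a)) x" "satisfies r cs e' \<phi>" by blast
    then show "\<exists>e'. (\<forall>x. x \<notin> insert y A \<longrightarrow> e' x = e x) \<and> satisfies r cs e' \<phi>"
      by (intro exI[of _ e']) auto
  next
    assume "\<exists>e'. (\<forall>x. x \<notin> insert y A \<longrightarrow> e' x = e x) \<and> satisfies r cs e' \<phi>"
    then obtain e' where "\<forall>x. x \<notin> insert y A \<longrightarrow> e' x = e x" "satisfies r cs e' \<phi>" by blast
    then show "\<exists>a e'. (\<forall>x. x \<notin> A \<longrightarrow> e' x = (e(y := a)) x) \<and> satisfies r cs e' \<phi>"
      by (intro exI[of _ "e' y"] exI[of _ e']) auto
  qed
  then show ?case using \<psi> by (intro exI[of _ "Exists y \<psi>"]) auto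
qed

text \<open>\<open>definable\<close> puts no bound on the free variables,
  \<open>fo_definable\<close> does. The surplus variables are quantified away existentially; as
  \<open>P\<close> reads only the first \<open>n\<close> entries, its truth does not change, and the
  unspecified values of \<open>as ! x\<close> beyond the length do no harm.\<close>

lemma definable_imp_fo_definable:
  assumes "definable r cs P"
    and dep: "\<And>e e'. (\<And>x. x < n \<Longrightarrow> e x = e' x) \<Longrightarrow> P e \<longleftrightarrow> P e'"
  shows "fo_definable r cs n {as. length as = n \<and> P (\<lambda>x. as ! x)}"
proof -
  obtain \<phi> where \<phi>: "consts_of \<phi> \<subseteq> {..<length cs}" "\<And>e. satisfies r cs e \<phi> \<longleftrightarrow> P e"
    using assms(1) unfolding definable_def by blast
  obtain \<psi> where \<psi>: "free_vars \<psi> = free_vars \<phi> - (free_vars \<phi> - {..<n})"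
      "consts_of \<psi> = consts_of \<phi>"
      "\<And>e. satisfies r cs e \<psi> \<longleftrightarrow>
        (\<exists>e'. (\<forall>x. x \<notin> free_vars \<phi> - {..<n} \<longrightarrow> e' x = e x) \<and> satisfies r cs e' \<phi>)"
    using close_formula[of "free_vars \<phi> - {..<n}" \<phi> r cs] finite_free_vars by (metis finite_Diff)
  have "satisfies r cs e \<psi> \<longleftrightarrow> P e" for e
  proof
    assume "satisfies r cs e \<psi>"
    then obtain e' where "\<forall>x. x \<notin> free_vars \<phi> - {..<n} \<longrightarrow> e' x = e x" "P e'"
      unfolding \<psi>(3) \<phi>(2) by blast
    moreover from this(1) have "P e' \<longleftrightarrow> P e" by (intro dep) simp
    ultimately show "P e" by simp
  next
    assume "P e"
    then show "satisfies r cs e \<psi>" unfolding \<psi>(3) \<phi>(2) by blast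
  qed
  then show ?thesis using \<phi>(1) \<psi>(1,2)
    unfolding fo_definable_def by (intro exI[of _ \<psi>]) auto
qed

text \<open>The definition of \<open>r'\<close> replaces its atoms on the level of predicates, by
  induction on the formula; no formula is substituted into another, so variable capture cannot
  occur.\<close>

lemma definable_satisfies:
  assumes r': "\<And>i j. definable r cs (\<lambda>e. r' (e i) (e j))"
  shows "consts_of \<phi> = {} \<Longrightarrow> definable r cs (\<lambda>e. satisfies r' [] e \<phi>)"
proof (induction \<phi>)
  case (Le s t) then show ?case by (cases s; cases t) (simp_all add: r')
next
  case (Eq s t) then show ?case by (cases s; cases t) (simp_all add: definable_eq)
next
  case (Neg \<phi>) then show ?case by (auto intro: definable_not)
next
  case (Conj \<phi> \<psi>) then show ?case by (auto intro: definable_conj)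
next
  case (Exists x \<phi>)
  then show ?case using definable_exists_update[of r cs "\<lambda>e. satisfies r' [] e \<phi>" x] by simp
qed

lemma fo_definable_reduct:
  assumes r': "\<And>i j. definable r cs (\<lambda>e. r' (e i) (e j))" and R: "fo_definable r' [] n R"
  shows "fo_definable r cs n R"
proof -
  obtain \<phi> where \<phi>: "free_vars \<phi> \<subseteq> {..<n}" "consts_of \<phi> = {}"
    and R_eq: "R = {as. length as = n \<and> satisfies r' [] (\<lambda>x. as ! x) \<phi>}"
    using R unfolding fo_definable_def by auto
  have "definable r cs (\<lambda>e. satisfies r' [] e \<phi>)"
    by (rule definable_satisfies) (simp_all add: r' \<phi>(2))
  then show ?thesis unfolding R_eq
    by (rule definable_imp_fo_definable) (use \<phi>(1) in \<open>auto intro!: satisfies_cong\<close>)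
qed

section \<open>Isomorphism types of concrete digraphs\<close>

definition graph_on :: "'v set \<Rightarrow> ('v \<Rightarrow> 'v \<Rightarrow> bool) \<Rightarrow> 'v pair_pre_digraph" where
  "graph_on V E = \<lparr>pverts = V, parcs = {(u, v). u \<in> V \<and> v \<in> V \<and> E u v}\<rparr>"

text \<open>The vertex type is arbitrary, so that codes can be built over a datatype of labelled
  vertices. For an empty or infinite \<open>V\<close> no representative exists and the value is
  arbitrary, which explains the premises of finiteness and nonemptiness below.\<close>

definition gt :: "'v set \<Rightarrow> ('v \<Rightarrow> 'v \<Rightarrow> bool) \<Rightarrow> digraph_type" where
  "gt V E = abs_digraph_type (SOME H. finite_digraph H \<and> isomorphic (graph_on V E) H)"

lemma graph_on_wf: "pair_wf_digraph (graph_on V E)"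
  by unfold_locales (auto simp: graph_on_def)

lemma finite_digraph_graph_on: "finite V \<Longrightarrow> V \<noteq> {} \<Longrightarrow> finite_digraph (graph_on V E)"
proof -
  assume V: "finite V" "V \<noteq> {}"
  have "finite {(u, v). u \<in> V \<and> v \<in> V \<and> E u v}"
    by (rule finite_subset[of _ "V \<times> V"]) (use V in auto)
  then have "pair_fin_digraph (graph_on V E)"
    by unfold_locales (use V in \<open>auto simp: graph_on_def\<close>)
  then show ?thesis using V by (simp add: finite_digraph_def graph_on_def)
qed

lemma gt_rep:
  assumes "finite V" "V \<noteq> {}"
  obtains H where "finite_digraph H" "isomorphic (graph_on V E) H" "gt V E = abs_digraph_type H"
proof -
  let ?P = "\<lambda>H :: nat pair_pre_digraph. finite_digraph H \<and> isomorphic (graph_on V E) H"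
  have "?P (SOME H. ?P H)"
    by (rule someI_ex) (rule finite_digraph_nat_representative[OF finite_digraph_graph_on[OF assms]])
  then show ?thesis using that unfolding gt_def by blast
qed

lemma finite_digraph_eq_graph_on:
  "finite_digraph G \<Longrightarrow> G = graph_on (pverts G) (\<lambda>u v. (u, v) \<in> parcs G)"
proof -
  assume "finite_digraph G"
  then interpret pair_fin_digraph G by (simp add: finite_digraph_def)
  show ?thesis
    unfolding graph_on_def by (rule pair_pre_digraph.equality) (auto dest: in_arcsD1 in_arcsD2)
qed

lemma iso_rel_refl: "iso_rel H H \<longleftrightarrow> finite_digraph H"
  unfolding iso_rel_def finite_digraph_def pair_fin_digraph_def by (auto intro: isomorphic_refl)

lemma gt_cases:
  fixes t :: digraph_type
  obtains V :: "nat set" and E where "finite V" "V \<noteq> {}" "t = gt V E"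
proof -
  obtain H where H: "iso_rel H H" "t = abs_digraph_type H"
    using Quotient_abs_rep[OF Quotient_digraph_type] Quotient_rep_reflp[OF Quotient_digraph_type]
    by metis
  then have fin: "finite_digraph H" by (simp add: iso_rel_refl)
  let ?E = "\<lambda>u v. (u, v) \<in> parcs H"
  have V: "finite (pverts H)" "pverts H \<noteq> {}"
    using fin by (auto simp: finite_digraph_def intro: pair_fin_digraph.pair_finite_verts)
  obtain K where K: "finite_digraph K" "isomorphic (graph_on (pverts H) ?E) K"
      "gt (pverts H) ?E = abs_digraph_type K"
    using gt_rep[OF V] by metis
  have "iso_rel H K"
    using K fin finite_digraph_eq_graph_on[OF fin] by (simp add: iso_rel_def)
  then have "t = gt (pverts H) ?E"
    using H K(3) Quotient_rel[OF Quotient_digraph_type] by (metis (full_types) iso_rel_refl K(1))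
  then show ?thesis using that V by blast
qed

lemma isomorphic_graph_on:
  "isomorphic (graph_on V E) (graph_on W F) \<longleftrightarrow>
    (\<exists>f. bij_betw f V W \<and> (\<forall>x\<in>V. \<forall>y\<in>V. E x y \<longleftrightarrow> F (f x) (f y)))"
proof -
  have eq: "{(u, v). u \<in> W \<and> v \<in> W \<and> F u v} = map_prod f f ` {(u, v). u \<in> V \<and> v \<in> V \<and> E u v} \<longleftrightarrow>
      (\<forall>x\<in>V. \<forall>y\<in>V. E x y \<longleftrightarrow> F (f x) (f y))" (is "?A = ?B \<longleftrightarrow> ?C")
    if f: "bij_betw f V W" for f
  proof
    have inj: "inj_on f V" and W: "W = f ` V" using f by (auto simp: bij_betw_def)
    assume eq: "?A = ?B"
    show ?C
    proof (intro ballI)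
      fix x y assume xy: "x \<in> V" "y \<in> V"
      have "F (f x) (f y) \<longleftrightarrow> (f x, f y) \<in> ?A" using xy W by auto
      also have "\<dots> \<longleftrightarrow> (\<exists>u v. u \<in> V \<and> v \<in> V \<and> E u v \<and> f x = f u \<and> f y = f v)"
        unfolding eq by auto
      also have "\<dots> \<longleftrightarrow> E x y" using xy inj by (auto dest: inj_onD)
      finally show "E x y \<longleftrightarrow> F (f x) (f y)" by simp
    qed
  next
    assume C: ?C
    have W: "W = f ` V" using f by (simp add: bij_betw_def)
    show "?A = ?B"
    proof (intro subset_antisym subrelI)
      fix u v assume "(u, v) \<in> ?A"
      then obtain x y where "x \<in> V" "y \<in> V" "u = f x" "v = f y" "F u v" by (auto simp: W)
      then show "(u, v) \<in> ?B" using C by (intro image_eqI[of _ _ "(x, y)"]) auto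
    next
      fix u v assume "(u, v) \<in> ?B"
      then show "(u, v) \<in> ?A" using C by (auto simp: W)
    qed
  qed
  have "isomorphic (graph_on V E) (graph_on W F) \<longleftrightarrow> (\<exists>f. bij_betw f V W \<and>
      {(u, v). u \<in> W \<and> v \<in> W \<and> F u v} = map_prod f f ` {(u, v). u \<in> V \<and> v \<in> V \<and> E u v})"
    unfolding isomorphic_iff using graph_on_wf[of V E]
    by (simp add: graph_on_def bij_betw_def) blast
  also have "\<dots> \<longleftrightarrow> (\<exists>f. bij_betw f V W \<and> (\<forall>x\<in>V. \<forall>y\<in>V. E x y \<longleftrightarrow> F (f x) (f y)))"
    by (intro ex_cong1 conj_cong refl eq)
  finally show ?thesis .
qed

lemma gt_eq_iff:
  fixes V :: "'v set" and W :: "'w set"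
  assumes "finite V" "V \<noteq> {}" "finite W" "W \<noteq> {}"
  shows "gt V E = gt W F \<longleftrightarrow>
    (\<exists>f. bij_betw f V W \<and> (\<forall>x\<in>V. \<forall>y\<in>V. E x y \<longleftrightarrow> F (f x) (f y)))"
proof -
  obtain H where H: "finite_digraph H" "isomorphic (graph_on V E) H" "gt V E = abs_digraph_type H"
    using gt_rep assms by metis
  obtain K where K: "finite_digraph K" "isomorphic (graph_on W F) K" "gt W F = abs_digraph_type K"
    using gt_rep assms by metis
  have "gt V E = gt W F \<longleftrightarrow> iso_rel H K"
    using H K Quotient_rel[OF Quotient_digraph_type] by (metis iso_rel_refl)
  also have "\<dots> \<longleftrightarrow> isomorphic (graph_on V E) (graph_on W F)"
    using H K unfolding iso_rel_def by (meson isomorphic_sym isomorphic_trans)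
  finally show ?thesis unfolding isomorphic_graph_on .
qed

lemma gt_cong:
  assumes "\<And>x y. x \<in> V \<Longrightarrow> y \<in> V \<Longrightarrow> E x y \<longleftrightarrow> F x y"
  shows "gt V E = gt V F"
proof -
  have "graph_on V E = graph_on V F" using assms by (auto simp: graph_on_def)
  then show ?thesis unfolding gt_def by simp
qed

lemma embeddable_gt_iff:
  fixes V :: "'v set" and W :: "'w set"
  assumes "finite V" "V \<noteq> {}" "finite W" "W \<noteq> {}"
  shows "gt V E \<preceq> gt W F \<longleftrightarrow>
    (\<exists>f. inj_on f V \<and> f ` V \<subseteq> W \<and> (\<forall>x\<in>V. \<forall>y\<in>V. E x y \<longrightarrow> F (f x) (f y)))"
proof -
  obtain H where H: "finite_digraph H" "isomorphic (graph_on V E) H" "gt V E = abs_digraph_type H"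
    using gt_rep assms by metis
  obtain K where K: "finite_digraph K" "isomorphic (graph_on W F) K" "gt W F = abs_digraph_type K"
    using gt_rep assms by metis
  have "gt V E \<preceq> gt W F \<longleftrightarrow> embeddable H K"
    using H K by (simp add: embeddable_type.abs_eq iso_rel_refl)
  also have "\<dots> \<longleftrightarrow> embeddable (graph_on V E) (graph_on W F)"
    using H K by (meson isomorphic_sym embeddable_trans isomorphic_imp_embeddable)
  also have "\<dots> \<longleftrightarrow> (\<exists>f. inj_on f V \<and> f ` V \<subseteq> W \<and> (\<forall>x\<in>V. \<forall>y\<in>V. E x y \<longrightarrow> F (f x) (f y)))"
    unfolding embeddable_def by (intro ex_cong1) (auto simp: graph_on_def image_subset_iff)
  finally show ?thesis .
qed

lemma induced_subgraph_graph_on_iff: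
  "induced_subgraph (with_proj K) (with_proj (graph_on W F)) \<longleftrightarrow> (\<exists>A\<subseteq>W. K = graph_on A F)"
proof
  assume K: "induced_subgraph (with_proj K) (with_proj (graph_on W F))"
  then have V: "pverts K \<subseteq> W"
    unfolding induced_subgraph_def subgraph_def by (simp add: graph_on_def)
  have "parcs K = {e \<in> parcs (graph_on W F). fst e \<in> pverts K \<and> snd e \<in> pverts K}"
    using K unfolding induced_subgraph_def by simp
  also have "\<dots> = parcs (graph_on (pverts K) F)"
    using V unfolding graph_on_def by auto
  finally have "K = graph_on (pverts K) F"
    by (intro pair_pre_digraph.equality) (simp_all add: graph_on_def)
  then show "\<exists>A\<subseteq>W. K = graph_on A F" using V by blast
next
  assume "\<exists>A\<subseteq>W. K = graph_on A F"
  then obtain A where A: "A \<subseteq> W" "K = graph_on A F" by blast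
  have "pverts K = A" "pverts (graph_on W F) = W"
    and arcs: "parcs K = {e \<in> parcs (graph_on W F). fst e \<in> A \<and> snd e \<in> A}"
    using A by (auto simp: graph_on_def)
  then show "induced_subgraph (with_proj K) (with_proj (graph_on W F))"
    unfolding induced_subgraph_def subgraph_def compatible_def
    using A(1) graph_on_wf[of A F] graph_on_wf[of W F]
    by (simp add: wf_digraph_wp_iff A(2))
qed

lemma substructure_graph_on_iff:
  "substructure G (graph_on W F) \<longleftrightarrow> (\<exists>A\<subseteq>W. isomorphic G (graph_on A F))"
  unfolding substructure_def induced_subgraph_graph_on_iff by auto

lemma sub_gt_iff:
  fixes W :: "'w set"
  assumes "finite W" "W \<noteq> {}"
  shows "t \<sqsubseteq> gt W F \<longleftrightarrow> (\<exists>A\<subseteq>W. A \<noteq> {} \<and> t = gt A F)"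
proof -
  obtain V :: "nat set" and E where V: "finite V" "V \<noteq> {}" "t = gt V E" using gt_cases by metis
  obtain H where H: "finite_digraph H" "isomorphic (graph_on V E) H" "gt V E = abs_digraph_type H"
    using gt_rep V(1,2) by metis
  obtain K where K: "finite_digraph K" "isomorphic (graph_on W F) K" "gt W F = abs_digraph_type K"
    using gt_rep assms by metis
  have "gt V E \<sqsubseteq> gt W F \<longleftrightarrow> substructure H K"
    using H K by (simp add: substructure_type.abs_eq iso_rel_refl)
  also have "\<dots> \<longleftrightarrow> substructure H (graph_on W F)"
    using K(2) by (meson isomorphic_sym substructure_isomorphic_right)
  also have "\<dots> \<longleftrightarrow> (\<exists>A\<subseteq>W. isomorphic H (graph_on A F))"
    by (rule substructure_graph_on_iff)
  also have "\<dots> \<longleftrightarrow> (\<exists>A\<subseteq>W. isomorphic (graph_on V E) (graph_on A F))"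
    using H(2) by (meson isomorphic_sym isomorphic_trans)
  also have "\<dots> \<longleftrightarrow> (\<exists>A\<subseteq>W. A \<noteq> {} \<and> gt V E = gt A F)"
    unfolding isomorphic_graph_on
  proof (intro ex_cong1 conj_cong refl)
    fix A assume A: "A \<subseteq> W"
    then have "finite A" using assms finite_subset by blast
    then show "(\<exists>f. bij_betw f V A \<and> (\<forall>x\<in>V. \<forall>y\<in>V. E x y = F (f x) (f y))) \<longleftrightarrow>
        A \<noteq> {} \<and> gt V E = gt A F"
      using gt_eq_iff[of V A E F] V(1,2) by (cases "A = {}") (auto simp: bij_betw_def)
  qed
  finally show ?thesis using V(3) by simp
qed

lemma gt_sub_gt_iff:
  fixes V :: "'v set" and W :: "'w set"
  assumes "finite V" "V \<noteq> {}" "finite W" "W \<noteq> {}"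
  shows "gt V E \<sqsubseteq> gt W F \<longleftrightarrow>
    (\<exists>f. inj_on f V \<and> f ` V \<subseteq> W \<and> (\<forall>x\<in>V. \<forall>y\<in>V. E x y \<longleftrightarrow> F (f x) (f y)))" (is "_ \<longleftrightarrow> ?R")
proof -
  have "gt V E \<sqsubseteq> gt W F \<longleftrightarrow> (\<exists>A\<subseteq>W. A \<noteq> {} \<and> gt V E = gt A F)"
    using assms(3,4) by (rule sub_gt_iff)
  also have "\<dots> \<longleftrightarrow> (\<exists>A\<subseteq>W. \<exists>f. bij_betw f V A \<and> (\<forall>x\<in>V. \<forall>y\<in>V. E x y \<longleftrightarrow> F (f x) (f y)))"
  proof (intro ex_cong1 conj_cong refl)
    fix A assume "A \<subseteq> W"
    then have "finite A" using assms(3) finite_subset by blast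
    then show "A \<noteq> {} \<and> gt V E = gt A F \<longleftrightarrow>
        (\<exists>f. bij_betw f V A \<and> (\<forall>x\<in>V. \<forall>y\<in>V. E x y \<longleftrightarrow> F (f x) (f y)))"
      using gt_eq_iff[of V A E F] assms(1,2) by (cases "A = {}") (auto simp: bij_betw_def)
  qed
  also have "\<dots> \<longleftrightarrow> ?R" unfolding bij_betw_def by blast
  finally show ?thesis .
qed

lemma gt_image:
  assumes "finite V" "V \<noteq> {}" "inj_on f V"
    and "\<And>x y. x \<in> V \<Longrightarrow> y \<in> V \<Longrightarrow> E x y \<longleftrightarrow> F (f x) (f y)"
  shows "gt (f ` V) F = gt V E"
proof -
  have "gt V E = gt (f ` V) F"
    using assms by (subst gt_eq_iff) (auto simp: bij_betw_def)
  then show ?thesis by simp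
qed

lemma gt_card_eq:
  assumes "finite V" "V \<noteq> {}" "finite W" "W \<noteq> {}" "gt V E = gt W F"
  shows "card V = card W"
  using assms gt_eq_iff bij_betw_same_card by metis

text \<open>This rests on finiteness: composing the two inclusions gives a copy of \<open>t\<close>
  on a vertex subset of \<open>t\<close> itself, and equal cardinality forces that subset to be
  everything.\<close>

lemma sub_antisym: "s \<sqsubseteq> t \<Longrightarrow> t \<sqsubseteq> s \<Longrightarrow> s = t"
proof -
  assume st: "s \<sqsubseteq> t" "t \<sqsubseteq> s"
  obtain V :: "nat set" and E where V: "finite V" "V \<noteq> {}" "t = gt V E" using gt_cases by metis
  then obtain A where A: "A \<subseteq> V" "A \<noteq> {}" "s = gt A E" using st sub_gt_iff[of V] by metis
  have fA: "finite A" using A V finite_subset by blast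
  then obtain B where B: "B \<subseteq> A" "B \<noteq> {}" "t = gt B E" using st A sub_gt_iff[of A] by metis
  have "card B = card V" using gt_card_eq[of B V E E] B V fA finite_subset by metis
  then have "card V \<le> card A" using B fA card_mono by metis
  then have "A = V" using A V card_seteq by metis
  then show "s = t" using A V by simp
qed

section \<open>Covers and bounded patterns\<close>

definition cover :: "digraph_type \<Rightarrow> digraph_type \<Rightarrow> bool" where
  "cover s t \<longleftrightarrow> s \<sqsubseteq> t \<and> s \<noteq> t \<and> (\<forall>y. s \<sqsubseteq> y \<and> y \<sqsubseteq> t \<longrightarrow> y = s \<or> y = t)"

definition ext1 :: "digraph_type \<Rightarrow> digraph_type \<Rightarrow> digraph_type \<Rightarrow> bool" where
  "ext1 t z x \<longleftrightarrow> cover t z \<and> z \<sqsubseteq> x"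

definition ext2 :: "digraph_type \<Rightarrow> digraph_type \<Rightarrow> digraph_type \<Rightarrow> bool" where
  "ext2 t w x \<longleftrightarrow> (\<exists>y. cover t y \<and> cover y w \<and> w \<sqsubseteq> x)"

lemma gt_mono:
  assumes "finite V" "A \<subseteq> V" "A \<noteq> {}"
  shows "gt A E \<sqsubseteq> gt V E"
proof -
  have "V \<noteq> {}" using assms by blast
  then show ?thesis using assms sub_gt_iff[of V "gt A E" E] by blast
qed

text \<open>The order is graded by the number of vertices: a proper subset extends to one that
  misses a single vertex, and nothing fits between cardinalities that differ by one. A type with one
  vertex has no lower cover, since there is no empty digraph.\<close>

lemma cover_gt_iff:
  fixes V :: "'v set"
  assumes V: "finite V" "V \<noteq> {}"
  shows "cover s (gt V E) \<longleftrightarrow> (\<exists>v\<in>V. V - {v} \<noteq> {} \<and> s = gt (V - {v}) E)"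
proof
  assume c: "cover s (gt V E)"
  then obtain A where A: "A \<subseteq> V" "A \<noteq> {}" "s = gt A E"
    using sub_gt_iff[OF V, of s E] unfolding cover_def by blast
  have "A \<noteq> V" using c A(3) by (auto simp: cover_def)
  then obtain v where v: "v \<in> V" "v \<notin> A" using A by blast
  then have ne: "V - {v} \<noteq> {}" using A by blast
  have "A \<subseteq> V - {v}" using A v by blast
  then have "s \<sqsubseteq> gt (V - {v}) E"
    using A V by (simp add: gt_mono)
  moreover have "gt (V - {v}) E \<sqsubseteq> gt V E"
    using V ne by (intro gt_mono) auto
  moreover have "card (V - {v}) \<noteq> card V" using v V by (metis card_Diff1_less less_irrefl)
  then have "gt (V - {v}) E \<noteq> gt V E"
    using gt_card_eq[of "V - {v}" V E E] V ne by auto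
  ultimately have "s = gt (V - {v}) E" using c unfolding cover_def by metis
  then show "\<exists>v\<in>V. V - {v} \<noteq> {} \<and> s = gt (V - {v}) E" using v ne by blast
next
  assume "\<exists>v\<in>V. V - {v} \<noteq> {} \<and> s = gt (V - {v}) E"
  then obtain v where v: "v \<in> V" "V - {v} \<noteq> {}" "s = gt (V - {v}) E" by blast
  have fin: "finite B" if "B \<subseteq> V" for B using that V(1) finite_subset by blast
  have cv: "card (V - {v}) = card V - 1" using v by simp
  have pos: "card V > 0" using V card_gt_0_iff by blast
  have "s \<sqsubseteq> gt V E" unfolding v(3) using V v by (intro gt_mono) auto
  moreover have "s \<noteq> gt V E"
    using gt_card_eq[of "V - {v}" V E E] V v cv pos by auto
  moreover have "y = s \<or> y = gt V E" if y: "s \<sqsubseteq> y" "y \<sqsubseteq> gt V E" for y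
  proof -
    obtain B where B: "B \<subseteq> V" "B \<noteq> {}" "y = gt B E" using y(2) sub_gt_iff[OF V, of y E] by blast
    obtain C where C: "C \<subseteq> B" "C \<noteq> {}" "s = gt C E"
      using y(1) B sub_gt_iff[OF fin[OF B(1)] B(2), of s E] by blast
    have fB: "finite B" and fC: "finite C" using fin B C by auto
    have "gt C E = gt (V - {v}) E" using C v by simp
    then have "card C = card V - 1"
      using gt_card_eq[of C "V - {v}" E E] fC C(2) V(1) v(2) cv by simp
    moreover have "card C \<le> card B" "card B \<le> card V"
      using C(1) B(1) fB V(1) card_mono by auto
    ultimately consider "card B = card V" | "card C = card B" by linarith
    then show ?thesis
    proof cases
      case 1
      then have "B = V" using B(1) V(1) card_subset_eq by blast
      then show ?thesis using B by simp
    next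
      case 2
      then have "C = B" using C(1) fB card_subset_eq by blast
      then show ?thesis using B C by simp
    qed
  qed
  ultimately show "cover s (gt V E)" unfolding cover_def by blast
qed

lemma ext1_gt_iff:
  fixes V :: "'v set"
  assumes V: "finite V" "V \<noteq> {}"
  shows "ext1 t z (gt V E) \<longleftrightarrow>
    (\<exists>A v. A \<subseteq> V \<and> A \<noteq> {} \<and> v \<in> V - A \<and> t = gt A E \<and> z = gt (insert v A) E)"
proof
  assume "ext1 t z (gt V E)"
  then obtain W where W: "W \<subseteq> V" "W \<noteq> {}" "z = gt W E" "cover t z"
    using sub_gt_iff[OF V, of z E] unfolding ext1_def by blast
  then obtain v where "v \<in> W" "W - {v} \<noteq> {}" "t = gt (W - {v}) E"
    using cover_gt_iff[of W t E] finite_subset[OF W(1) V(1)] by blast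
  then show "\<exists>A v. A \<subseteq> V \<and> A \<noteq> {} \<and> v \<in> V - A \<and> t = gt A E \<and> z = gt (insert v A) E"
    using W by (intro exI[of _ "W - {v}"] exI[of _ v]) (auto simp: insert_absorb)
next
  assume "\<exists>A v. A \<subseteq> V \<and> A \<noteq> {} \<and> v \<in> V - A \<and> t = gt A E \<and> z = gt (insert v A) E"
  then obtain A v where A: "A \<subseteq> V" "A \<noteq> {}" "v \<in> V - A" "t = gt A E" "z = gt (insert v A) E"
    by blast
  have "finite (insert v A)" using A V finite_subset by auto
  moreover have "insert v A - {v} = A" using A by auto
  ultimately have "cover t z" using A cover_gt_iff[of "insert v A" t E] by auto
  moreover have "insert v A \<subseteq> V" using A by blast
  then have "z \<sqsubseteq> gt V E" unfolding A(5) using V by (intro gt_mono) auto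
  ultimately show "ext1 t z (gt V E)" unfolding ext1_def by blast
qed

lemma ext2_gt_iff:
  fixes V :: "'v set"
  assumes V: "finite V" "V \<noteq> {}"
  shows "ext2 t w (gt V E) \<longleftrightarrow> (\<exists>A u v. A \<subseteq> V \<and> A \<noteq> {} \<and> u \<in> V - A \<and> v \<in> V - A \<and> u \<noteq> v \<and>
    t = gt A E \<and> w = gt (insert u (insert v A)) E)" (is "_ \<longleftrightarrow> ?R")
proof
  assume "ext2 t w (gt V E)"
  then obtain y where y: "cover t y" "ext1 y w (gt V E)" unfolding ext2_def ext1_def by blast
  then obtain B u where B: "B \<subseteq> V" "B \<noteq> {}" "u \<in> V - B" "y = gt B E" "w = gt (insert u B) E"
    unfolding ext1_gt_iff[OF V] by blast
  have "finite B" using B(1) V(1) finite_subset by blast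
  then obtain v where v: "v \<in> B" "B - {v} \<noteq> {}" "t = gt (B - {v}) E"
    using y(1) B cover_gt_iff[of B t E] by blast
  then show ?R
    using B by (intro exI[of _ "B - {v}"] exI[of _ u] exI[of _ v]) (auto simp: insert_absorb)
next
  assume ?R
  then obtain A u v where A: "A \<subseteq> V" "A \<noteq> {}" "u \<in> V - A" "v \<in> V - A" "u \<noteq> v" "t = gt A E"
    "w = gt (insert u (insert v A)) E" by blast
  have "ext1 t (gt (insert v A) E) (gt V E)"
    unfolding ext1_gt_iff[OF V] using A by (intro exI[of _ A] exI[of _ v]) simp
  moreover have "ext1 (gt (insert v A) E) w (gt V E)"
    unfolding ext1_gt_iff[OF V] using A by (intro exI[of _ "insert v A"] exI[of _ u]) auto
  ultimately show "ext2 t w (gt V E)" unfolding ext2_def ext1_def by blast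
qed

section \<open>Patterns of bounded size\<close>

definition pat :: "nat \<Rightarrow> ((nat \<Rightarrow> nat \<Rightarrow> bool) \<Rightarrow> bool) \<Rightarrow> digraph_type \<Rightarrow> bool" where
  "pat k R t \<longleftrightarrow> (\<exists>M. R M \<and> gt {..<k} M \<sqsubseteq> t)"

text \<open>Without the premise on \<open>R\<close>, the existential matrix in \<open>pat\<close>
  could satisfy \<open>R\<close> through entries outside the first \<open>k\<close> indices, which
  the type does not see.\<close>

lemma pat_gt_iff:
  fixes V :: "'v set"
  assumes V: "finite V" "V \<noteq> {}" and k: "0 < k"
    and cong: "\<And>M M'. (\<And>i j. i < k \<Longrightarrow> j < k \<Longrightarrow> M i j = M' i j) \<Longrightarrow> R M = R M'"
  shows "pat k R (gt V E) \<longleftrightarrow> (\<exists>vs. length vs = k \<and> distinct vs \<and> set vs \<subseteq> V \<and>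
    R (\<lambda>i j. E (vs ! i) (vs ! j)))"
proof
  assume "pat k R (gt V E)"
  then obtain M where M: "R M" "gt {..<k} M \<sqsubseteq> gt V E" unfolding pat_def by blast
  have ne: "finite {..<k}" "{..<k} \<noteq> {}" using k by auto
  obtain f where f: "inj_on f {..<k}" "f ` {..<k} \<subseteq> V"
      "\<forall>x\<in>{..<k}. \<forall>y\<in>{..<k}. M x y \<longleftrightarrow> E (f x) (f y)"
    using M(2) unfolding gt_sub_gt_iff[OF ne V] by blast
  have "R (\<lambda>i j. E (map f [0..<k] ! i) (map f [0..<k] ! j)) = R M"
    by (rule cong) (use f(3) in auto)
  then show "\<exists>vs. length vs = k \<and> distinct vs \<and> set vs \<subseteq> V \<and> R (\<lambda>i j. E (vs ! i) (vs ! j))"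
    using f M(1)
    by (intro exI[of _ "map f [0..<k]"]) (auto simp: distinct_map atLeast0LessThan)
next
  assume "\<exists>vs. length vs = k \<and> distinct vs \<and> set vs \<subseteq> V \<and> R (\<lambda>i j. E (vs ! i) (vs ! j))"
  then obtain vs where vs: "length vs = k" "distinct vs" "set vs \<subseteq> V"
    "R (\<lambda>i j. E (vs ! i) (vs ! j))" by blast
  have ne: "finite {..<k}" "{..<k} \<noteq> {}" using k by auto
  have "gt {..<k} (\<lambda>i j. E (vs ! i) (vs ! j)) \<sqsubseteq> gt V E"
    unfolding gt_sub_gt_iff[OF ne V]
    by (intro exI[of _ "\<lambda>i. vs ! i"])
      (use vs in \<open>auto simp: inj_on_def nth_eq_iff_index_eq\<close>)
  then show "pat k R (gt V E)" using vs(4) unfolding pat_def by blast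
qed

lemma ex_length_Suc: "(\<exists>vs. length vs = Suc n \<and> P vs) \<longleftrightarrow> (\<exists>a vs. length vs = n \<and> P (a # vs))"
  by (auto simp: length_Suc_conv)

text \<open>The largest structural pattern has 7 vertices; the bound 8 comes from the size condition
  on tournaments, which is itself the 8-vertex pattern without restriction.\<close>

definition small_types :: "digraph_type set" where
  "small_types = (\<Union>k\<in>{1..8}. range (gt {..<k :: nat}))"

lemma finite_small_types: "finite small_types"
proof -
  have "finite (range (gt {..<k :: nat}))" for k
  proof (rule finite_subset)
    show "range (gt {..<k}) \<subseteq> (\<lambda>R. gt {..<k} (\<lambda>i j. (i, j) \<in> R)) ` Pow ({..<k} \<times> {..<k})"
    proof (intro subsetI)
      fix t assume "t \<in> range (gt {..<k})"
      then obtain M where "t = gt {..<k} M" by blast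
      also have "\<dots> = gt {..<k} (\<lambda>i j. (i, j) \<in> {(i, j). i < k \<and> j < k \<and> M i j})"
        by (rule gt_cong) auto
      finally show "t \<in> (\<lambda>R. gt {..<k} (\<lambda>i j. (i, j) \<in> R)) ` Pow ({..<k} \<times> {..<k})"
        by (rule image_eqI) auto
    qed
  qed auto
  then show ?thesis unfolding small_types_def by blast
qed

text \<open>A pattern is a finite disjunction: whatever \<open>R\<close> is, only finitely many
  types on \<open>k\<close> vertices occur, and all of them are constants.\<close>

lemma definable_pat:
  assumes "set cs = small_types" "1 \<le> k" "k \<le> 8"
  shows "definable (\<sqsubseteq>) cs (\<lambda>e. pat k R (e i))"
proof -
  let ?C = "gt {..<k} ` Collect R"
  have "?C \<subseteq> set cs" using assms unfolding small_types_def by auto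
  moreover from this have "finite ?C" by (rule finite_subset) simp
  ultimately have "definable (\<sqsubseteq>) cs (\<lambda>e. \<exists>c\<in>?C. c \<sqsubseteq> e i)" by (intro definable_finite_lower)
  then show ?thesis unfolding pat_def by (simp add: conj_commute)
qed

section \<open>Definable classes of types\<close>

definition has_loop :: "digraph_type \<Rightarrow> bool" where
  "has_loop = pat 1 (\<lambda>M. M 0 0)"

definition has_nonloop :: "digraph_type \<Rightarrow> bool" where
  "has_nonloop = pat 1 (\<lambda>M. \<not> M 0 0)"

text \<open>Over a loopless frame only the new vertex can carry a loop, so together with
  \<open>has_loop\<close> this says that the new vertex is looped and isolated from the frame. Over
  a looped frame \<open>has_nonloop\<close> plays the dual part. This is how a member of one frame
  looks to the other.\<close>

definition loops_apart :: "digraph_type \<Rightarrow> bool" where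
  "loops_apart t \<longleftrightarrow> \<not> pat 2 (\<lambda>M. M 0 0 \<and> \<not> M 1 1 \<and> (M 0 1 \<or> M 1 0)) t"

text \<open>Transitivity appears as the absence of 3-cycles. The size condition leaves room for the
  auxiliary tournament vertices in \<open>attached\<close> and \<open>apart\<close>.\<close>

definition tour :: "digraph_type \<Rightarrow> bool" where
  "tour t \<longleftrightarrow> \<not> has_loop t \<and> \<not> pat 2 (\<lambda>M. M 0 1 \<and> M 1 0) t \<and>
    \<not> pat 2 (\<lambda>M. \<not> M 0 1 \<and> \<not> M 1 0) t \<and>
    \<not> pat 3 (\<lambda>M. M 0 1 \<and> M 1 2 \<and> M 2 0) t \<and> pat 8 (\<lambda>M. True) t"

text \<open>Two vertices are required because \<open>dominating\<close> could not see the direction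
  of an arc over a frame with a single vertex.\<close>

definition indep :: "digraph_type \<Rightarrow> bool" where
  "indep t \<longleftrightarrow> \<not> has_nonloop t \<and> \<not> pat 2 (\<lambda>M. M 0 1) t \<and> pat 2 (\<lambda>M. True) t"

text \<open>
  In a one-vertex extension of a tournament, the first pattern below can only be realised with the
  new vertex as \<open>0\<close>, because \<open>0\<close> is not adjacent to \<open>2\<close> and \<open>3\<close>; it provides an arc from the new
  vertex to a vertex which is not the last one of the tournament.  The second pattern excludes
  further adjacencies.
\<close>

definition attached :: "digraph_type \<Rightarrow> bool" where
  "attached z \<longleftrightarrow>
    pat 4 (\<lambda>M. M 0 1 \<and> \<not> M 1 0 \<and> M 1 2 \<and> (M 2 3 \<or> M 3 2) \<and>
      \<not> M 0 2 \<and> \<not> M 2 0 \<and> \<not> M 0 3 \<and> \<not> M 3 0) z \<and>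
    \<not> pat 4 (\<lambda>M. (M 0 1 \<or> M 1 0) \<and> (M 0 2 \<or> M 2 0) \<and> \<not> M 0 3 \<and> \<not> M 3 0 \<and>
      (M 1 3 \<or> M 3 1) \<and> (M 2 3 \<or> M 3 2)) z"

definition dominating :: "digraph_type \<Rightarrow> bool" where
  "dominating z \<longleftrightarrow> pat 2 (\<lambda>M. M 0 1) z \<and> \<not> pat 3 (\<lambda>M. M 0 1 \<and> \<not> M 0 2) z"

text \<open>
  \<open>apart\<close> certifies that \<open>0\<close> and \<open>1\<close> are the two new vertices of a two-vertex extension of a
  tournament: a vertex of the tournament is adjacent to at least one of three others.
\<close>

definition apart :: "(nat \<Rightarrow> nat \<Rightarrow> bool) \<Rightarrow> nat \<Rightarrow> nat \<Rightarrow> nat \<Rightarrow> bool" where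
  "apart M a b c \<longleftrightarrow> (M a b \<or> M b a) \<and> (M a c \<or> M c a) \<and> (M b c \<or> M c b) \<and>
    (\<forall>i\<in>{0, 1}. \<forall>j\<in>{a, b, c}. \<not> M i j \<and> \<not> M j i)"

definition same_place :: "digraph_type \<Rightarrow> bool" where
  "same_place = pat 6 (\<lambda>M. M 0 2 \<and> M 1 2 \<and> apart M 3 4 5)"

text \<open>The new vertices 0 and 1 are interchangeable up to isomorphism. The arc between their
  places 2 and 3 orders them, so this pattern reports an arc from the vertex with the earlier place
  to the one with the later place, and \<open>backward\<close> reports the opposite arc.\<close>

definition forward :: "digraph_type \<Rightarrow> bool" where
  "forward = pat 7 (\<lambda>M. M 0 1 \<and> M 0 2 \<and> M 1 3 \<and> M 2 3 \<and> apart M 4 5 6)"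

definition backward :: "digraph_type \<Rightarrow> bool" where
  "backward = pat 7 (\<lambda>M. M 1 0 \<and> M 0 2 \<and> M 1 3 \<and> M 2 3 \<and> apart M 4 5 6)"

section \<open>Meaning of the pattern classes in a concrete digraph\<close>

context
  fixes V :: "'v set"
  assumes V: "finite V" "V \<noteq> {}"
begin

lemma pat_1_gt_iff:
  assumes "\<And>M M'. (\<And>i j. i < 1 \<Longrightarrow> j < 1 \<Longrightarrow> M i j = M' i j) \<Longrightarrow> R M = R M'"
  shows "pat 1 R (gt V E) \<longleftrightarrow> (\<exists>a. distinct [a] \<and> set [a] \<subseteq> V \<and>
    R (\<lambda>i j. E ([a] ! i) ([a] ! j)))"
proof -
  have "pat 1 R (gt V E) \<longleftrightarrow> (\<exists>vs. length vs = 1 \<and> distinct vs \<and> set vs \<subseteq> V \<and>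
      R (\<lambda>i j. E (vs ! i) (vs ! j)))"
    by (rule pat_gt_iff[OF V _ assms]) simp_all
  also have "\<dots> \<longleftrightarrow> (\<exists>a. distinct [a] \<and> set [a] \<subseteq> V \<and>
      R (\<lambda>i j. E ([a] ! i) ([a] ! j)))"
    unfolding One_nat_def ex_length_Suc by simp
  finally show ?thesis .
qed

lemma pat_2_gt_iff:
  assumes "\<And>M M'. (\<And>i j. i < 2 \<Longrightarrow> j < 2 \<Longrightarrow> M i j = M' i j) \<Longrightarrow> R M = R M'"
  shows "pat 2 R (gt V E) \<longleftrightarrow> (\<exists>a b. distinct [a, b] \<and> set [a, b] \<subseteq> V \<and>
    R (\<lambda>i j. E ([a, b] ! i) ([a, b] ! j)))"
proof -
  have k: "2 = Suc (Suc 0)" by simp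
  have "pat 2 R (gt V E) \<longleftrightarrow> (\<exists>vs. length vs = 2 \<and> distinct vs \<and> set vs \<subseteq> V \<and>
      R (\<lambda>i j. E (vs ! i) (vs ! j)))"
    by (rule pat_gt_iff[OF V _ assms]) simp_all
  also have "\<dots> \<longleftrightarrow> (\<exists>a b. distinct [a, b] \<and> set [a, b] \<subseteq> V \<and>
      R (\<lambda>i j. E ([a, b] ! i) ([a, b] ! j)))"
    unfolding k ex_length_Suc by simp
  finally show ?thesis .
qed

lemma pat_3_gt_iff:
  assumes "\<And>M M'. (\<And>i j. i < 3 \<Longrightarrow> j < 3 \<Longrightarrow> M i j = M' i j) \<Longrightarrow> R M = R M'"
  shows "pat 3 R (gt V E) \<longleftrightarrow> (\<exists>a b c. distinct [a, b, c] \<and> set [a, b, c] \<subseteq> V \<and>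
    R (\<lambda>i j. E ([a, b, c] ! i) ([a, b, c] ! j)))"
proof -
  have k: "3 = Suc (Suc (Suc 0))" by simp
  have "pat 3 R (gt V E) \<longleftrightarrow> (\<exists>vs. length vs = 3 \<and> distinct vs \<and> set vs \<subseteq> V \<and>
      R (\<lambda>i j. E (vs ! i) (vs ! j)))"
    by (rule pat_gt_iff[OF V _ assms]) simp_all
  also have "\<dots> \<longleftrightarrow> (\<exists>a b c. distinct [a, b, c] \<and> set [a, b, c] \<subseteq> V \<and>
      R (\<lambda>i j. E ([a, b, c] ! i) ([a, b, c] ! j)))"
    unfolding k ex_length_Suc by simp
  finally show ?thesis .
qed

lemma pat_4_gt_iff:
  assumes "\<And>M M'. (\<And>i j. i < 4 \<Longrightarrow> j < 4 \<Longrightarrow> M i j = M' i j) \<Longrightarrow> R M = R M'"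
  shows "pat 4 R (gt V E) \<longleftrightarrow> (\<exists>a b c d. distinct [a, b, c, d] \<and> set [a, b, c, d] \<subseteq> V \<and>
    R (\<lambda>i j. E ([a, b, c, d] ! i) ([a, b, c, d] ! j)))"
proof -
  have k: "4 = Suc (Suc (Suc (Suc 0)))" by simp
  have "pat 4 R (gt V E) \<longleftrightarrow> (\<exists>vs. length vs = 4 \<and> distinct vs \<and> set vs \<subseteq> V \<and>
      R (\<lambda>i j. E (vs ! i) (vs ! j)))"
    by (rule pat_gt_iff[OF V _ assms]) simp_all
  also have "\<dots> \<longleftrightarrow> (\<exists>a b c d. distinct [a, b, c, d] \<and> set [a, b, c, d] \<subseteq> V \<and>
      R (\<lambda>i j. E ([a, b, c, d] ! i) ([a, b, c, d] ! j)))"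
    unfolding k ex_length_Suc by simp
  finally show ?thesis .
qed

lemma pat_6_gt_iff:
  assumes "\<And>M M'. (\<And>i j. i < 6 \<Longrightarrow> j < 6 \<Longrightarrow> M i j = M' i j) \<Longrightarrow> R M = R M'"
  shows "pat 6 R (gt V E) \<longleftrightarrow> (\<exists>a b c d e f. distinct [a, b, c, d, e, f] \<and>
    set [a, b, c, d, e, f] \<subseteq> V \<and> R (\<lambda>i j. E ([a, b, c, d, e, f] ! i) ([a, b, c, d, e, f] ! j)))"
proof -
  have k: "6 = Suc (Suc (Suc (Suc (Suc (Suc 0)))))" by simp
  have "pat 6 R (gt V E) \<longleftrightarrow> (\<exists>vs. length vs = 6 \<and> distinct vs \<and> set vs \<subseteq> V \<and>
      R (\<lambda>i j. E (vs ! i) (vs ! j)))"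
    by (rule pat_gt_iff[OF V _ assms]) simp_all
  also have "\<dots> \<longleftrightarrow> (\<exists>a b c d e f. distinct [a, b, c, d, e, f] \<and> set [a, b, c, d, e, f] \<subseteq> V \<and>
      R (\<lambda>i j. E ([a, b, c, d, e, f] ! i) ([a, b, c, d, e, f] ! j)))"
    unfolding k ex_length_Suc by simp
  finally show ?thesis .
qed

lemma pat_7_gt_iff:
  assumes "\<And>M M'. (\<And>i j. i < 7 \<Longrightarrow> j < 7 \<Longrightarrow> M i j = M' i j) \<Longrightarrow> R M = R M'"
  shows "pat 7 R (gt V E) \<longleftrightarrow> (\<exists>a b c d e f g. distinct [a, b, c, d, e, f, g] \<and>
    set [a, b, c, d, e, f, g] \<subseteq> V \<and> R (\<lambda>i j. E ([a, b, c, d, e, f, g] ! i) ([a, b, c, d, e, f, g] ! j)))"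
proof -
  have k: "7 = Suc (Suc (Suc (Suc (Suc (Suc (Suc 0))))))" by simp
  have "pat 7 R (gt V E) \<longleftrightarrow> (\<exists>vs. length vs = 7 \<and> distinct vs \<and> set vs \<subseteq> V \<and>
      R (\<lambda>i j. E (vs ! i) (vs ! j)))"
    by (rule pat_gt_iff[OF V _ assms]) simp_all
  also have "\<dots> \<longleftrightarrow> (\<exists>a b c d e f g. distinct [a, b, c, d, e, f, g] \<and> set [a, b, c, d, e, f, g] \<subseteq> V \<and>
      R (\<lambda>i j. E ([a, b, c, d, e, f, g] ! i) ([a, b, c, d, e, f, g] ! j)))"
    unfolding k ex_length_Suc by simp
  finally show ?thesis .
qed

lemma has_loop_gt_iff: "has_loop (gt V E) \<longleftrightarrow> (\<exists>x\<in>V. E x x)"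
  unfolding has_loop_def by (subst pat_1_gt_iff) auto

lemma has_nonloop_gt_iff: "has_nonloop (gt V E) \<longleftrightarrow> (\<exists>x\<in>V. \<not> E x x)"
  unfolding has_nonloop_def by (subst pat_1_gt_iff) auto

lemma loops_apart_gt_iff:
  "loops_apart (gt V E) \<longleftrightarrow> (\<forall>x\<in>V. \<forall>y\<in>V. E x x \<and> \<not> E y y \<longrightarrow> \<not> E x y \<and> \<not> E y x)"
  unfolding loops_apart_def by (subst pat_2_gt_iff) auto

lemma pat_True_gt_iff: "0 < k \<Longrightarrow> pat k (\<lambda>M. True) (gt V E) \<longleftrightarrow> k \<le> card V"
proof -
  assume "0 < k"
  then have "pat k (\<lambda>M. True) (gt V E) \<longleftrightarrow> (\<exists>vs. length vs = k \<and> distinct vs \<and> set vs \<subseteq> V)"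
    by (subst pat_gt_iff[OF V]) auto
  also have "\<dots> \<longleftrightarrow> k \<le> card V"
  proof
    assume "\<exists>vs. length vs = k \<and> distinct vs \<and> set vs \<subseteq> V"
    then show "k \<le> card V" using V(1) by (metis card_mono distinct_card)
  next
    assume "k \<le> card V"
    then obtain A where "A \<subseteq> V" "card A = k" "finite A" by (rule obtain_subset_with_card_n)
    then show "\<exists>vs. length vs = k \<and> distinct vs \<and> set vs \<subseteq> V"
      using finite_distinct_list distinct_card by metis
  qed
  finally show ?thesis .
qed

lemma indep_gt_iff:
  "indep (gt V E) \<longleftrightarrow> (\<forall>x\<in>V. \<forall>y\<in>V. E x y \<longleftrightarrow> x = y) \<and> 2 \<le> card V"
proof -
  have "pat 2 (\<lambda>M. M 0 1) (gt V E) \<longleftrightarrow> (\<exists>x\<in>V. \<exists>y\<in>V. x \<noteq> y \<and> E x y)"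
    by (subst pat_2_gt_iff) auto
  then show ?thesis
    unfolding indep_def has_nonloop_gt_iff by (simp add: pat_True_gt_iff) metis
qed

lemma tour_gt_iff:
  "tour (gt V E) \<longleftrightarrow> (\<forall>x\<in>V. \<forall>y\<in>V. E x y \<longrightarrow> \<not> E y x) \<and>
    (\<forall>x\<in>V. \<forall>y\<in>V. x \<noteq> y \<longrightarrow> E x y \<or> E y x) \<and>
    (\<forall>x\<in>V. \<forall>y\<in>V. \<forall>z\<in>V. E x y \<longrightarrow> E y z \<longrightarrow> E x z) \<and> 8 \<le> card V"
proof -
  have p2: "pat 2 (\<lambda>M. M 0 1 \<and> M 1 0) (gt V E) \<longleftrightarrow> (\<exists>x\<in>V. \<exists>y\<in>V. x \<noteq> y \<and> E x y \<and> E y x)"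
    by (subst pat_2_gt_iff) auto
  have p2': "pat 2 (\<lambda>M. \<not> M 0 1 \<and> \<not> M 1 0) (gt V E) \<longleftrightarrow>
      (\<exists>x\<in>V. \<exists>y\<in>V. x \<noteq> y \<and> \<not> E x y \<and> \<not> E y x)"
    by (subst pat_2_gt_iff) auto
  have p3: "pat 3 (\<lambda>M. M 0 1 \<and> M 1 2 \<and> M 2 0) (gt V E) \<longleftrightarrow>
      (\<exists>x\<in>V. \<exists>y\<in>V. \<exists>z\<in>V. distinct [x, y, z] \<and> E x y \<and> E y z \<and> E z x)"
    by (subst pat_3_gt_iff) auto
  note iffs = tour_def has_loop_gt_iff p2 p2' p3 pat_True_gt_iff[OF zero_less_numeral]
  show ?thesis
  proof
    assume "tour (gt V E)"
    then have irr: "\<And>x. x \<in> V \<Longrightarrow> \<not> E x x"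
      and asym: "\<And>x y. x \<in> V \<Longrightarrow> y \<in> V \<Longrightarrow> x \<noteq> y \<Longrightarrow> E x y \<Longrightarrow> \<not> E y x"
      and tot: "\<And>x y. x \<in> V \<Longrightarrow> y \<in> V \<Longrightarrow> x \<noteq> y \<Longrightarrow> E x y \<or> E y x"
      and acyc: "\<And>x y z. x \<in> V \<Longrightarrow> y \<in> V \<Longrightarrow> z \<in> V \<Longrightarrow> distinct [x, y, z] \<Longrightarrow>
        E x y \<Longrightarrow> E y z \<Longrightarrow> \<not> E z x"
      and card: "8 \<le> card V"
      unfolding iffs by blast+
    have asym': "\<not> E y x" if "x \<in> V" "y \<in> V" "E x y" for x y
      using that irr[of x] asym[of x y] by (cases "x = y") simp_all
    \<comment> \<open>Patterns only speak about distinct vertices, so coincidences are excluded by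
      asymmetry first; then an arc from \<open>z\<close> to \<open>x\<close> would close a
      3-cycle.\<close>
    have "E x z" if "x \<in> V" "y \<in> V" "z \<in> V" "E x y" "E y z" for x y z
    proof -
      have "x \<noteq> y" "y \<noteq> z" "x \<noteq> z" using that irr asym' by blast+
      then show ?thesis using acyc[of x y z] tot[of x z] that by simp
    qed
    then show "(\<forall>x\<in>V. \<forall>y\<in>V. E x y \<longrightarrow> \<not> E y x) \<and>
        (\<forall>x\<in>V. \<forall>y\<in>V. x \<noteq> y \<longrightarrow> E x y \<or> E y x) \<and>
        (\<forall>x\<in>V. \<forall>y\<in>V. \<forall>z\<in>V. E x y \<longrightarrow> E y z \<longrightarrow> E x z) \<and> 8 \<le> card V"
      using asym' tot card by blast
  next
    assume "(\<forall>x\<in>V. \<forall>y\<in>V. E x y \<longrightarrow> \<not> E y x) \<and>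
        (\<forall>x\<in>V. \<forall>y\<in>V. x \<noteq> y \<longrightarrow> E x y \<or> E y x) \<and>
        (\<forall>x\<in>V. \<forall>y\<in>V. \<forall>z\<in>V. E x y \<longrightarrow> E y z \<longrightarrow> E x z) \<and> 8 \<le> card V"
    then show "tour (gt V E)" unfolding iffs by blast
  qed
qed

lemma attached_gt_iff:
  "attached (gt V E) \<longleftrightarrow>
    (\<exists>x a b c. distinct [x, a, b, c] \<and> set [x, a, b, c] \<subseteq> V \<and> E x a \<and> \<not> E a x \<and> E a b \<and>
      (E b c \<or> E c b) \<and> \<not> E x b \<and> \<not> E b x \<and> \<not> E x c \<and> \<not> E c x) \<and>
    \<not> (\<exists>x a b y. distinct [x, a, b, y] \<and> set [x, a, b, y] \<subseteq> V \<and> (E x a \<or> E a x) \<and> (E x b \<or> E b x) \<and>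
      \<not> E x y \<and> \<not> E y x \<and> (E a y \<or> E y a) \<and> (E b y \<or> E y b))"
  unfolding attached_def by (subst pat_4_gt_iff, simp, subst pat_4_gt_iff, simp, simp)

lemma dominating_gt_iff:
  "dominating (gt V E) \<longleftrightarrow> (\<exists>x\<in>V. \<exists>y\<in>V. x \<noteq> y \<and> E x y) \<and>
    (\<forall>x\<in>V. \<forall>y\<in>V. \<forall>z\<in>V. distinct [x, y, z] \<longrightarrow> E x y \<longrightarrow> E x z)"
  unfolding dominating_def by (subst pat_2_gt_iff, simp, subst pat_3_gt_iff, simp) auto

lemma same_place_gt_iff:
  "same_place (gt V E) \<longleftrightarrow> (\<exists>x y a b c d. distinct [x, y, a, b, c, d] \<and> set [x, y, a, b, c, d] \<subseteq> V \<and>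
    E x a \<and> E y a \<and> (E b c \<or> E c b) \<and> (E b d \<or> E d b) \<and> (E c d \<or> E d c) \<and>
    (\<forall>i\<in>{x, y}. \<forall>j\<in>{b, c, d}. \<not> E i j \<and> \<not> E j i))"
  unfolding same_place_def apart_def by (subst pat_6_gt_iff, simp, simp)

lemma forward_gt_iff:
  "forward (gt V E) \<longleftrightarrow> (\<exists>x y p q b c d.
    distinct [x, y, p, q, b, c, d] \<and> set [x, y, p, q, b, c, d] \<subseteq> V \<and> E x y \<and> E x p \<and> E y q \<and> E p q \<and>
    (E b c \<or> E c b) \<and> (E b d \<or> E d b) \<and> (E c d \<or> E d c) \<and>
    (\<forall>i\<in>{x, y}. \<forall>j\<in>{b, c, d}. \<not> E i j \<and> \<not> E j i))"
  unfolding forward_def apart_def by (subst pat_7_gt_iff, simp, simp)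

lemma backward_gt_iff:
  "backward (gt V E) \<longleftrightarrow> (\<exists>x y p q b c d.
    distinct [x, y, p, q, b, c, d] \<and> set [x, y, p, q, b, c, d] \<subseteq> V \<and> E y x \<and> E x p \<and> E y q \<and> E p q \<and>
    (E b c \<or> E c b) \<and> (E b d \<or> E d b) \<and> (E c d \<or> E d c) \<and>
    (\<forall>i\<in>{x, y}. \<forall>j\<in>{b, c, d}. \<not> E i j \<and> \<not> E j i))"
  unfolding backward_def apart_def by (subst pat_7_gt_iff, simp, simp)

end

section \<open>One-vertex extensions of frames\<close>

definition tour_on :: "('v \<Rightarrow> 'v \<Rightarrow> bool) \<Rightarrow> 'v set \<Rightarrow> bool" where
  "tour_on E F \<longleftrightarrow> finite F \<and> (\<forall>x\<in>F. \<forall>y\<in>F. E x y \<longrightarrow> \<not> E y x) \<and>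
    (\<forall>x\<in>F. \<forall>y\<in>F. x \<noteq> y \<longrightarrow> E x y \<or> E y x) \<and>
    (\<forall>x\<in>F. \<forall>y\<in>F. \<forall>z\<in>F. E x y \<longrightarrow> E y z \<longrightarrow> E x z) \<and> 8 \<le> card F"

definition indep_on :: "('v \<Rightarrow> 'v \<Rightarrow> bool) \<Rightarrow> 'v set \<Rightarrow> bool" where
  "indep_on E F \<longleftrightarrow> finite F \<and> 2 \<le> card F \<and> (\<forall>x\<in>F. \<forall>y\<in>F. E x y \<longleftrightarrow> x = y)"

text \<open>The place must have a successor \<open>b\<close>, which excludes the last vertex of the
  tournament. Otherwise a second tournament could share just its last vertex with \<open>F\<close>,
  the remaining vertices of each being placed there in the other.\<close>

definition plugged :: "('v \<Rightarrow> 'v \<Rightarrow> bool) \<Rightarrow> 'v set \<Rightarrow> 'v \<Rightarrow> bool" where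
  "plugged E F v \<longleftrightarrow> (\<exists>a\<in>F. (\<exists>b\<in>F. E a b) \<and> (\<forall>b\<in>F. \<not> E b v \<and> (E v b \<longleftrightarrow> b = a)))"

lemma tour_onD:
  assumes "tour_on E F"
  shows "finite F" "8 \<le> card F" "x \<in> F \<Longrightarrow> \<not> E x x"
    "x \<in> F \<Longrightarrow> y \<in> F \<Longrightarrow> E x y \<Longrightarrow> \<not> E y x"
    "x \<in> F \<Longrightarrow> y \<in> F \<Longrightarrow> x \<noteq> y \<Longrightarrow> E x y \<or> E y x"
  using assms unfolding tour_on_def by blast+

lemma indep_onD:
  assumes "indep_on E F"
  shows "finite F" "2 \<le> card F" "x \<in> F \<Longrightarrow> y \<in> F \<Longrightarrow> E x y \<longleftrightarrow> x = y"
  using assms unfolding indep_on_def by blast+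

lemma tour_on_ne: "tour_on E F \<Longrightarrow> F \<noteq> {}"
proof -
  assume "tour_on E F"
  then have "8 \<le> card F" by (simp only: tour_on_def)
  then show ?thesis by force
qed

lemma indep_on_ne: "indep_on E F \<Longrightarrow> F \<noteq> {}"
proof -
  assume "indep_on E F"
  then have "2 \<le> card F" by (simp only: indep_on_def)
  then show ?thesis by force
qed

lemma tour_gt: "finite F \<Longrightarrow> F \<noteq> {} \<Longrightarrow> tour (gt F E) \<longleftrightarrow> tour_on E F"
  by (simp only: tour_gt_iff tour_on_def simp_thms)

lemma indep_gt: "finite F \<Longrightarrow> F \<noteq> {} \<Longrightarrow> indep (gt F E) \<longleftrightarrow> indep_on E F"
  by (simp add: indep_gt_iff indep_on_def conj_commute)

lemma obtain_fresh:
  assumes "finite F" "card (set xs) < card F"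
  obtains c where "c \<in> F" "c \<notin> set xs"
proof -
  have "\<not> F \<subseteq> set xs" using assms card_mono[of "set xs" F] by auto
  then show ?thesis using that by blast
qed

context
  fixes F :: "'v set" and E v
  assumes tour: "tour_on E F" and v: "v \<notin> F"
begin

lemma finF: "finite F" and cardF: "8 \<le> card F" and irrF: "x \<in> F \<Longrightarrow> \<not> E x x"
  and totF: "x \<in> F \<Longrightarrow> y \<in> F \<Longrightarrow> x \<noteq> y \<Longrightarrow> E x y \<or> E y x"
  by (rule tour_onD[OF tour]; assumption?)+

lemma attached_insert_iff: "attached (gt (insert v F) E) \<longleftrightarrow> plugged E F v"
proof -
  have fin: "finite (insert v F)" "insert v F \<noteq> {}" using finF by auto
  note att = attached_gt_iff[OF fin, of E]
  show ?thesis
  proof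
    assume "attached (gt (insert v F) E)"
    then obtain x a b c where 1: "distinct [x, a, b, c]" "set [x, a, b, c] \<subseteq> insert v F"
        "E x a" "\<not> E a x" "E a b" "\<not> E x b" "\<not> E b x" "\<not> E x c" "\<not> E c x"
      and 2: "\<And>x a b y. distinct [x, a, b, y] \<Longrightarrow> set [x, a, b, y] \<subseteq> insert v F \<Longrightarrow>
        E x a \<or> E a x \<Longrightarrow> E x b \<or> E b x \<Longrightarrow> E x y \<or> E y x \<or> \<not> (E a y \<or> E y a) \<or> \<not> (E b y \<or> E y b)"
      unfolding att by blast
    \<comment> \<open>A member of \<open>F\<close> is adjacent to all others, so its non-neighbours
      \<open>b\<close> and \<open>c\<close> would both have to be \<open>v\<close>.\<close>
    have "x = v"
    proof (rule ccontr)
      assume "x \<noteq> v"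
      then have "x \<in> F" using 1(2) by auto
      then have "b \<notin> F" "c \<notin> F" using totF 1 by (metis distinct_length_2_or_more)+
      then show False using 1(1,2) by auto
    qed
    then have F: "a \<in> F" "b \<in> F" using 1(1,2) by auto
    \<comment> \<open>A second neighbour \<open>d\<close> of \<open>v\<close> would realise the
      forbidden pattern: \<open>a\<close> and \<open>d\<close> are common neighbours of
      \<open>v\<close> and \<open>b\<close>, which are not adjacent.\<close>
    have "\<not> E v d \<and> \<not> E d v" if d: "d \<in> F" "d \<noteq> a" for d
    proof (rule ccontr)
      assume *: "\<not> (\<not> E v d \<and> \<not> E d v)"
      then have "d \<noteq> b" using 1 \<open>x = v\<close> by blast
      then show False
        using 2[of v a d b] 1 * \<open>x = v\<close> F d v totF[of a b] totF[of d b] by auto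
    qed
    then show "plugged E F v"
      unfolding plugged_def using F 1(3-5) \<open>x = v\<close> by (intro bexI[of _ a] conjI bexI[of _ b]) auto
  next
    assume "plugged E F v"
    then obtain a b where a: "a \<in> F" "b \<in> F" "E a b" "\<And>d. d \<in> F \<Longrightarrow> \<not> E d v"
      "\<And>d. d \<in> F \<Longrightarrow> E v d \<longleftrightarrow> d = a" unfolding plugged_def by blast
    have "a \<noteq> b" using a irrF by blast
    obtain c where c: "c \<in> F" "c \<notin> set [a, b]"
      by (rule obtain_fresh[OF finF, of "[a, b]"]) (use cardF card_length[of "[a, b]"] in auto)
    have "distinct [v, a, b, c]" "set [v, a, b, c] \<subseteq> insert v F" "E v a" "\<not> E a v" "E a b"
      "E b c \<or> E c b" "\<not> E v b" "\<not> E b v" "\<not> E v c" "\<not> E c v"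
      using a c v \<open>a \<noteq> b\<close> totF[of b c] by auto
    moreover have False
      if "distinct [x, d, e, y]" "set [x, d, e, y] \<subseteq> insert v F" "E x d \<or> E d x" "E x e \<or> E e x"
        "\<not> E x y" "\<not> E y x" "E d y \<or> E y d" "E e y \<or> E y e" for x d e y
    proof -
      \<comment> \<open>The non-adjacent pair must contain \<open>v\<close>, so its two common
        neighbours lie in \<open>F\<close>; but \<open>v\<close> has only the neighbour
        \<open>a\<close> there.\<close>
      have "x = v \<or> y = v" using that(1,2,5,6) totF[of x y] by auto
      then have "d \<in> F" "e \<in> F" using that(1,2) by auto
      then have "d = a" "e = a" using \<open>x = v \<or> y = v\<close> that a(4,5) by auto
      then show False using that(1) by auto
    qed
    ultimately show "attached (gt (insert v F) E)" unfolding att by blast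
  qed
qed

lemma loop_apart_insert_iff:
  "has_loop (gt (insert v F) E) \<and> loops_apart (gt (insert v F) E) \<longleftrightarrow>
    E v v \<and> (\<forall>b\<in>F. \<not> E v b \<and> \<not> E b v)"
proof -
  have fin: "finite (insert v F)" "insert v F \<noteq> {}" using finF by auto
  show ?thesis
    unfolding has_loop_gt_iff[OF fin] loops_apart_gt_iff[OF fin] using irrF v by auto
qed

end

context
  fixes F :: "'v set" and E v
  assumes ind: "indep_on E F" and v: "v \<notin> F"
begin

lemma nonloop_apart_insert_iff:
  "has_nonloop (gt (insert v F) E) \<and> loops_apart (gt (insert v F) E) \<longleftrightarrow>
    \<not> E v v \<and> (\<forall>b\<in>F. \<not> E v b \<and> \<not> E b v)"
proof -
  have fin: "finite (insert v F)" "insert v F \<noteq> {}" and F: "\<And>x. x \<in> F \<Longrightarrow> E x x"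
    using indep_onD[OF ind] by simp_all
  show ?thesis
    unfolding has_nonloop_gt_iff[OF fin] loops_apart_gt_iff[OF fin] using F v by auto
qed

text \<open>A frame vertex with an arc to \<open>v\<close> would also need an arc to a second frame
  vertex, and there is none. So an arc between distinct vertices can only start at \<open>v\<close>,
  and then it spreads to the whole frame.\<close>

lemma dominating_insert_iff:
  "dominating (gt (insert v F) E) \<longleftrightarrow> (\<forall>b\<in>F. E v b \<and> \<not> E b v)"
proof -
  have fin: "finite (insert v F)" "insert v F \<noteq> {}" "finite F" and c: "2 \<le> card F"
    and F: "\<And>x y. x \<in> F \<Longrightarrow> y \<in> F \<Longrightarrow> E x y \<longleftrightarrow> x = y"
    using indep_onD[OF ind] by simp_all
  have other: "\<exists>c\<in>F. c \<noteq> x" if "x \<in> F" for x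
    by (rule obtain_fresh[OF fin(3), of "[x]"]) (use c in simp, auto)
  show ?thesis
  proof
    assume dom: "dominating (gt (insert v F) E)"
    note dom' = dom[unfolded dominating_gt_iff[OF fin(1,2)]]
    obtain x y where xy: "x \<in> insert v F" "y \<in> insert v F" "x \<noteq> y" "E x y"
      using conjunct1[OF dom'] by (elim bexE conjE)
    have step: "E x z" if "x \<in> insert v F" "y \<in> insert v F" "z \<in> insert v F"
        "distinct [x, y, z]" "E x y" for x y z
      by (rule conjunct2[OF dom', rule_format, OF that])
    have no: "\<not> E b v" if b: "b \<in> F" for b
    proof
      assume "E b v"
      obtain c where "c \<in> F" "c \<noteq> b" using other[OF b] by blast
      then have "distinct [b, v, c]" using b v by auto
      then have "E b c" using step[of b v c] \<open>E b v\<close> \<open>c \<in> F\<close> b by simp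
      then show False using F[of b c] that \<open>c \<in> F\<close> \<open>c \<noteq> b\<close> by simp
    qed
    have "x \<notin> F"
    proof
      assume x: "x \<in> F"
      then have "y \<in> F" using xy(2,4) no[of x] by blast
      then show False using xy(3,4) F[OF x, of y] by simp
    qed
    then have xv: "x = v" using xy(1) by simp
    then have yF: "y \<in> F" using xy(2,3) by simp
    have "E v b" if b: "b \<in> F" for b
    proof (cases "b = y")
      case False
      then have "distinct [v, y, b]" using b yF v by auto
      then show ?thesis using step[of v y b] b yF xy(4) xv by simp
    qed (use xy(4) xv in simp)
    then show "\<forall>b\<in>F. E v b \<and> \<not> E b v" using no by simp
  next
    assume *: "\<forall>b\<in>F. E v b \<and> \<not> E b v"
    obtain b where "b \<in> F" using indep_on_ne[OF ind] by blast
    then show "dominating (gt (insert v F) E)"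
      unfolding dominating_gt_iff[OF fin(1,2)]
    proof (intro conjI ballI impI)
      show "\<exists>x\<in>insert v F. \<exists>y\<in>insert v F. x \<noteq> y \<and> E x y"
        by (rule bexI[of _ v], rule bexI[of _ b]) (use \<open>b \<in> F\<close> * v in auto)
    next
      fix x y z assume "x \<in> insert v F" "y \<in> insert v F" "z \<in> insert v F" "distinct [x, y, z]" "E x y"
      note xyz = this
      have "x \<notin> F"
      proof
        assume "x \<in> F"
        then show False using xyz(2,4,5) F[of x y] *[rule_format, of x] by (cases "y = v") simp_all
      qed
      then have "x = v" "z \<in> F" using xyz(1,3,4) by auto
      then show "E x z" using * by simp
    qed
  qed
qed

end

text \<open>
  The only possible common vertex of two different copies is the place of the remaining vertices
  of either copy in the other one, hence the last vertex of both, which no place is.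
\<close>

lemma tour_copy_unique:
  assumes tA: "tour_on E A" and tB: "tour_on E B" and card: "card A = card B"
    and A: "\<And>x. x \<in> B - A \<Longrightarrow> plugged E A x" and B: "\<And>x. x \<in> A - B \<Longrightarrow> plugged E B x"
  shows "A = B"
proof (rule ccontr)
  assume "A \<noteq> B"
  have fin: "finite A" "finite B" using tA tB by (auto dest: tour_onD)
  have "\<not> B \<subseteq> A" using \<open>A \<noteq> B\<close> card fin card_subset_eq[of A B] by auto
  then obtain x where x: "x \<in> B - A" by blast
  obtain p where p: "p \<in> A" "\<exists>b\<in>A. E p b" "\<And>b. b \<in> A \<Longrightarrow> \<not> E b x \<and> (E x b \<longleftrightarrow> b = p)"
    using A[OF x] unfolding plugged_def by blast
  have totB: "E u w \<or> E w u" if "u \<in> B" "w \<in> B" "u \<noteq> w" for u w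
    by (rule tour_onD(5)[OF tB that])
  have inter: "z = p" if "z \<in> A" "z \<in> B" for z
  proof -
    have "z \<noteq> x" using x that by blast
    then show ?thesis using totB[of x z] p(3)[OF that(1)] x that by blast
  qed
  \<comment> \<open>If \<open>p\<close> is outside \<open>B\<close>, it is plugged into
    \<open>B\<close> and receives no arc from there, yet \<open>x\<close> sends one. If
    \<open>p\<close> is in \<open>B\<close>, its successor \<open>b\<close> in \<open>A\<close> lies
    outside \<open>B\<close> by \<open>inter\<close>, yet receives an arc from
    \<open>p\<close>.\<close>
  show False
  proof (cases "p \<in> B")
    case False
    then obtain q where "q \<in> B" "\<And>b. b \<in> B \<Longrightarrow> \<not> E b p"
      using B[of p] p(1) unfolding plugged_def by blast
    then show False using p x by blast
  next
    case True
    obtain b where b: "b \<in> A" "E p b" using p by blast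
    then have "b \<noteq> p" using tour_onD(3)[OF tA p(1)] by blast
    then have "b \<notin> B" using inter b by blast
    then show False using B[of b] b True unfolding plugged_def by blast
  qed
qed

text \<open>Equal cardinality provides vertices on both sides of the difference, and each of them
  would dominate the other, while domination excludes the reverse arc.\<close>

lemma indep_copy_unique:
  assumes card: "card A = card B" and fin: "finite A" "finite B"
    and A: "\<And>x b. x \<in> B - A \<Longrightarrow> b \<in> A \<Longrightarrow> E x b \<and> \<not> E b x"
    and B: "\<And>x b. x \<in> A - B \<Longrightarrow> b \<in> B \<Longrightarrow> E x b \<and> \<not> E b x"
  shows "A = B"
proof (rule ccontr)
  assume "A \<noteq> B"
  then have "\<not> B \<subseteq> A" "\<not> A \<subseteq> B" using card fin card_subset_eq[of A B] card_subset_eq[of B A] by auto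
  then obtain x y where "x \<in> B - A" "y \<in> A - B" by blast
  then show False using A[of x y] B[of y x] by blast
qed

section \<open>Recovering a digraph from a scaffold\<close>

text \<open>This is a greatest element rather than a merely maximal one; antisymmetry makes it
  unique, so it acts as a definite description.\<close>

definition maximal :: "(digraph_type \<Rightarrow> bool) \<Rightarrow> digraph_type \<Rightarrow> bool" where
  "maximal P q \<longleftrightarrow> P q \<and> (\<forall>q'. P q' \<longrightarrow> q' \<sqsubseteq> q)"

text \<open>
  The clause on \<open>w\<close> makes the two frames see the same remaining vertices: a vertex that looks like
  a member of the other frame to only one of them would, together with both frames, yield a
  counterexample \<open>w\<close>.
\<close>

definition code_in :: "digraph_type \<Rightarrow> digraph_type \<Rightarrow> digraph_type \<Rightarrow> digraph_type \<Rightarrow> digraph_type \<Rightarrow>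
    digraph_type \<Rightarrow> bool" where
  "code_in t s x y q g \<longleftrightarrow> tour t \<and> indep s \<and> t \<sqsubseteq> x \<and> s \<sqsubseteq> x \<and>
    (\<forall>z. ext1 t z x \<longrightarrow> attached z \<or> (has_loop z \<and> loops_apart z)) \<and>
    (\<forall>z. ext1 s z x \<longrightarrow> dominating z \<or> (has_nonloop z \<and> loops_apart z)) \<and>
    (\<forall>w. w \<sqsubseteq> x \<and> t \<sqsubseteq> w \<and> s \<sqsubseteq> w \<longrightarrow>
      ((\<forall>z. ext1 t z w \<longrightarrow> has_loop z \<and> loops_apart z) \<longleftrightarrow>
       (\<forall>z. ext1 s z w \<longrightarrow> has_nonloop z \<and> loops_apart z))) \<and>
    maximal (\<lambda>q. t \<sqsubseteq> q \<and> q \<sqsubseteq> x \<and> (\<forall>z. ext1 t z q \<longrightarrow> attached z)) q \<and>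
    maximal (\<lambda>y. s \<sqsubseteq> y \<and> y \<sqsubseteq> x \<and> (\<forall>z. ext1 s z y \<longrightarrow> dominating z)) y \<and>
    maximal (\<lambda>g. g \<sqsubseteq> q \<and> g \<sqsubseteq> y) g"

text \<open>Uniqueness is meant as a vertex set, not up to isomorphism. Under it, the order and the
  extension relations over the type of \<open>A\<close> become statements about the vertices outside
  \<open>A\<close>; this is how formulas come to quantify over vertices.\<close>

definition unique_copy :: "('v \<Rightarrow> 'v \<Rightarrow> bool) \<Rightarrow> 'v set \<Rightarrow> 'v set \<Rightarrow> bool" where
  "unique_copy E A V \<longleftrightarrow> (\<forall>A'. A' \<subseteq> V \<and> gt A' E = gt A E \<and> A' \<noteq> {} \<longrightarrow> A' = A)"

context
  fixes V A W :: "'v set" and E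
  assumes fin: "finite V" and A: "A \<noteq> {}" and uniq: "unique_copy E A V" and W: "W \<subseteq> V"
begin

lemma unique_copy_sub_iff: "W \<noteq> {} \<Longrightarrow> gt A E \<sqsubseteq> gt W E \<longleftrightarrow> A \<subseteq> W"
proof
  assume ne: "W \<noteq> {}" and "gt A E \<sqsubseteq> gt W E"
  have "finite W" using W fin finite_subset by blast
  then obtain B where "B \<subseteq> W" "B \<noteq> {}" "gt B E = gt A E"
    using sub_gt_iff[of W "gt A E" E] \<open>gt A E \<sqsubseteq> gt W E\<close> ne by metis
  then show "A \<subseteq> W" using uniq W unfolding unique_copy_def by (metis subset_trans)
next
  assume "A \<subseteq> W"
  then show "gt A E \<sqsubseteq> gt W E" using W fin A by (intro gt_mono) (auto intro: finite_subset)
qed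

lemma unique_copy_ext1_iff:
  "A \<subseteq> W \<Longrightarrow> ext1 (gt A E) z (gt W E) \<longleftrightarrow> (\<exists>v\<in>W - A. z = gt (insert v A) E)"
proof -
  assume AW: "A \<subseteq> W"
  have fW: "finite W" "W \<noteq> {}" using W fin finite_subset A AW by blast+
  have "B = A" if "B \<subseteq> W" "B \<noteq> {}" "gt A E = gt B E" for B
    using uniq W that unfolding unique_copy_def by (metis subset_trans)
  then show ?thesis
    unfolding ext1_gt_iff[OF fW] using AW A by (intro iffI; blast)
qed

lemma unique_copy_ext2_iff:
  "A \<subseteq> W \<Longrightarrow> ext2 (gt A E) w (gt W E) \<longleftrightarrow>
    (\<exists>u v. u \<in> W - A \<and> v \<in> W - A \<and> u \<noteq> v \<and> w = gt (insert u (insert v A)) E)"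
proof -
  assume AW: "A \<subseteq> W"
  have fW: "finite W" "W \<noteq> {}" using W fin finite_subset A AW by blast+
  have "B = A" if "B \<subseteq> W" "B \<noteq> {}" "gt A E = gt B E" for B
    using uniq W that unfolding unique_copy_def by (metis subset_trans)
  note only = this
  show ?thesis
    unfolding ext2_gt_iff[OF fW]
  proof (intro iffI; elim exE conjE)
    fix B u v
    assume B: "B \<subseteq> W" "B \<noteq> {}" "gt A E = gt B E" and uv: "u \<in> W - B" "v \<in> W - B" "u \<noteq> v"
      "w = gt (insert u (insert v B)) E"
    from only[OF B] uv show "\<exists>u v. u \<in> W - A \<and> v \<in> W - A \<and> u \<noteq> v \<and>
        w = gt (insert u (insert v A)) E" by (intro exI[of _ u] exI[of _ v]) simp
  next
    fix u v assume "u \<in> W - A" "v \<in> W - A" "u \<noteq> v" "w = gt (insert u (insert v A)) E"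
    then show "\<exists>B u v. B \<subseteq> W \<and> B \<noteq> {} \<and> u \<in> W - B \<and> v \<in> W - B \<and> u \<noteq> v \<and>
        gt A E = gt B E \<and> w = gt (insert u (insert v B)) E"
      using AW A by (intro exI[of _ A] exI[of _ u] exI[of _ v]) simp
  qed
qed

end

lemma maximal_iff_eq:
  assumes m: "P m" and above: "\<And>q. P q \<Longrightarrow> q \<sqsubseteq> m"
  shows "maximal P q \<longleftrightarrow> q = m"
proof
  assume max: "maximal P q"
  have "P q" "m \<sqsubseteq> q" using max m unfolding maximal_def by simp_all
  then show "q = m" using above sub_antisym by simp
next
  assume "q = m"
  have "\<forall>q'. P q' \<longrightarrow> q' \<sqsubseteq> m" by (intro allI impI above)
  then show "maximal P q" unfolding maximal_def \<open>q = m\<close> using m by (intro conjI)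
qed

text \<open>The configurations that \<open>code_in\<close> is meant to describe: each of them
  satisfies it, and each solution of it arises from one. Places may still coincide here; the
  \<open>same_place\<close> clause of \<open>code\<close> separates them.\<close>

locale scaffold =
  fixes V A B :: "'v set" and E
  assumes fin: "finite V" and AV: "A \<subseteq> V" and BV: "B \<subseteq> V"
    and tour: "tour_on E A" and ind: "indep_on E B"
    and uniqA: "unique_copy E A V" and uniqB: "unique_copy E B V"
    and apart: "\<And>a b. a \<in> A \<Longrightarrow> b \<in> B \<Longrightarrow> \<not> E a b \<and> \<not> E b a"
    and plug: "\<And>v. v \<in> V \<Longrightarrow> v \<notin> A \<Longrightarrow> v \<notin> B \<Longrightarrow> plugged E A v"
    and dom: "\<And>v b. v \<in> V \<Longrightarrow> v \<notin> A \<Longrightarrow> v \<notin> B \<Longrightarrow> b \<in> B \<Longrightarrow> E v b \<and> \<not> E b v"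
    and core_ne: "V - (A \<union> B) \<noteq> {}"
begin

definition core :: "'v set" where "core = V - (A \<union> B)"

lemma ne: "A \<noteq> {}" "B \<noteq> {}" "V \<noteq> {}" "core \<noteq> {}"
  using tour_on_ne[OF tour] indep_on_ne[OF ind] AV core_ne by (auto simp: core_def)

lemma finA: "finite A" and finB: "finite B" and finC: "finite core"
  using fin AV BV finite_subset by (auto simp: core_def)

lemma disj: "a \<in> A \<Longrightarrow> a \<notin> B"
  using tour_onD(3)[OF tour] indep_onD(3)[OF ind] by blast

lemma loops: "a \<in> A \<Longrightarrow> \<not> E a a" "b \<in> B \<Longrightarrow> E b b"
  using tour_onD(3)[OF tour] indep_onD(3)[OF ind] by blast+

lemma VE: "v \<in> V \<Longrightarrow> v \<in> A \<or> v \<in> B \<or> v \<in> core"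
  by (auto simp: core_def)

lemma attached_iff: "v \<in> V - A \<Longrightarrow> attached (gt (insert v A) E) \<longleftrightarrow> v \<in> core"
proof -
  assume v: "v \<in> V - A"
  have "\<not> plugged E A v" if "v \<in> B" using apart that unfolding plugged_def by blast
  then have "plugged E A v \<longleftrightarrow> v \<in> core" using plug v by (auto simp: core_def)
  then show ?thesis using attached_insert_iff[OF tour] v by simp
qed

lemma looped_apart_iff:
  "v \<in> V - A \<Longrightarrow> has_loop (gt (insert v A) E) \<and> loops_apart (gt (insert v A) E) \<longleftrightarrow> v \<in> B"
proof -
  assume v: "v \<in> V - A"
  have "\<exists>a\<in>A. E v a" if "v \<notin> B" using plug[of v] v that unfolding plugged_def by blast
  then have "E v v \<and> (\<forall>b\<in>A. \<not> E v b \<and> \<not> E b v) \<longleftrightarrow> v \<in> B" using apart loops by blast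
  then show ?thesis using loop_apart_insert_iff[OF tour, of v] v by simp
qed

lemma dominating_iff: "v \<in> V - B \<Longrightarrow> dominating (gt (insert v B) E) \<longleftrightarrow> v \<in> core"
proof -
  assume v: "v \<in> V - B"
  have "(\<forall>b\<in>B. E v b \<and> \<not> E b v) \<longleftrightarrow> v \<in> core"
    using dom[of v] apart[of v] ne(2) v by (auto simp: core_def)
  then show ?thesis using dominating_insert_iff[OF ind] v by simp
qed

lemma nonlooped_apart_iff:
  "v \<in> V - B \<Longrightarrow> has_nonloop (gt (insert v B) E) \<and> loops_apart (gt (insert v B) E) \<longleftrightarrow> v \<in> A"
proof -
  assume v: "v \<in> V - B"
  have "\<not> E v v \<and> (\<forall>b\<in>B. \<not> E v b \<and> \<not> E b v) \<longleftrightarrow> v \<in> A"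
    using dom[of v] apart[of v] ne(2) v loops(1)[of v] by blast
  then show ?thesis using nonloop_apart_insert_iff[OF ind, of v] v by simp
qed

lemmas subA = unique_copy_sub_iff[OF fin ne(1) uniqA]
lemmas subB = unique_copy_sub_iff[OF fin ne(2) uniqB]
lemmas extA = unique_copy_ext1_iff[OF fin ne(1) uniqA]
lemmas extB = unique_copy_ext1_iff[OF fin ne(2) uniqB]

lemma sub_cases:
  assumes "q \<sqsubseteq> gt V E"
  obtains W where "W \<subseteq> V" "W \<noteq> {}" "q = gt W E"
  using assms sub_gt_iff[OF fin ne(3), of q E] by blast

text \<open>A set that contains \<open>A\<close> and has only attached one-vertex extensions cannot
  meet \<open>B\<close>, because no arc joins \<open>A\<close> and \<open>B\<close>. The dual
  argument for the other frame uses that a member of \<open>A\<close> does not dominate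
  \<open>B\<close>.\<close>

lemma maximal_attached:
  "maximal (\<lambda>q. gt A E \<sqsubseteq> q \<and> q \<sqsubseteq> gt V E \<and> (\<forall>z. ext1 (gt A E) z q \<longrightarrow> attached z)) q \<longleftrightarrow>
    q = gt (A \<union> core) E"
proof (rule maximal_iff_eq)
  have *: "A \<union> core \<subseteq> V" "A \<subseteq> A \<union> core" "A \<union> core \<noteq> {}" using AV ne by (auto simp: core_def)
  have "attached z" if "ext1 (gt A E) z (gt (A \<union> core) E)" for z
    using that attached_iff *(1) unfolding extA[OF *(1,2)] by blast
  then show "gt A E \<sqsubseteq> gt (A \<union> core) E \<and> gt (A \<union> core) E \<sqsubseteq> gt V E \<and>
      (\<forall>z. ext1 (gt A E) z (gt (A \<union> core) E) \<longrightarrow> attached z)"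
    using * subA[OF *(1,3)] gt_mono[OF fin *(1,3)] by blast
next
  fix q' assume q': "gt A E \<sqsubseteq> q' \<and> q' \<sqsubseteq> gt V E \<and> (\<forall>z. ext1 (gt A E) z q' \<longrightarrow> attached z)"
  then obtain W where W: "W \<subseteq> V" "W \<noteq> {}" "q' = gt W E" using sub_cases by blast
  then have AW: "A \<subseteq> W" using q' subA[OF W(1,2)] by simp
  have "W \<subseteq> A \<union> core"
  proof
    fix v assume "v \<in> W"
    show "v \<in> A \<union> core"
    proof (cases "v \<in> A")
      case False
      then have "ext1 (gt A E) (gt (insert v A) E) q'"
        using \<open>v \<in> W\<close> unfolding W(3) extA[OF W(1) AW] by blast
      then have "attached (gt (insert v A) E)" using q' by blast
      then show ?thesis using attached_iff False \<open>v \<in> W\<close> W(1) by blast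
    qed simp
  qed
  then show "q' \<sqsubseteq> gt (A \<union> core) E" unfolding W(3) using finA finC W(2) by (intro gt_mono) auto
qed

lemma maximal_dominating:
  "maximal (\<lambda>q. gt B E \<sqsubseteq> q \<and> q \<sqsubseteq> gt V E \<and> (\<forall>z. ext1 (gt B E) z q \<longrightarrow> dominating z)) q \<longleftrightarrow>
    q = gt (B \<union> core) E"
proof (rule maximal_iff_eq)
  have *: "B \<union> core \<subseteq> V" "B \<subseteq> B \<union> core" "B \<union> core \<noteq> {}" using BV ne by (auto simp: core_def)
  have "dominating z" if "ext1 (gt B E) z (gt (B \<union> core) E)" for z
    using that dominating_iff *(1) unfolding extB[OF *(1,2)] by blast
  then show "gt B E \<sqsubseteq> gt (B \<union> core) E \<and> gt (B \<union> core) E \<sqsubseteq> gt V E \<and>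
      (\<forall>z. ext1 (gt B E) z (gt (B \<union> core) E) \<longrightarrow> dominating z)"
    using * subB[OF *(1,3)] gt_mono[OF fin *(1,3)] by blast
next
  fix q' assume q': "gt B E \<sqsubseteq> q' \<and> q' \<sqsubseteq> gt V E \<and> (\<forall>z. ext1 (gt B E) z q' \<longrightarrow> dominating z)"
  then obtain W where W: "W \<subseteq> V" "W \<noteq> {}" "q' = gt W E" using sub_cases by blast
  then have BW: "B \<subseteq> W" using q' subB[OF W(1,2)] by simp
  have "W \<subseteq> B \<union> core"
  proof
    fix v assume "v \<in> W"
    show "v \<in> B \<union> core"
    proof (cases "v \<in> B")
      case False
      then have "ext1 (gt B E) (gt (insert v B) E) q'"
        using \<open>v \<in> W\<close> unfolding W(3) extB[OF W(1) BW] by blast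
      then have "dominating (gt (insert v B) E)" using q' by blast
      then show ?thesis using dominating_iff False \<open>v \<in> W\<close> W(1) by blast
    qed simp
  qed
  then show "q' \<sqsubseteq> gt (B \<union> core) E" unfolding W(3) using finB finC W(2) by (intro gt_mono) auto
qed

text \<open>
  A common substructure cannot meet both frames: if \<open>y\<close> goes to the loopless frame \<open>A\<close> in one
  embedding and \<open>x\<close> to the looped frame \<open>B\<close> in the other, then their loops force \<open>y\<close> and \<open>x\<close> into
  the core in the opposite embeddings; the second one yields an arc from \<open>y\<close> to \<open>x\<close>, but no arc
  leaves \<open>A\<close> towards the core.
\<close>

lemma common_sub_core:
  assumes "p \<sqsubseteq> gt (A \<union> core) E" "p \<sqsubseteq> gt (B \<union> core) E"
  shows "p \<sqsubseteq> gt core E"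
proof -
  obtain Y :: "nat set" and D where Y: "finite Y" "Y \<noteq> {}" "p = gt Y D" by (rule gt_cases)
  have fA: "finite (A \<union> core)" "A \<union> core \<noteq> {}" and fB: "finite (B \<union> core)" "B \<union> core \<noteq> {}"
    using finA finB finC ne by auto
  obtain f where f: "inj_on f Y" "f ` Y \<subseteq> A \<union> core" "\<forall>x\<in>Y. \<forall>y\<in>Y. D x y \<longleftrightarrow> E (f x) (f y)"
    using assms(1) unfolding Y(3) gt_sub_gt_iff[OF Y(1,2) fA] by blast
  obtain h where h: "inj_on h Y" "h ` Y \<subseteq> B \<union> core" "\<forall>x\<in>Y. \<forall>y\<in>Y. D x y \<longleftrightarrow> E (h x) (h y)"
    using assms(2) unfolding Y(3) gt_sub_gt_iff[OF Y(1,2) fB] by blast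
  have "f ` Y \<subseteq> core \<or> h ` Y \<subseteq> core"
  proof (rule ccontr)
    assume "\<not> (f ` Y \<subseteq> core \<or> h ` Y \<subseteq> core)"
    then obtain y x where y: "y \<in> Y" "f y \<in> A" and x: "x \<in> Y" "h x \<in> B"
      using f(2) h(2) by blast
    have "\<not> D y y" using f(3) y loops(1) by blast
    moreover have "D x x" using h(3) x loops(2) by blast
    ultimately have "h y \<notin> B" "f x \<notin> A" using f(3) h(3) x y loops by blast+
    then have hy: "h y \<in> core" and fx: "f x \<in> core" using f(2) h(2) x y by auto
    have "D y x" using dom[of "h y" "h x"] hy x y h(3) by (auto simp: core_def)
    moreover have "\<not> E (f y) (f x)"
      using plug[of "f x"] fx y unfolding plugged_def by (auto simp: core_def)
    ultimately show False using f(3) x y by blast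
  qed
  then show ?thesis
    unfolding Y(3) gt_sub_gt_iff[OF Y(1,2) finC ne(4)] using f h by blast
qed

lemma maximal_common:
  "maximal (\<lambda>g. g \<sqsubseteq> gt (A \<union> core) E \<and> g \<sqsubseteq> gt (B \<union> core) E) g \<longleftrightarrow> g = gt core E"
  by (rule maximal_iff_eq) (use finA finB finC ne common_sub_core in \<open>auto intro: gt_mono\<close>)

lemma code_in_scaffold:
  "code_in (gt A E) (gt B E) (gt V E) (gt (B \<union> core) E) (gt (A \<union> core) E) (gt core E)"
proof -
  have "attached z \<or> (has_loop z \<and> loops_apart z)" if "ext1 (gt A E) z (gt V E)" for z
    using that attached_iff looped_apart_iff VE unfolding extA[OF subset_refl AV] by blast
  moreover have "dominating z \<or> (has_nonloop z \<and> loops_apart z)" if "ext1 (gt B E) z (gt V E)" for z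
    using that dominating_iff nonlooped_apart_iff VE unfolding extB[OF subset_refl BV] by blast
  moreover have "(\<forall>z. ext1 (gt A E) z w \<longrightarrow> has_loop z \<and> loops_apart z) \<longleftrightarrow>
      (\<forall>z. ext1 (gt B E) z w \<longrightarrow> has_nonloop z \<and> loops_apart z)"
    if w: "w \<sqsubseteq> gt V E" "gt A E \<sqsubseteq> w" "gt B E \<sqsubseteq> w" for w
  proof -
    obtain W where W: "W \<subseteq> V" "W \<noteq> {}" "w = gt W E" using sub_cases w by blast
    have AW: "A \<subseteq> W" and BW: "B \<subseteq> W" using w subA[OF W(1,2)] subB[OF W(1,2)] W(3) by auto
    \<comment> \<open>This condition and the next both say that \<open>W\<close> consists of the two
      frames only.\<close>
    have "(\<forall>z. ext1 (gt A E) z w \<longrightarrow> has_loop z \<and> loops_apart z) \<longleftrightarrow> W - A \<subseteq> B"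
      unfolding W(3) extA[OF W(1) AW] using looped_apart_iff W(1) by blast
    moreover have "(\<forall>z. ext1 (gt B E) z w \<longrightarrow> has_nonloop z \<and> loops_apart z) \<longleftrightarrow> W - B \<subseteq> A"
      unfolding W(3) extB[OF W(1) BW] using nonlooped_apart_iff W(1) by blast
    ultimately show ?thesis by blast
  qed
  ultimately show ?thesis
    unfolding code_in_def maximal_attached maximal_dominating maximal_common
    using tour_gt[OF finA ne(1)] indep_gt[OF finB ne(2)] tour ind
      gt_mono[OF fin AV ne(1)] gt_mono[OF fin BV ne(2)] by blast
qed

end

text \<open>The extension clauses hold for every copy of a frame at once. Vertices of a second copy
  of the tournament are loopless, so outside the first copy they must be plugged into it, and
  \<open>tour_copy_unique\<close> applies; the looped frame is treated likewise. Only after this can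
  the other clauses be read as statements about vertices.\<close>

lemma code_in_sound:
  assumes code: "code_in t s x y q g"
  obtains V A B :: "nat set" and E
  where "scaffold V A B E" "t = gt A E" "q = gt (A \<union> scaffold.core V A B) E"
    "g = gt (scaffold.core V A B) E"
proof -
  have t: "tour t" and s: "indep s" and tx: "t \<sqsubseteq> x" and sx: "s \<sqsubseteq> x"
    and ext_t: "\<And>z. ext1 t z x \<Longrightarrow> attached z \<or> (has_loop z \<and> loops_apart z)"
    and ext_s: "\<And>z. ext1 s z x \<Longrightarrow> dominating z \<or> (has_nonloop z \<and> loops_apart z)"
    and sep: "\<And>w. w \<sqsubseteq> x \<Longrightarrow> t \<sqsubseteq> w \<Longrightarrow> s \<sqsubseteq> w \<Longrightarrow>
      (\<forall>z. ext1 t z w \<longrightarrow> has_loop z \<and> loops_apart z) \<longleftrightarrow>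
      (\<forall>z. ext1 s z w \<longrightarrow> has_nonloop z \<and> loops_apart z)"
    and q: "maximal (\<lambda>q. t \<sqsubseteq> q \<and> q \<sqsubseteq> x \<and> (\<forall>z. ext1 t z q \<longrightarrow> attached z)) q"
    and y: "maximal (\<lambda>y. s \<sqsubseteq> y \<and> y \<sqsubseteq> x \<and> (\<forall>z. ext1 s z y \<longrightarrow> dominating z)) y"
    and g: "maximal (\<lambda>g. g \<sqsubseteq> q \<and> g \<sqsubseteq> y) g"
    using code unfolding code_in_def by (elim conjE, simp)+
  obtain V :: "nat set" and E where V: "finite V" "V \<noteq> {}" "x = gt V E" by (rule gt_cases)
  have fin: "finite C" if "C \<subseteq> V" for C using V(1) that finite_subset by blast
  obtain A where A: "A \<subseteq> V" "A \<noteq> {}" "t = gt A E"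
    using tx sub_gt_iff[OF V(1,2), of t E] V(3) by blast
  obtain B where B: "B \<subseteq> V" "B \<noteq> {}" "s = gt B E"
    using sx sub_gt_iff[OF V(1,2), of s E] V(3) by blast
  have copy_t: "tour_on E C" "v \<in> V - C \<Longrightarrow> plugged E C v \<or> (E v v \<and> (\<forall>b\<in>C. \<not> E v b \<and> \<not> E b v))"
    if C: "C \<subseteq> V" "C \<noteq> {}" "gt C E = t" for C v
  proof -
    show tour: "tour_on E C" using t C tour_gt[OF fin] by metis
    assume v: "v \<in> V - C"
    have "ext1 t (gt (insert v C) E) x"
      unfolding V(3) ext1_gt_iff[OF V(1,2)] using C v by (intro exI[of _ C] exI[of _ v]) simp
    from ext_t[OF this] show "plugged E C v \<or> (E v v \<and> (\<forall>b\<in>C. \<not> E v b \<and> \<not> E b v))"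
      using attached_insert_iff[OF tour, of v] loop_apart_insert_iff[OF tour, of v] v by simp
  qed
  have copy_s: "indep_on E C" "v \<in> V - C \<Longrightarrow>
      (\<forall>b\<in>C. E v b \<and> \<not> E b v) \<or> (\<not> E v v \<and> (\<forall>b\<in>C. \<not> E v b \<and> \<not> E b v))"
    if C: "C \<subseteq> V" "C \<noteq> {}" "gt C E = s" for C v
  proof -
    show ind: "indep_on E C" using s C indep_gt[OF fin] by metis
    assume v: "v \<in> V - C"
    have "ext1 s (gt (insert v C) E) x"
      unfolding V(3) ext1_gt_iff[OF V(1,2)] using C v by (intro exI[of _ C] exI[of _ v]) simp
    from ext_s[OF this]
    show "(\<forall>b\<in>C. E v b \<and> \<not> E b v) \<or> (\<not> E v v \<and> (\<forall>b\<in>C. \<not> E v b \<and> \<not> E b v))"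
      using dominating_insert_iff[OF ind, of v] nonloop_apart_insert_iff[OF ind, of v] v by simp
  qed
  have uniqA: "unique_copy E A V"
    unfolding unique_copy_def
  proof (intro allI impI, elim conjE)
    fix C assume C: "C \<subseteq> V" "gt C E = gt A E" "C \<noteq> {}"
    have eq: "gt C E = t" "gt A E = t" using C A by simp_all
    note tC = copy_t[OF C(1,3) eq(1)] and tA = copy_t[OF A(1,2) eq(2)]
    show "C = A"
    proof (rule tour_copy_unique[OF tC(1) tA(1)])
      show "card C = card A" using gt_card_eq[of C A E E] C A fin by blast
      show "plugged E C v" if "v \<in> A - C" for v
        using tC(2)[of v] tour_onD(3)[OF tA(1), of v] that A(1) by blast
      show "plugged E A v" if "v \<in> C - A" for v
        using tA(2)[of v] tour_onD(3)[OF tC(1), of v] that C(1) by blast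
    qed
  qed
  have uniqB: "unique_copy E B V"
    unfolding unique_copy_def
  proof (intro allI impI, elim conjE)
    fix C assume C: "C \<subseteq> V" "gt C E = gt B E" "C \<noteq> {}"
    have eq: "gt C E = s" "gt B E = s" using C B by simp_all
    note sC = copy_s[OF C(1,3) eq(1)] and sB = copy_s[OF B(1,2) eq(2)]
    have out: "E v b \<and> \<not> E b v" if "v \<in> V - D" "E v v" "b \<in> D"
      "(\<forall>b\<in>D. E v b \<and> \<not> E b v) \<or> (\<not> E v v \<and> (\<forall>b\<in>D. \<not> E v b \<and> \<not> E b v))" for v b D
      using that by blast
    show "C = B"
    proof (rule indep_copy_unique[of _ _ E])
      show "card C = card B" using gt_card_eq[of C B E E] C B fin by blast
      show "finite C" "finite B" using C B fin by auto
      show "E v b \<and> \<not> E b v" if "v \<in> B - C" "b \<in> C" for v b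
        by (rule out[OF _ _ that(2) sC(2)[of v]])
          (use that(1) B(1) indep_onD(3)[OF sB(1), of v v] in auto)
      show "E v b \<and> \<not> E b v" if "v \<in> C - B" "b \<in> B" for v b
        by (rule out[OF _ _ that(2) sB(2)[of v]])
          (use that(1) C(1) indep_onD(3)[OF sC(1), of v v] in auto)
    qed
  qed
  note tA = copy_t[OF A(1,2) A(3)[symmetric]] and sB = copy_s[OF B(1,2) B(3)[symmetric]]
  have noloop: "\<not> E a a" if "a \<in> A" for a using tour_onD(3)[OF tA(1) that] .
  have loop: "E b b" if "b \<in> B" for b using indep_onD(3)[OF sB(1) that that] by simp
  have disj: "a \<notin> B" if "a \<in> A" for a using noloop[OF that] loop by blast
  \<comment> \<open>The place \<open>p\<close> of \<open>b\<close> lies outside \<open>B\<close>,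
    and a vertex outside \<open>B\<close> receives no arc from \<open>B\<close> in either of its two
    permitted forms.\<close>
  have apartA: "\<not> plugged E A b" if b: "b \<in> B" for b
  proof
    assume "plugged E A b"
    then obtain p where p: "p \<in> A" "E b p" unfolding plugged_def by blast
    then have "p \<in> V - B" using disj A(1) by blast
    from sB(2)[OF this] show False using p(2) b by blast
  qed
  have apart: "\<not> E a b \<and> \<not> E b a" if "a \<in> A" "b \<in> B" for a b
  proof -
    have "b \<in> V - A" using disj that B(1) by blast
    from tA(2)[OF this] show ?thesis using apartA[OF that(2)] that(1) by blast
  qed
  have new: "plugged E A v \<and> (\<forall>b\<in>B. E v b \<and> \<not> E b v)" if v: "v \<in> V" "v \<notin> A" "v \<notin> B" for v
  proof -
    let ?W = "insert v (A \<union> B)"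
    have W: "?W \<subseteq> V" "A \<subseteq> ?W" "B \<subseteq> ?W" "?W \<noteq> {}" using v A B by auto
    have "t \<sqsubseteq> gt ?W E" "s \<sqsubseteq> gt ?W E" "gt ?W E \<sqsubseteq> x"
      unfolding A(3) B(3) V(3) using W fin[OF W(1)] A(2) B(2) V(1) by (auto intro: gt_mono)
    note sep = sep[OF this(3,1,2)]
    have TL: "has_loop (gt (insert u A) E) \<and> loops_apart (gt (insert u A) E) \<longleftrightarrow>
        E u u \<and> (\<forall>b\<in>A. \<not> E u b \<and> \<not> E b u)" if "u \<notin> A" for u
      by (rule loop_apart_insert_iff[OF tA(1) that])
    have SU: "has_nonloop (gt (insert u B) E) \<and> loops_apart (gt (insert u B) E) \<longleftrightarrow>
        \<not> E u u \<and> (\<forall>b\<in>B. \<not> E u b \<and> \<not> E b u)" if "u \<notin> B" for u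
      by (rule nonloop_apart_insert_iff[OF sB(1) that])
    have "(\<forall>z. ext1 t z (gt ?W E) \<longrightarrow> has_loop z \<and> loops_apart z) \<longleftrightarrow>
        (\<forall>u\<in>?W - A. E u u \<and> (\<forall>b\<in>A. \<not> E u b \<and> \<not> E b u))"
      unfolding A(3) unique_copy_ext1_iff[OF V(1) A(2) uniqA W(1,2)] using TL by auto
    also have "\<dots> \<longleftrightarrow> E v v \<and> (\<forall>b\<in>A. \<not> E v b \<and> \<not> E b v)"
      using v(2) loop apart by blast
    finally have T: "(\<forall>z. ext1 t z (gt ?W E) \<longrightarrow> has_loop z \<and> loops_apart z) \<longleftrightarrow>
      E v v \<and> (\<forall>b\<in>A. \<not> E v b \<and> \<not> E b v)" .
    have "(\<forall>z. ext1 s z (gt ?W E) \<longrightarrow> has_nonloop z \<and> loops_apart z) \<longleftrightarrow>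
        (\<forall>u\<in>?W - B. \<not> E u u \<and> (\<forall>b\<in>B. \<not> E u b \<and> \<not> E b u))"
      unfolding B(3) unique_copy_ext1_iff[OF V(1) B(2) uniqB W(1,3)] using SU by auto
    also have "\<dots> \<longleftrightarrow> \<not> E v v \<and> (\<forall>b\<in>B. \<not> E v b \<and> \<not> E b v)"
      using v(3) noloop apart by blast
    finally have "(E v v \<and> (\<forall>b\<in>A. \<not> E v b \<and> \<not> E b v)) \<longleftrightarrow>
        (\<not> E v v \<and> (\<forall>b\<in>B. \<not> E v b \<and> \<not> E b v))"
      using sep T by simp
    \<comment> \<open>The two sides of the equivalence contradict each other on the loop at
      \<open>v\<close>, so both fail; each frame is left with its first alternative for
      \<open>v\<close>.\<close>
    then have "\<not> (E v v \<and> (\<forall>b\<in>A. \<not> E v b \<and> \<not> E b v))"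
      "\<not> (\<not> E v v \<and> (\<forall>b\<in>B. \<not> E v b \<and> \<not> E b v))" by blast+
    then show ?thesis using tA(2)[of v] sB(2)[of v] v by blast
  qed
  \<comment> \<open>Without a core, \<open>q\<close> and \<open>y\<close> would shrink to the two
    frames, and the nonempty digraph \<open>g\<close> would be both loopless and looped.\<close>
  have core: "V - (A \<union> B) \<noteq> {}"
  proof
    assume none: "V - (A \<union> B) = {}"
    have q': "t \<sqsubseteq> q" "q \<sqsubseteq> x" "\<And>z. ext1 t z q \<Longrightarrow> attached z"
      and y': "s \<sqsubseteq> y" "y \<sqsubseteq> x" "\<And>z. ext1 s z y \<Longrightarrow> dominating z"
      and g': "g \<sqsubseteq> q" "g \<sqsubseteq> y"
      using q y g unfolding maximal_def by simp_all
    obtain W where W: "W \<subseteq> V" "W \<noteq> {}" "q = gt W E"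
      using q'(2) sub_gt_iff[OF V(1,2), of q E] V(3) by blast
    have AW: "A \<subseteq> W"
      using q'(1) unique_copy_sub_iff[OF V(1) A(2) uniqA W(1,2)] W(3) A(3) by simp
    have "W \<subseteq> A"
    proof
      fix v assume v: "v \<in> W"
      show "v \<in> A"
      proof (rule ccontr)
        assume "v \<notin> A"
        then have "v \<in> B" using none v W(1) by blast
        have "ext1 t (gt (insert v A) E) q"
          unfolding A(3) W(3) unique_copy_ext1_iff[OF V(1) A(2) uniqA W(1) AW] using v \<open>v \<notin> A\<close> by blast
        then show False
          using q'(3) attached_insert_iff[OF tA(1) \<open>v \<notin> A\<close>] apartA[OF \<open>v \<in> B\<close>] by blast
      qed
    qed
    then have "q = gt A E" using AW W(3) by simp
    then obtain C where C: "C \<subseteq> A" "C \<noteq> {}" "g = gt C E"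
      using g'(1) sub_gt_iff[OF fin[OF A(1)] A(2), of g E] by blast
    obtain W where W: "W \<subseteq> V" "W \<noteq> {}" "y = gt W E"
      using y'(2) sub_gt_iff[OF V(1,2), of y E] V(3) by blast
    have BW: "B \<subseteq> W"
      using y'(1) unique_copy_sub_iff[OF V(1) B(2) uniqB W(1,2)] W(3) B(3) by simp
    have "W \<subseteq> B"
    proof
      fix v assume v: "v \<in> W"
      show "v \<in> B"
      proof (rule ccontr)
        assume "v \<notin> B"
        then have "v \<in> A" using none v W(1) by blast
        have "ext1 s (gt (insert v B) E) y"
          unfolding B(3) W(3) unique_copy_ext1_iff[OF V(1) B(2) uniqB W(1) BW] using v \<open>v \<notin> B\<close> by blast
        then show False
          using y'(3) dominating_insert_iff[OF sB(1) \<open>v \<notin> B\<close>] apart[OF \<open>v \<in> A\<close>] B(2) by blast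
      qed
    qed
    then have "y = gt B E" using BW W(3) by simp
    then obtain D where D: "D \<subseteq> B" "D \<noteq> {}" "g = gt D E"
      using g'(2) sub_gt_iff[OF fin[OF B(1)] B(2), of g E] by blast
    have fC: "finite C" and fD: "finite D"
      using finite_subset[OF C(1)] finite_subset[OF D(1)] A(1) B(1) fin by blast+
    obtain d where "d \<in> D" using D(2) by blast
    then have "has_loop (gt D E)" unfolding has_loop_gt_iff[OF fD D(2)] using loop D(1) by blast
    moreover have "\<not> has_loop (gt C E)" unfolding has_loop_gt_iff[OF fC C(2)] using noloop C(1) by blast
    ultimately show False using C(3) D(3) by simp
  qed
  interpret scaffold V A B E
    by unfold_locales (use V A B tA(1) sB(1) uniqA uniqB apart new core in \<open>auto\<close>)
  have q_eq: "q = gt (A \<union> core) E" using q unfolding A(3) V(3) maximal_attached .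
  have y_eq: "y = gt (B \<union> core) E" using y unfolding B(3) V(3) maximal_dominating .
  have "g = gt core E" using g unfolding q_eq y_eq maximal_common .
  then show ?thesis using that[OF scaffold_axioms A(3) q_eq] by blast
qed

section \<open>Codes in normal form\<close>

datatype vtx = Frame nat | Hub nat | Vert nat

text \<open>The tournament is the order of its indices and a place is a number, so codes of
  different digraphs over frames of equal size literally share the frame. Hubs form the looped
  frame.\<close>

fun join :: "(nat \<Rightarrow> nat \<Rightarrow> bool) \<Rightarrow> (nat \<Rightarrow> nat) \<Rightarrow> vtx \<Rightarrow> vtx \<Rightarrow> bool" where
  "join E p (Frame i) (Frame j) \<longleftrightarrow> i < j"
| "join E p (Hub i) (Hub j) \<longleftrightarrow> i = j"
| "join E p (Vert u) (Vert v) \<longleftrightarrow> E u v"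
| "join E p (Vert u) (Frame j) \<longleftrightarrow> p u = j"
| "join E p (Vert u) (Hub j) \<longleftrightarrow> True"
| "join E p (Frame i) (Hub j) \<longleftrightarrow> False"
| "join E p (Frame i) (Vert v) \<longleftrightarrow> False"
| "join E p (Hub i) (Frame j) \<longleftrightarrow> False"
| "join E p (Hub i) (Vert v) \<longleftrightarrow> False"

definition frame :: "nat \<Rightarrow> vtx set" where
  "frame M = Frame ` {..<M}"

lemma finite_frame: "finite (frame M)" and card_frame: "card (frame M) = M"
  by (simp_all add: frame_def card_image inj_on_def)

lemma mem_frame: "x \<in> frame M \<longleftrightarrow> (\<exists>i<M. x = Frame i)"
  by (auto simp: frame_def)

lemma frame_adj: "x \<in> frame M \<Longrightarrow> y \<in> frame M \<Longrightarrow> x \<noteq> y \<Longrightarrow> join E p x y \<or> join E p y x"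
  by (auto simp: mem_frame)

lemma tour_on_frame: "8 \<le> M \<Longrightarrow> tour_on (join E p) (frame M)"
  unfolding tour_on_def card_frame by (auto simp: mem_frame finite_frame)

section \<open>Rigidity of finite transitive tournaments\<close>

lemma tour_on_enum:
  assumes t: "tour_on E A"
  obtains f where "bij_betw f {..<card A} A"
    "\<And>i j. i < card A \<Longrightarrow> j < card A \<Longrightarrow> E (f i) (f j) \<longleftrightarrow> i < j"
proof -
  have fin: "finite A" by (rule tour_onD[OF t])
  have trans: "E x z" if "x \<in> A" "y \<in> A" "z \<in> A" "E x y" "E y z" for x y z
    using t that unfolding tour_on_def by blast
  \<comment> \<open>The rank is the in-degree inside \<open>A\<close>. Transitivity makes it grow
    strictly along arcs, so it is injective, and counting makes it a bijection onto an initial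
    segment.\<close>
  define r where "r a = card {b \<in> A. E b a}" for a
  have less: "r a < r b" if ab: "a \<in> A" "b \<in> A" "E a b" for a b
  proof -
    have "{c \<in> A. E c a} \<subseteq> {c \<in> A. E c b}" using trans ab by blast
    moreover have "a \<in> {c \<in> A. E c b}" "a \<notin> {c \<in> A. E c a}" using ab tour_onD(3)[OF t] by auto
    ultimately have "{c \<in> A. E c a} \<subset> {c \<in> A. E c b}" by blast
    then show ?thesis unfolding r_def using fin by (intro psubset_card_mono) auto
  qed
  have iff: "E a b \<longleftrightarrow> r a < r b" if "a \<in> A" "b \<in> A" for a b
    using less[OF that] less[OF that(2,1)] tour_onD(5)[OF t that] by (cases "a = b") auto
  have inj: "inj_on r A"
  proof (rule inj_onI)
    fix a b assume ab: "a \<in> A" "b \<in> A" "r a = r b"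
    show "a = b"
    proof (rule ccontr)
      assume "a \<noteq> b"
      then show False using tour_onD(5)[OF t ab(1,2)] iff[OF ab(1,2)] iff[OF ab(2,1)] ab(3) by auto
    qed
  qed
  have "r ` A \<subseteq> {..<card A}"
  proof
    fix k assume "k \<in> r ` A"
    then obtain a where a: "a \<in> A" "k = r a" by blast
    have "{b \<in> A. E b a} \<subset> A" using a(1) tour_onD(3)[OF t a(1)] by blast
    then show "k \<in> {..<card A}" unfolding a(2) r_def using fin by (simp add: psubset_card_mono)
  qed
  moreover have "card (r ` A) = card A" using inj by (rule card_image)
  ultimately have "r ` A = {..<card A}" by (intro card_subset_eq) auto
  then have r: "bij_betw r A {..<card A}" using inj by (simp add: bij_betw_def)
  let ?f = "the_inv_into A r"
  have f: "bij_betw ?f {..<card A} A" using r by (rule bij_betw_the_inv_into)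
  have "E (?f i) (?f j) \<longleftrightarrow> i < j" if "i < card A" "j < card A" for i j
  proof -
    have "?f i \<in> A" "?f j \<in> A" using f that by (auto simp: bij_betw_def)
    moreover have "r (?f i) = i" "r (?f j) = j"
      using that r by (auto simp: f_the_inv_into_f_bij_betw)
    ultimately show ?thesis using iff by simp
  qed
  then show ?thesis using that f by blast
qed

text \<open>The numbers below \<open>i\<close> are mapped onto those below \<open>h i\<close>, so
  the two sets have the same cardinality.\<close>

lemma order_iso_lessThan_id:
  fixes h :: "nat \<Rightarrow> nat"
  assumes h: "bij_betw h {..<M} {..<M}" and mono: "\<And>i j. i < M \<Longrightarrow> j < M \<Longrightarrow> h i < h j \<longleftrightarrow> i < j"
    and i: "i < M"
  shows "h i = i"
proof -
  have hi: "h i < M" using h i by (auto simp: bij_betw_def)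
  have "h ` {..<i} = {..<h i}"
  proof (intro subset_antisym subsetI)
    fix k assume "k \<in> h ` {..<i}"
    then show "k \<in> {..<h i}" using mono i by auto
  next
    fix k assume k: "k \<in> {..<h i}"
    then have "k \<in> h ` {..<M}" using h hi by (auto simp: bij_betw_def)
    then obtain j where "j < M" "k = h j" by blast
    then show "k \<in> h ` {..<i}" using mono[of j i] i k by auto
  qed
  moreover have "inj_on h {..<i}"
    by (rule inj_on_subset[OF bij_betw_imp_inj_on[OF h]]) (use i in auto)
  then have "card (h ` {..<i}) = i" by (simp add: card_image)
  ultimately show ?thesis by simp
qed

text \<open>The two enumerations differ by an order automorphism of an initial segment, which is the
  identity. This makes place numbers comparable between different digraphs.\<close>

lemma tour_enum_unique:
  fixes f f' :: "nat \<Rightarrow> 'v"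
  assumes f: "inj_on f {..<M}" and f': "inj_on f' {..<M}" and im: "f ` {..<M} = f' ` {..<M}"
    and E: "\<And>i j. i < M \<Longrightarrow> j < M \<Longrightarrow> E (f i) (f j) \<longleftrightarrow> i < j"
    and E': "\<And>i j. i < M \<Longrightarrow> j < M \<Longrightarrow> E (f' i) (f' j) \<longleftrightarrow> i < j"
    and i: "i < M"
  shows "f i = f' i"
proof -
  let ?g = "the_inv_into {..<M} f'"
  have g: "f' (?g x) = x" "?g x < M" if "x \<in> f ` {..<M}" for x
  proof -
    have x: "x \<in> f' ` {..<M}" using that unfolding im .
    show "f' (?g x) = x" by (rule f_the_inv_into_f[OF f' x])
    show "?g x < M" using the_inv_into_into[OF f' x subset_refl] by simp
  qed
  let ?h = "\<lambda>i. ?g (f i)"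
  have inj: "inj_on ?h {..<M}"
  proof (rule inj_onI)
    fix j k assume jk: "j \<in> {..<M}" "k \<in> {..<M}" "?h j = ?h k"
    then have "f' (?h j) = f' (?h k)" by simp
    then have "f j = f k" using g(1)[of "f j"] g(1)[of "f k"] jk(1,2) by (simp only: imageI)
    then show "j = k" by (rule inj_onD[OF f _ jk(1,2)])
  qed
  have sub: "?h ` {..<M} \<subseteq> {..<M}" using g(2) by auto
  have "?h ` {..<M} = {..<M}"
    by (rule card_subset_eq[OF finite_lessThan sub card_image[OF inj]])
  then have "bij_betw ?h {..<M} {..<M}" using inj by (simp add: bij_betw_def)
  moreover have "?h j < ?h k \<longleftrightarrow> j < k" if "j < M" "k < M" for j k
  proof -
    have jk: "f j \<in> f ` {..<M}" "f k \<in> f ` {..<M}" using that by auto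
    have "?h j < ?h k \<longleftrightarrow> E (f' (?h j)) (f' (?h k))"
      using E'[OF g(2)[OF jk(1)] g(2)[OF jk(2)]] by simp
    also have "\<dots> \<longleftrightarrow> E (f j) (f k)" unfolding g(1)[OF jk(1)] g(1)[OF jk(2)] ..
    finally show ?thesis unfolding E[OF that] .
  qed
  ultimately have "?h i = i" using i by (rule order_iso_lessThan_id)
  then show ?thesis using g(1)[of "f i"] i by simp
qed

section \<open>Extensions of the frame by one and two vertices\<close>

definition place1 :: "nat \<Rightarrow> (nat \<Rightarrow> nat \<Rightarrow> bool) \<Rightarrow> (nat \<Rightarrow> nat) \<Rightarrow> nat \<Rightarrow> digraph_type" where
  "place1 M E p v = gt (insert (Vert v) (frame M)) (join E p)"

definition place2 :: "nat \<Rightarrow> (nat \<Rightarrow> nat \<Rightarrow> bool) \<Rightarrow> (nat \<Rightarrow> nat) \<Rightarrow> nat \<Rightarrow> nat \<Rightarrow> digraph_type" where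
  "place2 M E p u v = gt (insert (Vert u) (insert (Vert v) (frame M))) (join E p)"

lemma obtain_three:
  assumes "finite F" "4 \<le> card F"
  obtains b c d where "b \<in> F" "c \<in> F" "d \<in> F" "distinct [a, b, c, d]"
proof -
  obtain b where b: "b \<in> F" "b \<notin> set [a]"
    by (rule obtain_fresh[OF assms(1), of "[a]"]) (use assms(2) in auto)
  obtain c where c: "c \<in> F" "c \<notin> set [a, b]"
    by (rule obtain_fresh[OF assms(1), of "[a, b]"])
      (use assms(2) card_length[of "[a, b]"] in auto)
  obtain d where d: "d \<in> F" "d \<notin> set [a, b, c]"
    by (rule obtain_fresh[OF assms(1), of "[a, b, c]"])
      (use assms(2) card_length[of "[a, b, c]"] in auto)
  show ?thesis using that[of b c d] b c d by auto
qed

text \<open>Members of \<open>F\<close> are pairwise adjacent, so three non-neighbours of one of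
  them would have to be found among \<open>u\<close> and \<open>v\<close>. Taking
  \<open>u = v\<close> covers one-vertex extensions.\<close>

lemma apart_from_three:
  assumes F: "\<And>x y. x \<in> F \<Longrightarrow> y \<in> F \<Longrightarrow> x \<noteq> y \<Longrightarrow> E x y \<or> E y x"
    and d: "distinct [x, b, c, d]" and W: "set [x, b, c, d] \<subseteq> insert u (insert v F)"
    and nadj: "\<forall>j\<in>{b, c, d}. \<not> E x j \<and> \<not> E j x"
  shows "x \<notin> F"
proof
  assume x: "x \<in> F"
  have "b \<notin> F" "c \<notin> F" "d \<notin> F" using F[OF x] nadj d by auto
  then have "{b, c, d} \<subseteq> {u, v}" using W by auto
  then have "card {b, c, d} \<le> card {u, v}" by (intro card_mono) auto
  moreover have "card {b, c, d} = 3" using d by simp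
  moreover have "card {u, v} \<le> 2" by (simp add: card_insert_if)
  ultimately show False by simp
qed

lemma has_loop_place1: "has_loop (place1 M E p v) \<longleftrightarrow> E v v"
proof -
  have "finite (insert (Vert v) (frame M))" "insert (Vert v) (frame M) \<noteq> {}"
    by (simp_all add: finite_frame)
  then show ?thesis unfolding place1_def by (subst has_loop_gt_iff) (auto simp: mem_frame)
qed

context
  fixes M :: nat
  assumes M: "8 \<le> M"
begin

lemma frame_ne: "frame M \<noteq> {}"
  using M card_frame[of M] by force

text \<open>An isomorphism sends the new vertex to the new vertex, since it keeps three
  non-neighbours from the frame, and rigidity makes it the identity on frame indices. So the type
  remembers exactly the place and the loop.\<close>

lemma place1_eq_iff:
  assumes p: "p v < M" and p': "p' v' < M"
  shows "place1 M E p v = place1 M E' p' v' \<longleftrightarrow> p v = p' v' \<and> (E v v \<longleftrightarrow> E' v' v')"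
proof -
  let ?V = "insert (Vert v) (frame M)" and ?V' = "insert (Vert v') (frame M)"
  have fin: "finite ?V" "?V \<noteq> {}" "finite ?V'" "?V' \<noteq> {}" by (simp_all add: finite_frame)
  show ?thesis
    unfolding place1_def gt_eq_iff[OF fin]
  proof (intro iffI; (elim exE conjE)?)
    fix f assume f: "bij_betw f ?V ?V'" and hom: "\<forall>x\<in>?V. \<forall>y\<in>?V. join E p x y \<longleftrightarrow> join E' p' (f x) (f y)"
    have inj: "inj_on f ?V" and im: "f ` ?V = ?V'" using f by (auto simp: bij_betw_def)
    obtain b c d where bcd: "b \<in> frame M" "c \<in> frame M" "d \<in> frame M"
        "distinct [Frame (p v), b, c, d]"
      by (rule obtain_three[of "frame M" "Frame (p v)"]) (use M finite_frame card_frame[of M] in auto)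
    have fv: "f (Vert v) \<notin> frame M"
    proof (rule apart_from_three[where E = "join E' p'" and F = "frame M" and b = "f b" and c = "f c"
          and d = "f d" and u = "Vert v'" and v = "Vert v'"])
      show "join E' p' x y \<or> join E' p' y x" if "x \<in> frame M" "y \<in> frame M" "x \<noteq> y" for x y
        using frame_adj that by blast
      have "distinct [Vert v, b, c, d]" using bcd by (auto simp: mem_frame)
      then have "distinct (map f [Vert v, b, c, d])"
        by (subst distinct_map) (use bcd inj_on_subset[OF inj, of "set [Vert v, b, c, d]"] in auto)
      then show "distinct [f (Vert v), f b, f c, f d]" by simp
      show "set [f (Vert v), f b, f c, f d] \<subseteq> insert (Vert v') (insert (Vert v') (frame M))"
        using im bcd by auto
      have "\<not> join E p (Vert v) j \<and> \<not> join E p j (Vert v)" if "j \<in> {b, c, d}" for j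
        using that bcd by (auto simp: mem_frame)
      then show "\<forall>j\<in>{f b, f c, f d}. \<not> join E' p' (f (Vert v)) j \<and> \<not> join E' p' j (f (Vert v))"
        using hom bcd by auto
    qed
    then have fv: "f (Vert v) = Vert v'" using im by auto
    have fr: "f (Frame i) \<in> frame M" if "i < M" for i
    proof -
      have "Frame i \<in> ?V" using that by (simp add: mem_frame)
      moreover have "f (Frame i) \<noteq> f (Vert v)"
        using inj_on_eq_iff[OF inj calculation, of "Vert v"] by simp
      ultimately show ?thesis using im fv by auto
    qed
    have "f (Frame i) = Frame i" if i: "i < M" for i
    proof (rule tour_enum_unique[where E = "join E' p'" and M = M and i = i
          and f = "\<lambda>i. f (Frame i)" and f' = Frame])
      show inj': "inj_on (\<lambda>i. f (Frame i)) {..<M}"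
      proof (rule inj_onI)
        fix j k assume jk: "j \<in> {..<M}" "k \<in> {..<M}" "f (Frame j) = f (Frame k)"
        have "Frame j = Frame k" by (rule inj_onD[OF inj jk(3)]) (use jk in \<open>simp_all add: mem_frame\<close>)
        then show "j = k" by simp
      qed
      then have card: "card ((\<lambda>i. f (Frame i)) ` {..<M}) = M" by (simp add: card_image)
      show "inj_on Frame {..<M}" by (simp add: inj_on_def)
      have "(\<lambda>i. f (Frame i)) ` {..<M} \<subseteq> frame M" using fr by auto
      then have "(\<lambda>i. f (Frame i)) ` {..<M} = frame M"
        using card by (intro card_subset_eq finite_frame) (simp_all add: card_frame)
      then show "(\<lambda>i. f (Frame i)) ` {..<M} = Frame ` {..<M}" by (simp add: frame_def)
      show "join E' p' (f (Frame i)) (f (Frame j)) \<longleftrightarrow> i < j" if "i < M" "j < M" for i j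
        using hom[rule_format, of "Frame i" "Frame j"] that by (simp add: mem_frame)
    qed (use i in auto)
    note fix_frame = this
    have "p v = p' v'"
      using fix_frame[OF p] hom[rule_format, of "Vert v" "Frame (p v)"] p fv by (simp add: mem_frame)
    moreover have "E v v \<longleftrightarrow> E' v' v'" using hom[rule_format, of "Vert v" "Vert v"] fv by simp
    ultimately show "p v = p' v' \<and> (E v v \<longleftrightarrow> E' v' v')" ..
  next
    assume eq: "p v = p' v'" "E v v \<longleftrightarrow> E' v' v'"
    let ?f = "\<lambda>x. case x of Vert _ \<Rightarrow> Vert v' | _ \<Rightarrow> x"
    have "bij_betw ?f ?V ?V'"
      unfolding bij_betw_def frame_def by (simp add: inj_on_def image_image split: vtx.split)
    moreover have "\<forall>x\<in>?V. \<forall>y\<in>?V. join E p x y \<longleftrightarrow> join E' p' (?f x) (?f y)"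
      using eq by (auto simp: mem_frame)
    ultimately show "\<exists>f. bij_betw f ?V ?V' \<and> (\<forall>x\<in>?V. \<forall>y\<in>?V. join E p x y \<longleftrightarrow> join E' p' (f x) (f y))"
      by (intro exI[of _ ?f] conjI)
  qed
qed

end

context
  fixes E :: "nat \<Rightarrow> nat \<Rightarrow> bool" and p :: "nat \<Rightarrow> nat" and u v M :: nat
  assumes M: "8 \<le> M" and uv: "u \<noteq> v" and pu: "p u < M" and pv: "p v < M"
begin

lemma finite_place2:
  "finite (insert (Vert u) (insert (Vert v) (frame M)))"
  "insert (Vert u) (insert (Vert v) (frame M)) \<noteq> {}"
  by (simp_all add: finite_frame)

lemma three_apart:
  obtains b c d where "b < M" "c < M" "d < M" "distinct [b, c, d]" "p u \<notin> {b, c, d}" "p v \<notin> {b, c, d}"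
proof -
  \<comment> \<open>The place of \<open>v\<close> is removed beforehand, and
    \<open>obtain_three\<close> then avoids the place of \<open>u\<close>.\<close>
  have "card ({..<M} - {p v}) = M - 1" using pv by simp
  then have "4 \<le> card ({..<M} - {p v})" using M by simp
  then obtain b c d where "b \<in> {..<M} - {p v}" "c \<in> {..<M} - {p v}" "d \<in> {..<M} - {p v}"
      "distinct [p u, b, c, d]"
    by (rule obtain_three[OF finite_Diff[OF finite_lessThan]])
  then show ?thesis by (intro that[of b c d]) simp_all
qed

lemma apart_Vert:
  assumes d: "distinct [x, b, c, d]"
    and W: "set [x, b, c, d] \<subseteq> insert (Vert u) (insert (Vert v) (frame M))"
    and nadj: "\<forall>j\<in>{b, c, d}. \<not> join E p x j \<and> \<not> join E p j x"
  shows "x = Vert u \<or> x = Vert v"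
proof -
  have "x \<notin> frame M"
  proof (rule apart_from_three[where F = "frame M" and E = "join E p" and b = b and c = c and d = d
        and u = "Vert u" and v = "Vert v"])
    show "join E p y z \<or> join E p z y" if "y \<in> frame M" "z \<in> frame M" "y \<noteq> z" for y z
      by (rule frame_adj[OF that])
    show "distinct [x, b, c, d]" by (rule d)
    show "set [x, b, c, d] \<subseteq> insert (Vert u) (insert (Vert v) (frame M))" by (rule W)
    show "\<forall>j\<in>{b, c, d}. \<not> join E p x j \<and> \<not> join E p j x" by (rule nadj)
  qed
  then show ?thesis using W by auto
qed

lemma same_place_place2: "same_place (place2 M E p u v) \<longleftrightarrow> p u = p v"
proof
  assume "same_place (place2 M E p u v)"
  then obtain x y a b c d where 1: "distinct [x, y, a, b, c, d]"
      "set [x, y, a, b, c, d] \<subseteq> insert (Vert u) (insert (Vert v) (frame M))"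
      "join E p x a" "join E p y a"
      "\<forall>i\<in>{x, y}. \<forall>j\<in>{b, c, d}. \<not> join E p i j \<and> \<not> join E p j i"
    unfolding place2_def same_place_gt_iff[OF finite_place2] by (elim exE conjE)
  have "x = Vert u \<or> x = Vert v" "y = Vert u \<or> y = Vert v"
    by (rule apart_Vert[of _ b c d]; use 1 in simp)+
  moreover from this have "a \<in> frame M" using 1(1,2) by auto
  then obtain i where "a = Frame i" by (auto simp: mem_frame)
  ultimately show "p u = p v" using 1(1,3,4) by auto
next
  assume eq: "p u = p v"
  obtain b c d where bcd: "b < M" "c < M" "d < M" "distinct [b, c, d]" "p u \<notin> {b, c, d}"
    "p v \<notin> {b, c, d}" by (rule three_apart)
  have ne: "b \<noteq> c" "b \<noteq> d" "c \<noteq> d" using bcd(4) by simp_all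
  have ord: "b < c \<or> c < b" "b < d \<or> d < b" "c < d \<or> d < c"
    by (rule linorder_neq_iff[THEN iffD1, OF ne(1)], rule linorder_neq_iff[THEN iffD1, OF ne(2)],
        rule linorder_neq_iff[THEN iffD1, OF ne(3)])
  show "same_place (place2 M E p u v)"
    unfolding place2_def same_place_gt_iff[OF finite_place2]
    by (rule exI[of _ "Vert u"], rule exI[of _ "Vert v"],
        rule exI[of _ "Frame (p u)"], rule exI[of _ "Frame b"], rule exI[of _ "Frame c"],
        rule exI[of _ "Frame d"])
      (use ord bcd eq uv pu in \<open>auto simp: mem_frame\<close>)
qed

text \<open>The relation \<open>R\<close> is left open so that \<open>forward\<close> and
  \<open>backward\<close> are both instances. The three vertices apart force \<open>x\<close> and
  \<open>y\<close> to be the two new vertices, \<open>a\<close> and \<open>a'\<close> are then their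
  places, and the arc from \<open>a\<close> to \<open>a'\<close> tells which of them is
  \<open>u\<close>.\<close>

lemma arc_place2:
  fixes R
  shows "(\<exists>x y a a' b c d. distinct [x, y, a, a', b, c, d] \<and>
      set [x, y, a, a', b, c, d] \<subseteq> insert (Vert u) (insert (Vert v) (frame M)) \<and>
      R x y \<and> join E p x a \<and> join E p y a' \<and> join E p a a' \<and>
      (join E p b c \<or> join E p c b) \<and> (join E p b d \<or> join E p d b) \<and>
      (join E p c d \<or> join E p d c) \<and>
      (\<forall>i\<in>{x, y}. \<forall>j\<in>{b, c, d}. \<not> join E p i j \<and> \<not> join E p j i)) \<longleftrightarrow>
    (p u < p v \<and> R (Vert u) (Vert v)) \<or> (p v < p u \<and> R (Vert v) (Vert u))" (is "?L \<longleftrightarrow> ?R")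
proof
  assume ?L
  then obtain x y a a' b c d where 1: "distinct [x, y, a, a', b, c, d]"
      "set [x, y, a, a', b, c, d] \<subseteq> insert (Vert u) (insert (Vert v) (frame M))"
      "R x y" "join E p x a" "join E p y a'" "join E p a a'"
      "\<forall>i\<in>{x, y}. \<forall>j\<in>{b, c, d}. \<not> join E p i j \<and> \<not> join E p j i"
    by (elim exE conjE)
  have xy: "x = Vert u \<or> x = Vert v" "y = Vert u \<or> y = Vert v"
    by (rule apart_Vert[of _ b c d]; use 1 in simp)+
  have "a \<in> frame M" "a' \<in> frame M" using 1(1,2) xy by auto
  then obtain i j where "a = Frame i" "a' = Frame j" by (auto simp: mem_frame)
  then show ?R using xy 1(1,3-6) by auto
next
  assume ?R
  obtain b c d where bcd: "b < M" "c < M" "d < M" "distinct [b, c, d]" "p u \<notin> {b, c, d}"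
    "p v \<notin> {b, c, d}" by (rule three_apart)
  have ne: "b \<noteq> c" "b \<noteq> d" "c \<noteq> d" using bcd(4) by simp_all
  have ord: "b < c \<or> c < b" "b < d \<or> d < b" "c < d \<or> d < c"
    by (rule linorder_neq_iff[THEN iffD1, OF ne(1)], rule linorder_neq_iff[THEN iffD1, OF ne(2)],
        rule linorder_neq_iff[THEN iffD1, OF ne(3)])
  from \<open>?R\<close> show ?L
  proof
    assume lt: "p u < p v \<and> R (Vert u) (Vert v)"
    show ?L
      by (rule exI[of _ "Vert u"], rule exI[of _ "Vert v"],
          rule exI[of _ "Frame (p u)"], rule exI[of _ "Frame (p v)"], rule exI[of _ "Frame b"],
          rule exI[of _ "Frame c"], rule exI[of _ "Frame d"])
        (use lt ord bcd uv pu pv in \<open>auto simp: mem_frame\<close>)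
  next
    assume lt: "p v < p u \<and> R (Vert v) (Vert u)"
    show ?L
      by (rule exI[of _ "Vert v"], rule exI[of _ "Vert u"],
          rule exI[of _ "Frame (p v)"], rule exI[of _ "Frame (p u)"], rule exI[of _ "Frame b"],
          rule exI[of _ "Frame c"], rule exI[of _ "Frame d"])
        (use lt ord bcd uv pu pv in \<open>auto simp: mem_frame\<close>)
  qed
qed

lemma forward_place2:
  "forward (place2 M E p u v) \<longleftrightarrow> (p u < p v \<and> E u v) \<or> (p v < p u \<and> E v u)"
  unfolding place2_def forward_gt_iff[OF finite_place2] arc_place2[of "join E p"] by simp

lemma backward_place2:
  "backward (place2 M E p u v) \<longleftrightarrow> (p u < p v \<and> E v u) \<or> (p v < p u \<and> E u v)"
  unfolding place2_def backward_gt_iff[OF finite_place2] arc_place2[of "\<lambda>x y. join E p y x"] by simp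

end

text \<open>
  Two one-vertex extensions with equal loops and equal places have the same type, so only the
  passage from a loopless to a looped vertex needs the amalgam \<open>u\<close>.
\<close>

definition lift :: "digraph_type \<Rightarrow> digraph_type \<Rightarrow> bool" where
  "lift z z' \<longleftrightarrow> z = z' \<or>
    (\<not> has_loop z \<and> has_loop z' \<and> (\<exists>u. cover z u \<and> cover z' u \<and> same_place u))"

text \<open>The amalgam in \<open>lift\<close> is an arbitrary digraph. Deleting \<open>a\<close>
  recovers an enumerated frame and the vertex \<open>b\<close> with its place and loop, while
  nothing is known about \<open>a\<close> itself.\<close>

lemma cover_place1E:
  assumes c: "cover (place1 M E p v) (gt U D)" and U: "finite U" "U \<noteq> {}"
  obtains e a b where "inj_on e {..<M}" "\<And>i j. i < M \<Longrightarrow> j < M \<Longrightarrow> D (e i) (e j) \<longleftrightarrow> i < j"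
    "U = insert a (insert b (e ` {..<M}))" "b \<notin> e ` {..<M}" "D b b \<longleftrightarrow> E v v"
    "\<And>i. i < M \<Longrightarrow> D b (e i) \<longleftrightarrow> p v = i"
proof -
  obtain a where a: "a \<in> U" "U - {a} \<noteq> {}" "place1 M E p v = gt (U - {a}) D"
    using c unfolding cover_gt_iff[OF U] by blast
  let ?V = "insert (Vert v) (frame M)"
  have fin: "finite ?V" "?V \<noteq> {}" "finite (U - {a})" using U by (simp_all add: finite_frame)
  obtain f where f: "bij_betw f ?V (U - {a})"
    and hom: "\<forall>x\<in>?V. \<forall>y\<in>?V. join E p x y \<longleftrightarrow> D (f x) (f y)"
    using a(3) unfolding place1_def gt_eq_iff[OF fin a(2)] by (elim exE conjE)
  have inj: "inj_on f ?V" and im: "f ` ?V = U - {a}" using f by (simp_all add: bij_betw_def)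
  let ?e = "\<lambda>i. f (Frame i)"
  have fr: "Frame i \<in> ?V" if "i < M" for i using that by (simp add: mem_frame)
  have e_im: "?e ` {..<M} = f ` frame M" by (simp add: frame_def image_image)
  show ?thesis
  proof (rule that[of ?e a "f (Vert v)"])
    show "inj_on ?e {..<M}"
    proof (rule inj_onI)
      fix i j assume ij: "i \<in> {..<M}" "j \<in> {..<M}" "f (Frame i) = f (Frame j)"
      have "Frame i = Frame j" by (rule inj_onD[OF inj ij(3)]) (use ij fr in simp_all)
      then show "i = j" by simp
    qed
    show "D (?e i) (?e j) \<longleftrightarrow> i < j" if "i < M" "j < M" for i j
      using hom[rule_format, OF fr[OF that(1)] fr[OF that(2)]] by simp
    have "insert (f (Vert v)) (f ` frame M) = U - {a}" using im by simp
    then show "U = insert a (insert (f (Vert v)) (?e ` {..<M}))" unfolding e_im using a(1) by blast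
    show "f (Vert v) \<notin> ?e ` {..<M}"
    proof
      assume "f (Vert v) \<in> ?e ` {..<M}"
      then obtain i where i: "i < M" "f (Vert v) = f (Frame i)" by blast
      have "Vert v = Frame i" by (rule inj_onD[OF inj i(2)]) (use fr[OF i(1)] in simp_all)
      then show False by simp
    qed
    show "D (f (Vert v)) (f (Vert v)) \<longleftrightarrow> E v v"
      using hom[rule_format, of "Vert v" "Vert v"] by simp
    show "D (f (Vert v)) (?e i) \<longleftrightarrow> p v = i" if "i < M" for i
      using hom[rule_format, OF _ fr[OF that], of "Vert v"] by simp
  qed
qed

text \<open>The two covers might use different copies of the frame inside the amalgam. But
  \<open>same_place\<close> supplies two vertices with three common non-neighbours, which lie in
  neither copy; so both copies are the complement of these two vertices, and rigidity identifies
  their enumerations. The common out-neighbour \<open>k\<close> is then the place on both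
  sides.\<close>

lemma lift_place1_imp:
  assumes M: "8 \<le> M" and p: "p v < M" and p': "p' v' < M"
    and lift: "lift (place1 M E p v) (place1 M E' p' v')"
  shows "p v = p' v' \<and> (E v v \<longrightarrow> E' v' v')"
proof (cases "place1 M E p v = place1 M E' p' v'")
  case True
  then show ?thesis
      using place1_eq_iff[where M = M and p = p and v = v and p' = p' and v' = v', OF M p p']
      by simp
next
  case False
  then obtain u where u: "\<not> E v v" "E' v' v'" "cover (place1 M E p v) u"
      "cover (place1 M E' p' v') u" "same_place u"
    using lift unfolding lift_def has_loop_place1 by blast
  obtain U :: "nat set" and D where U: "finite U" "U \<noteq> {}" "u = gt U D" by (rule gt_cases)
  obtain e a b where e: "inj_on e {..<M}" "\<And>i j. i < M \<Longrightarrow> j < M \<Longrightarrow> D (e i) (e j) \<longleftrightarrow> i < j"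
    and eU: "U = insert a (insert b (e ` {..<M}))" and b: "b \<notin> e ` {..<M}" "D b b \<longleftrightarrow> E v v"
    "\<And>i. i < M \<Longrightarrow> D b (e i) \<longleftrightarrow> p v = i"
    using cover_place1E[OF u(3)[unfolded U(3)] U(1,2)] by blast
  obtain e' a' b' where e': "inj_on e' {..<M}" "\<And>i j. i < M \<Longrightarrow> j < M \<Longrightarrow> D (e' i) (e' j) \<longleftrightarrow> i < j"
    and eU': "U = insert a' (insert b' (e' ` {..<M}))" and b': "b' \<notin> e' ` {..<M}" "D b' b' \<longleftrightarrow> E' v' v'"
    "\<And>i. i < M \<Longrightarrow> D b' (e' i) \<longleftrightarrow> p' v' = i"
    using cover_place1E[OF u(4)[unfolded U(3)] U(1,2)] by blast
  obtain x y k l m n where xy: "distinct [x, y, k, l, m, n]" "set [x, y, k, l, m, n] \<subseteq> U"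
      "D x k" "D y k" "\<forall>i\<in>{x, y}. \<forall>j\<in>{l, m, n}. \<not> D i j \<and> \<not> D j i"
    using u(5) unfolding U(3) same_place_gt_iff[OF U(1,2)] by (elim exE conjE)
  have off: "z \<notin> g ` {..<M}"
    if z: "z = x \<or> z = y" and g: "\<And>i j. i < M \<Longrightarrow> j < M \<Longrightarrow> D (g i) (g j) \<longleftrightarrow> i < j"
      and gU: "U = insert c (insert d (g ` {..<M}))" for z g c d
  proof (rule apart_from_three[where E = D and b = l and c = m and d = n and u = c and v = d])
    show "D s t \<or> D t s" if st: "s \<in> g ` {..<M}" "t \<in> g ` {..<M}" "s \<noteq> t" for s t
    proof -
      obtain i j where ij: "i < M" "s = g i" "j < M" "t = g j" using st(1,2) by blast
      then have "i < j \<or> j < i" using st(3) by (cases i j rule: linorder_cases) simp_all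
      then show ?thesis using g[OF ij(1,3)] g[OF ij(3,1)] ij(2,4) by simp
    qed
    show "distinct [z, l, m, n]" using xy(1) z by auto
    show "set [z, l, m, n] \<subseteq> insert c (insert d (g ` {..<M}))" using xy(2) z unfolding gU by auto
    show "\<forall>j\<in>{l, m, n}. \<not> D z j \<and> \<not> D j z" using xy(5) z by blast
  qed
  have xyU: "x \<in> U" "y \<in> U" "k \<in> U" "x \<noteq> y" "k \<noteq> x" "k \<noteq> y" using xy(1,2) by auto
  have ab: "{a, b} = {x, y}"
    using off[OF _ e(2) eU, of x] off[OF _ e(2) eU, of y] xyU(1,2,4) unfolding eU by blast
  have ab': "{a', b'} = {x, y}"
    using off[OF _ e'(2) eU', of x] off[OF _ e'(2) eU', of y] xyU(1,2,4) unfolding eU' by blast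
  have eim: "e ` {..<M} = U - {x, y}"
    using off[OF _ e(2) eU, of x] off[OF _ e(2) eU, of y] eU ab by blast
  moreover have eim': "e' ` {..<M} = U - {x, y}"
    using off[OF _ e'(2) eU', of x] off[OF _ e'(2) eU', of y] eU' ab' by blast
  ultimately have same: "e i = e' i" if "i < M" for i
    by (intro tour_enum_unique[where E = D and M = M, OF e(1) e'(1) _ e(2) e'(2) that]) simp_all
  have "k \<in> e ` {..<M}" unfolding eim using xyU by blast
  then obtain i where i: "i < M" "k = e i" by blast
  have "b \<in> {x, y}" "b' \<in> {x, y}" using ab ab' by blast+
  then have "D b (e i)" "D b' (e' i)" using xy(3,4) i(2) same[OF i(1)] by auto
  then show ?thesis using b(3)[OF i(1)] b'(3)[OF i(1)] u(1) by simp
qed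

lemma lift_place1:
  assumes M: "8 \<le> M" and p: "p v < M" and p': "p' v' < M"
  shows "lift (place1 M E p v) (place1 M E' p' v') \<longleftrightarrow> p v = p' v' \<and> (E v v \<longrightarrow> E' v' v')"
proof
  assume R: "p v = p' v' \<and> (E v v \<longrightarrow> E' v' v')"
  show "lift (place1 M E p v) (place1 M E' p' v')"
  proof (cases "E v v \<longleftrightarrow> E' v' v'")
    case True
    then have "place1 M E p v = place1 M E' p' v'"
      using R place1_eq_iff[where M = M and p = p and v = v and p' = p' and v' = v', OF M p p']
      by simp
    then show ?thesis unfolding lift_def by simp
  next
    case False
    then have l: "\<not> E v v" "E' v' v'" using R by auto
    \<comment> \<open>The witness has the loopless vertex 0 and the looped vertex 1 at the same
      place; deleting either leaves one of the two given extensions.\<close>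
    let ?D = "\<lambda>i j :: nat. i = 1" and ?p = "\<lambda>_ :: nat. p v"
    have W: "finite (insert (Vert 0) (insert (Vert 1) (frame M)))"
      "insert (Vert 0) (insert (Vert 1) (frame M)) \<noteq> {}" by (simp_all add: finite_frame)
    have "place1 M ?D ?p 0 = place1 M E p v" "place1 M ?D ?p 1 = place1 M E' p' v'"
      using l R p p' place1_eq_iff[where p = ?p and v = 0 and p' = p and v' = v and E = ?D and E' = E, OF M]
        place1_eq_iff[where p = ?p and v = 1 and p' = p' and v' = v' and E = ?D and E' = E', OF M]
      by simp_all
    moreover have "insert (Vert 0) (insert (Vert 1) (frame M)) - {Vert 1} = insert (Vert 0) (frame M)"
      "insert (Vert 0) (insert (Vert 1) (frame M)) - {Vert 0} = insert (Vert 1) (frame M)"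
      by (auto simp: mem_frame)
    ultimately have "cover (place1 M E p v) (place2 M ?D ?p 0 1)"
      "cover (place1 M E' p' v') (place2 M ?D ?p 0 1)"
      unfolding place2_def cover_gt_iff[OF W] unfolding place1_def
      by (metis insertCI insert_not_empty)+
    moreover have "same_place (place2 M ?D ?p 0 1)"
      using same_place_place2[where p = ?p and u = 0 and v = 1 and E = ?D, OF M] p by simp
    ultimately show ?thesis unfolding lift_def has_loop_place1 using l by blast
  qed
qed (rule lift_place1_imp[where p = p and v = v and p' = p' and v' = v', OF M p p'])

definition frame_type :: "nat \<Rightarrow> digraph_type" where
  "frame_type M = gt {..<M} (<)"

lemma gt_frame: "8 \<le> M \<Longrightarrow> gt (frame M) (join E p) = frame_type M"
  unfolding frame_type_def frame_def
  by (rule gt_image) (auto simp: inj_on_def lessThan_empty_iff)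

text \<open>The normal form of the part of a code that is compared: the hubs have done their work
  once \<open>G\<close> and its places are isolated, so they are dropped.\<close>

locale coded =
  fixes M :: nat and G :: "nat set" and E :: "nat \<Rightarrow> nat \<Rightarrow> bool" and p :: "nat \<Rightarrow> nat"
  assumes M: "8 \<le> M" and finG: "finite G" and G_ne: "G \<noteq> {}" and inj_p: "inj_on p G"
    and p_less: "\<And>v. v \<in> G \<Longrightarrow> p v < M"
    and uniq: "unique_copy (join E p) (frame M) (frame M \<union> Vert ` G)"
begin

definition code_type :: digraph_type where
  "code_type = gt (frame M \<union> Vert ` G) (join E p)"

lemma fin_code: "finite (frame M \<union> Vert ` G)"
  by (simp add: finite_frame finG)

lemma ext1_code: "ext1 (frame_type M) z code_type \<longleftrightarrow> (\<exists>v\<in>G. z = place1 M E p v)"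
  unfolding code_type_def gt_frame[OF M, of E p, symmetric]
    unique_copy_ext1_iff[OF fin_code frame_ne[OF M] uniq subset_refl Un_upper1] place1_def
  by (auto simp: mem_frame)

lemma ext2_code: "ext2 (frame_type M) w code_type \<longleftrightarrow>
    (\<exists>u v. u \<in> G \<and> v \<in> G \<and> u \<noteq> v \<and> w = place2 M E p u v)"
  unfolding code_type_def gt_frame[OF M, of E p, symmetric]
    unique_copy_ext2_iff[OF fin_code frame_ne[OF M] uniq subset_refl Un_upper1] place2_def
  by (auto simp: mem_frame)

lemma ext1_place2:
  assumes "u \<in> G" "v \<in> G"
  shows "ext1 (frame_type M) z (place2 M E p u v) \<longleftrightarrow> z = place1 M E p u \<or> z = place1 M E p v"
proof -
  have W: "insert (Vert u) (insert (Vert v) (frame M)) \<subseteq> frame M \<union> Vert ` G"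
    "frame M \<subseteq> insert (Vert u) (insert (Vert v) (frame M))" using assms by auto
  show ?thesis
    unfolding place2_def place1_def gt_frame[OF M, of E p, symmetric]
      unique_copy_ext1_iff[OF fin_code frame_ne[OF M] uniq W]
    by (auto simp: mem_frame)
qed

end

section \<open>Codes and their comparison\<close>

definition code :: "digraph_type \<Rightarrow> digraph_type \<Rightarrow> digraph_type \<Rightarrow> bool" where
  "code t q g \<longleftrightarrow> (\<exists>x s y. code_in t s x y q g) \<and> (\<forall>w. ext2 t w q \<longrightarrow> \<not> same_place w)"

text \<open>The first clause sends each vertex to the one with the same place and preserves loops.
  In the second, the condition on one-vertex extensions says that \<open>w'\<close> has the same two
  places as \<open>w\<close>, so it is the image pair; arcs are then compared relative to the order
  of these places.\<close>

definition compare :: "digraph_type \<Rightarrow> digraph_type \<Rightarrow> digraph_type \<Rightarrow> bool" where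
  "compare t q r \<longleftrightarrow> (\<forall>z. ext1 t z q \<longrightarrow> (\<exists>z'. ext1 t z' r \<and> lift z z')) \<and>
    (\<forall>w w'. ext2 t w q \<and> ext2 t w' r \<and>
      (\<forall>z. ext1 t z w \<longrightarrow> (\<exists>z'. ext1 t z' w' \<and> lift z z')) \<longrightarrow>
      (forward w \<longrightarrow> forward w') \<and> (backward w \<longrightarrow> backward w'))"

lemma code_sound:
  assumes code: "code t q g"
  obtains M G E p where "coded M G E p" "t = frame_type M" "q = coded.code_type M G E p"
    "g = gt G E"
proof -
  obtain x s y where in_x: "code_in t s x y q g"
    and places: "\<And>w. ext2 t w q \<Longrightarrow> \<not> same_place w"
    using code unfolding code_def by blast
  obtain V A B :: "nat set" and E where S: "scaffold V A B E" "t = gt A E"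
      "q = gt (A \<union> scaffold.core V A B) E" "g = gt (scaffold.core V A B) E"
    by (rule code_in_sound[OF in_x])
  interpret S: scaffold V A B E by (rule S(1))
  define M where "M = card A"
  define G where "G = S.core"
  have M: "8 \<le> M" using tour_onD(2)[OF S.tour] by (simp add: M_def)
  have fG: "finite G" "G \<noteq> {}" using S.finC S.ne(4) by (simp_all add: G_def)
  obtain f where f: "bij_betw f {..<M} A"
    and f_less: "\<And>i j. i < M \<Longrightarrow> j < M \<Longrightarrow> E (f i) (f j) \<longleftrightarrow> i < j"
    unfolding M_def using tour_on_enum[OF S.tour] by metis
  have f_inj: "inj_on f {..<M}" and f_im: "f ` {..<M} = A" using f by (simp_all add: bij_betw_def)
  have fA: "f i \<in> A" if "i < M" for i using f_im that by blast
  have GA: "v \<notin> A" if "v \<in> G" for v using that by (simp add: G_def S.core_def)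
  have "\<forall>v\<in>G. \<exists>i. i < M \<and> (\<forall>j<M. \<not> E (f j) v \<and> (E v (f j) \<longleftrightarrow> i = j))"
  proof
    fix v assume "v \<in> G"
    then have "plugged E A v" using S.plug[of v] by (simp add: G_def S.core_def)
    then obtain a where a: "a \<in> A" "\<And>b. b \<in> A \<Longrightarrow> \<not> E b v \<and> (E v b \<longleftrightarrow> b = a)"
      unfolding plugged_def by blast
    obtain i where i: "i < M" "a = f i" using a(1) f_im by blast
    have "f j = f i \<longleftrightarrow> i = j" if "j < M" for j
      using inj_on_eq_iff[OF f_inj, of j i] that i(1) by auto
    then have "\<forall>j<M. \<not> E (f j) v \<and> (E v (f j) \<longleftrightarrow> i = j)" using a(2)[OF fA] i(2) by simp
    then show "\<exists>i. i < M \<and> (\<forall>j<M. \<not> E (f j) v \<and> (E v (f j) \<longleftrightarrow> i = j))" using i(1) by blast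
  qed
  then obtain p where p: "\<forall>v\<in>G. p v < M \<and> (\<forall>j<M. \<not> E (f j) v \<and> (E v (f j) \<longleftrightarrow> p v = j))"
    by (rule bchoice[THEN exE])
  \<comment> \<open>The identification of the normal form with \<open>A\<close> and the core. The
    value on hubs is a dummy, as no hub occurs in \<open>?Q\<close>.\<close>
  define h where "h x = (case x of Frame i \<Rightarrow> f i | Hub i \<Rightarrow> i | Vert v \<Rightarrow> v)" for x
  let ?Q = "frame M \<union> Vert ` G"
  have finQ: "finite ?Q" by (simp add: finite_frame fG)
  have h_frame: "h ` frame M = A" unfolding frame_def image_image h_def using f_im by simp
  have h_core: "h ` Vert ` G = G" unfolding image_image h_def by simp
  have h_inj: "inj_on h ?Q"
  proof (rule inj_onI)
    fix x y assume xy: "x \<in> ?Q" "y \<in> ?Q" "h x = h y"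
    consider i j where "x = Frame i" "y = Frame j" "i < M" "j < M"
      | i v where "x = Frame i" "y = Vert v" "i < M" "v \<in> G"
      | i v where "x = Vert v" "y = Frame i" "i < M" "v \<in> G"
      | u v where "x = Vert u" "y = Vert v"
      using xy(1,2) by (auto simp: mem_frame)
    then show "x = y"
    proof cases
      case (1 i j)
      then show ?thesis using inj_on_eq_iff[OF f_inj, of i j] xy(3) by (simp add: h_def)
    next
      case (2 i v)
      then show ?thesis using fA[of i] GA[of v] xy(3) by (simp add: h_def)
    next
      case (3 i v)
      then show ?thesis using fA[of i] GA[of v] xy(3) by (simp add: h_def)
    next
      case (4 u v)
      then show ?thesis using xy(3) by (simp add: h_def)
    qed
  qed
  have h_hom: "join E p x y \<longleftrightarrow> E (h x) (h y)" if "x \<in> ?Q" "y \<in> ?Q" for x y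
    using that p f_less by (auto simp: mem_frame h_def)
  have h_gt: "gt (h ` C) E = gt C (join E p)" if "C \<subseteq> ?Q" "C \<noteq> {}" for C
  proof (rule gt_image)
    show "finite C" using finite_subset[OF that(1) finQ] .
    show "inj_on h C" using inj_on_subset[OF h_inj that(1)] .
    show "join E p x y \<longleftrightarrow> E (h x) (h y)" if "x \<in> C" "y \<in> C" for x y
      using h_hom[of x y] that \<open>C \<subseteq> ?Q\<close> by blast
  qed (rule that(2))
  have t: "t = gt (frame M) (join E p)"
    using h_gt[of "frame M"] frame_ne[OF M] S(2) h_frame by simp
  have "h ` ?Q = A \<union> G" unfolding image_Un h_frame h_core ..
  then have q: "q = gt ?Q (join E p)"
    using h_gt[of ?Q] frame_ne[OF M] S(3) by (simp add: G_def)
  have uniq: "unique_copy (join E p) (frame M) ?Q"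
    unfolding unique_copy_def
  proof (intro allI impI, elim conjE)
    fix C assume C: "C \<subseteq> ?Q" "gt C (join E p) = gt (frame M) (join E p)" "C \<noteq> {}"
    have "gt (h ` C) E = gt A E" using h_gt[OF C(1,3)] C(2) t S(2) by simp
    moreover have "h ` C \<subseteq> V"
      using image_mono[OF C(1), of h] \<open>h ` ?Q = A \<union> G\<close> S.AV by (auto simp: G_def S.core_def)
    ultimately have "h ` C = h ` frame M"
      using S.uniqA C(3) unfolding unique_copy_def h_frame by simp
    then show "C = frame M" using inj_on_image_eq_iff[OF h_inj C(1), of "frame M"] by simp
  qed
  \<comment> \<open>Two vertices with equal places would form a two-vertex extension excluded by the
    \<open>same_place\<close> clause.\<close>
  have "inj_on p G"
  proof (rule inj_onI, rule ccontr)
    fix u v assume uv: "u \<in> G" "v \<in> G" "p u = p v" "u \<noteq> v"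
    have "ext2 t (place2 M E p u v) q"
      unfolding t q unique_copy_ext2_iff[OF finQ frame_ne[OF M] uniq subset_refl Un_upper1] place2_def
      using uv by (intro exI[of _ "Vert u"] exI[of _ "Vert v"] conjI) (simp_all add: mem_frame image_iff)
    then have "\<not> same_place (place2 M E p u v)" by (rule places)
    then show False using same_place_place2[OF M uv(4), of p E] p uv by simp
  qed
  then have c: "coded M G E p" using M fG p uniq by unfold_locales auto
  show ?thesis
  proof (rule that[OF c])
    show "t = frame_type M" unfolding t gt_frame[OF M] ..
    show "q = coded.code_type M G E p" unfolding q coded.code_type_def[OF c] ..
    show "g = gt G E" unfolding S(4) G_def ..
  qed
qed

lemma compare_sound:
  assumes c: "coded M G E p" and c': "coded M H E' p'"
    and cmp: "compare (frame_type M) (coded.code_type M G E p) (coded.code_type M H E' p')"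
  shows "gt G E \<preceq> gt H E'"
proof -
  interpret c: coded M G E p by (rule c)
  interpret c': coded M H E' p' by (rule c')
  have cmp1: "\<exists>z'. ext1 (frame_type M) z' c'.code_type \<and> lift z z'"
    if "ext1 (frame_type M) z c.code_type" for z
    using cmp that unfolding compare_def by blast
  have cmp2: "(forward w \<longrightarrow> forward w') \<and> (backward w \<longrightarrow> backward w')"
    if "ext2 (frame_type M) w c.code_type" "ext2 (frame_type M) w' c'.code_type"
      "\<forall>z. ext1 (frame_type M) z w \<longrightarrow> (\<exists>z'. ext1 (frame_type M) z' w' \<and> lift z z')" for w w'
    using cmp that unfolding compare_def by blast
  have "\<forall>v\<in>G. \<exists>u. u \<in> H \<and> p v = p' u \<and> (E v v \<longrightarrow> E' u u)"
  proof
    fix v assume v: "v \<in> G"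
    obtain u where u: "u \<in> H" "lift (place1 M E p v) (place1 M E' p' u)"
      using cmp1[of "place1 M E p v"] v unfolding c.ext1_code c'.ext1_code by blast
    show "\<exists>u. u \<in> H \<and> p v = p' u \<and> (E v v \<longrightarrow> E' u u)"
      using lift_place1_imp[where p = p and p' = p', OF c.M c.p_less[OF v] c'.p_less[OF u(1)] u(2)] u(1)
      by blast
  qed
  then obtain f where f: "\<forall>v\<in>G. f v \<in> H \<and> p v = p' (f v) \<and> (E v v \<longrightarrow> E' (f v) (f v))"
    by (rule bchoice[THEN exE])
  have inj: "inj_on f G"
  proof (rule inj_onI)
    fix u v assume uv: "u \<in> G" "v \<in> G" "f u = f v"
    then have "p u = p v" using f by simp
    then show "u = v" by (rule inj_onD[OF c.inj_p _ uv(1,2)])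
  qed
  have "E' (f u) (f v)" if uv: "u \<in> G" "v \<in> G" "E u v" for u v
  proof (cases "u = v")
    case True
    then show ?thesis using f uv by blast
  next
    case False
    have fuv: "f u \<noteq> f v" using inj_on_eq_iff[OF inj uv(1,2)] False by simp
    have fH: "f u \<in> H" "f v \<in> H" using f uv by blast+
    have pf: "p u = p' (f u)" "p v = p' (f v)" using f uv by blast+
    have pne: "p u \<noteq> p v" using inj_on_eq_iff[OF c.inj_p uv(1,2)] False by simp
    let ?w = "place2 M E p u v" and ?w' = "place2 M E' p' (f u) (f v)"
    have l: "lift (place1 M E p x) (place1 M E' p' (f x))" if "x \<in> G" for x
      using lift_place1[where p = p and v = x and p' = p' and v' = "f x" and E = E and E' = E',
          OF c.M c.p_less[OF that] c'.p_less] f that by blast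
    have "(forward ?w \<longrightarrow> forward ?w') \<and> (backward ?w \<longrightarrow> backward ?w')"
    proof (rule cmp2)
      show "ext2 (frame_type M) ?w c.code_type" unfolding c.ext2_code using uv False by blast
      show "ext2 (frame_type M) ?w' c'.code_type" unfolding c'.ext2_code using fH fuv by blast
      show "\<forall>z. ext1 (frame_type M) z ?w \<longrightarrow> (\<exists>z'. ext1 (frame_type M) z' ?w' \<and> lift z z')"
        unfolding c.ext1_place2[OF uv(1,2)] c'.ext1_place2[OF fH] using l[OF uv(1)] l[OF uv(2)] by blast
    qed
    \<comment> \<open>Which of the two patterns reports the arc from \<open>u\<close> to
      \<open>v\<close> depends on whose place comes first; the images have the same places, so the
      same pattern reports the image arc.\<close>
    then show ?thesis
      unfolding forward_place2[where p = p and E = E, OF c.M False c.p_less[OF uv(1)] c.p_less[OF uv(2)]]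
        backward_place2[where p = p and E = E, OF c.M False c.p_less[OF uv(1)] c.p_less[OF uv(2)]]
        forward_place2[where p = p' and E = E', OF c.M fuv c'.p_less[OF fH(1)] c'.p_less[OF fH(2)]]
        backward_place2[where p = p' and E = E', OF c.M fuv c'.p_less[OF fH(1)] c'.p_less[OF fH(2)]]
      using pne uv(3) unfolding pf by (cases "p' (f u)" "p' (f v)" rule: linorder_cases) simp_all
  qed
  then show ?thesis
    unfolding embeddable_gt_iff[OF c.finG c.G_ne c'.finG c'.G_ne]
    using inj f by (intro exI[of _ f] conjI) blast+
qed

lemma compare_complete:
  assumes c: "coded M G E p" and c': "coded M H E' p'"
    and inj: "inj_on f G" and fH: "\<And>v. v \<in> G \<Longrightarrow> f v \<in> H"
    and hom: "\<And>u v. u \<in> G \<Longrightarrow> v \<in> G \<Longrightarrow> E u v \<Longrightarrow> E' (f u) (f v)"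
    and pf: "\<And>v. v \<in> G \<Longrightarrow> p v = p' (f v)"
  shows "compare (frame_type M) (coded.code_type M G E p) (coded.code_type M H E' p')"
proof -
  interpret c: coded M G E p by (rule c)
  interpret c': coded M H E' p' by (rule c')
  have lift_iff: "lift (place1 M E p v) (place1 M E' p' u) \<longleftrightarrow> p v = p' u \<and> (E v v \<longrightarrow> E' u u)"
    if "v \<in> G" "u \<in> H" for u v
    by (rule lift_place1[where p = p and p' = p', OF c.M c.p_less[OF that(1)] c'.p_less[OF that(2)]])
  show ?thesis
    unfolding compare_def c.ext1_code c'.ext1_code c.ext2_code c'.ext2_code
  proof (intro conjI allI impI; (elim exE conjE bexE)?)
    fix z v assume v: "v \<in> G" "z = place1 M E p v"
    show "\<exists>z'. (\<exists>v\<in>H. z' = place1 M E' p' v) \<and> lift z z'"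
      unfolding v(2) using lift_iff[OF v(1) fH[OF v(1)]] pf[OF v(1)] hom[OF v(1) v(1)] fH[OF v(1)] by blast
  next
    fix w w' u v u' v'
    assume uv: "u \<in> G" "v \<in> G" "u \<noteq> v" "w = place2 M E p u v"
      and uv': "u' \<in> H" "v' \<in> H" "u' \<noteq> v'" "w' = place2 M E' p' u' v'"
      and exts: "\<forall>z. ext1 (frame_type M) z w \<longrightarrow> (\<exists>z'. ext1 (frame_type M) z' w' \<and> lift z z')"
    \<comment> \<open>Places identify the vertices of \<open>H\<close>, so matching the one-vertex
      extensions forces \<open>u'\<close> and \<open>v'\<close> to be the images of \<open>u\<close>
      and \<open>v\<close> in some order.\<close>
    have at: "f x = u' \<or> f x = v'" if "x = u \<or> x = v" for x
    proof -
      have x: "x \<in> G" "ext1 (frame_type M) (place1 M E p x) w"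
        using that uv(1,2) unfolding uv(4) c.ext1_place2[OF uv(1,2)] by blast+
      then obtain z' where "z' = place1 M E' p' u' \<or> z' = place1 M E' p' v'" "lift (place1 M E p x) z'"
        using exts unfolding uv'(4) c'.ext1_place2[OF uv'(1,2)] by blast
      then have "p x = p' u' \<or> p x = p' v'"
        using lift_iff[OF x(1) uv'(1)] lift_iff[OF x(1) uv'(2)] by blast
      then show ?thesis
        unfolding pf[OF x(1)]
        using inj_on_eq_iff[OF c'.inj_p fH[OF x(1)] uv'(1)] inj_on_eq_iff[OF c'.inj_p fH[OF x(1)] uv'(2)]
        by blast
    qed
    have fuv: "f u \<noteq> f v" using inj_on_eq_iff[OF inj uv(1,2)] uv(3) by simp
    then have "(u' = f u \<and> v' = f v) \<or> (u' = f v \<and> v' = f u)" using at[of u] at[of v] by auto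
    moreover have "E u v \<longrightarrow> E' (f u) (f v)" "E v u \<longrightarrow> E' (f v) (f u)" using hom uv(1,2) by blast+
    ultimately have "(forward w \<longrightarrow> forward w') \<and> (backward w \<longrightarrow> backward w')"
      unfolding uv(4) uv'(4)
        forward_place2[where p = p and E = E, OF c.M uv(3) c.p_less[OF uv(1)] c.p_less[OF uv(2)]]
        backward_place2[where p = p and E = E, OF c.M uv(3) c.p_less[OF uv(1)] c.p_less[OF uv(2)]]
        forward_place2[where p = p' and E = E', OF c.M uv'(3) c'.p_less[OF uv'(1)] c'.p_less[OF uv'(2)]]
        backward_place2[where p = p' and E = E', OF c.M uv'(3) c'.p_less[OF uv'(1)] c'.p_less[OF uv'(2)]]
        pf[OF uv(1)] pf[OF uv(2)] by blast
    then show "forward w \<Longrightarrow> forward w'" "backward w \<Longrightarrow> backward w'" by blast+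
  qed
qed

text \<open>\<open>Suc (p v) < M\<close> keeps places off the last tournament vertex. Both frames
  are chosen larger than \<open>G\<close>, so that neither can be copied with the help of vertices
  of \<open>G\<close>.\<close>

lemma code_complete:
  fixes E :: "nat \<Rightarrow> nat \<Rightarrow> bool"
  assumes G: "finite G" "G \<noteq> {}" and p: "inj_on p G" "\<And>v. v \<in> G \<Longrightarrow> Suc (p v) < M"
    and big: "card G + 8 \<le> M"
  shows "coded M G E p \<and> code (frame_type M) (coded.code_type M G E p) (gt G E)"
proof -
  let ?J = "join E p"
  let ?B = "Hub ` {..<card G + 2}" and ?C = "Vert ` G"
  let ?V = "frame M \<union> ?B \<union> ?C"
  have M: "8 \<le> M" using big by simp
  have fin: "finite ?V" "finite ?C" "finite ?B" by (simp_all add: finite_frame G(1))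
  have card_C: "card ?C = card G" by (simp add: card_image inj_on_def)
  have card_B: "card ?B = card G + 2" by (simp add: card_image inj_on_def)
  have tour: "tour_on ?J (frame M)" by (rule tour_on_frame[OF M])
  have ind: "indep_on ?J ?B" unfolding indep_on_def card_B using fin(3) by auto
  have uniqA: "unique_copy ?J (frame M) ?V"
    unfolding unique_copy_def
  proof (intro allI impI, elim conjE)
    fix D assume D: "D \<subseteq> ?V" "gt D ?J = gt (frame M) ?J" "D \<noteq> {}"
    have fD: "finite D" by (rule finite_subset[OF D(1) fin(1)])
    have cD: "card D = M"
      using gt_card_eq[OF fD D(3) finite_frame frame_ne[OF M] D(2)] by (simp add: card_frame)
    have tD: "tour_on ?J D"
      using tour_gt[OF fD D(3), of ?J] tour_gt[OF finite_frame frame_ne[OF M], of ?J] D(2) tour by simp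
    have noB: "Hub i \<notin> D" for i using tour_onD(3)[OF tD, of "Hub i"] by auto
    \<comment> \<open>A tournament through \<open>Vert v\<close> contains at most the frame vertex
      \<open>Frame (p v)\<close>, the only one adjacent to \<open>Vert v\<close>, and is too small
      otherwise confined to \<open>G\<close>.\<close>
    have noV: "Vert v \<notin> D" for v
    proof
      assume v: "Vert v \<in> D"
      have "D \<subseteq> insert (Frame (p v)) ?C"
      proof
        fix x assume x: "x \<in> D"
        show "x \<in> insert (Frame (p v)) ?C"
        proof (cases x)
          case (Frame i)
          then show ?thesis using tour_onD(5)[OF tD v x] by auto
        qed (use x noB D(1) in \<open>auto simp: mem_frame\<close>)
      qed
      then have "card D \<le> card (insert (Frame (p v)) ?C)" using fin(2) by (intro card_mono) auto
      also have "\<dots> \<le> Suc (card G)" using card_insert_le_m1[of "Suc (card G)" ?C] card_C by simp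
      finally show False using cD big by simp
    qed
    have "D \<subseteq> frame M"
    proof
      fix x assume x: "x \<in> D"
      then have "x \<in> ?V" using D(1) by blast
      then show "x \<in> frame M" using x noB noV by (cases x) (auto simp: mem_frame)
    qed
    then show "D = frame M" using cD by (intro card_subset_eq finite_frame) (simp_all add: card_frame)
  qed
  have uniqB: "unique_copy ?J ?B ?V"
    unfolding unique_copy_def
  proof (intro allI impI, elim conjE)
    fix D assume D: "D \<subseteq> ?V" "gt D ?J = gt ?B ?J" "D \<noteq> {}"
    have fD: "finite D" by (rule finite_subset[OF D(1) fin(1)])
    have B_ne: "?B \<noteq> {}" using indep_on_ne[OF ind] .
    have cD: "card D = card G + 2"
      using gt_card_eq[OF fD D(3) fin(3) B_ne D(2)] card_B by simp
    have iD: "indep_on ?J D"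
      using indep_gt[OF fD D(3), of ?J] indep_gt[OF fin(3) B_ne, of ?J] D(2) ind by simp
    have noF: "Frame i \<notin> D" for i using indep_onD(3)[OF iD, of "Frame i" "Frame i"] by auto
    \<comment> \<open>Every hub is adjacent to \<open>Vert v\<close>, so an arcless looped set
      through \<open>Vert v\<close> lies inside the copy of \<open>G\<close>, which is too
      small.\<close>
    have noV: "Vert v \<notin> D" for v
    proof
      assume v: "Vert v \<in> D"
      have noH: "Hub i \<notin> D" for i using indep_onD(3)[OF iD v, of "Hub i"] by auto
      have "D \<subseteq> ?C"
      proof
        fix x assume x: "x \<in> D"
        then have "x \<in> ?V" using D(1) by blast
        then show "x \<in> ?C" using x noF noH by (cases x) (auto simp: mem_frame)
      qed
      then have "card D \<le> card ?C" using fin(2) by (intro card_mono) auto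
      then show False using cD card_C by simp
    qed
    have "D \<subseteq> ?B"
    proof
      fix x assume x: "x \<in> D"
      then have "x \<in> ?V" using D(1) by blast
      then show "x \<in> ?B" using x noF noV by (cases x) (auto simp: mem_frame)
    qed
    then show "D = ?B" using cD card_B by (intro card_subset_eq fin(3)) simp_all
  qed
  have core: "?V - (frame M \<union> ?B) = ?C" by (auto simp: mem_frame)
  have plug: "plugged ?J (frame M) x" if x: "x \<in> ?C" for x
  proof -
    obtain v where v: "x = Vert v" "v \<in> G" using x by blast
    have "Frame (p v) \<in> frame M" "Frame (Suc (p v)) \<in> frame M"
      using p(2)[OF v(2)] by (simp_all add: mem_frame)
    moreover have "?J (Frame (p v)) (Frame (Suc (p v)))" by simp
    moreover have "\<forall>b\<in>frame M. \<not> ?J b x \<and> (?J x b \<longleftrightarrow> b = Frame (p v))"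
      unfolding v(1) by (auto simp: mem_frame)
    ultimately show ?thesis unfolding plugged_def by blast
  qed
  have sc: "scaffold ?V (frame M) ?B ?J"
  proof (intro scaffold.intro)
    show "frame M \<subseteq> ?V" "?B \<subseteq> ?V" by blast+
    show "\<not> ?J a b \<and> \<not> ?J b a" if "a \<in> frame M" "b \<in> ?B" for a b
      using that by (auto simp: mem_frame)
    show "plugged ?J (frame M) v" if "v \<in> ?V" "v \<notin> frame M" "v \<notin> ?B" for v
      using plug that by blast
    show "?J v b \<and> \<not> ?J b v" if "v \<in> ?V" "v \<notin> frame M" "v \<notin> ?B" "b \<in> ?B" for v b
      using that by auto
    show "?V - (frame M \<union> ?B) \<noteq> {}" unfolding core using G(2) by simp
  qed (fact fin(1) tour ind uniqA uniqB)+
  have core': "scaffold.core ?V (frame M) ?B = ?C"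
    unfolding scaffold.core_def[OF sc] by (rule core)
  have uniq: "unique_copy ?J (frame M) (frame M \<union> ?C)"
    using uniqA unfolding unique_copy_def by blast
  have less: "p v < M" if "v \<in> G" for v using p(2)[OF that] by simp
  have c: "coded M G E p" by (intro coded.intro M G p(1) less uniq)
  have "gt ?C ?J = gt G E" by (rule gt_image) (use G in \<open>auto simp: inj_on_def\<close>)
  then have "code_in (frame_type M) (gt ?B ?J) (gt ?V ?J) (gt (?B \<union> ?C) ?J)
      (coded.code_type M G E p) (gt G E)"
    using scaffold.code_in_scaffold[OF sc] unfolding core' coded.code_type_def[OF c] gt_frame[OF M]
    by simp
  moreover have "\<not> same_place w" if w: "ext2 (frame_type M) w (coded.code_type M G E p)" for w
  proof -
    obtain u v where uv: "u \<in> G" "v \<in> G" "u \<noteq> v" "w = place2 M E p u v"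
      using w unfolding coded.ext2_code[OF c] by blast
    show ?thesis
      unfolding uv(4) same_place_place2[where p = p and E = E, OF M uv(3) less[OF uv(1)] less[OF uv(2)]]
      using inj_on_eq_iff[OF p(1) uv(1,2)] uv(3) by simp
  qed
  ultimately show ?thesis unfolding code_def using c by blast
qed

lemma embeddable_iff_code:
  "g \<preceq> h \<longleftrightarrow> (\<exists>t q r. code t q g \<and> code t r h \<and> compare t q r)"
proof
  assume gh: "g \<preceq> h"
  obtain G :: "nat set" and E where G: "finite G" "G \<noteq> {}" "g = gt G E" by (rule gt_cases)
  obtain H :: "nat set" and E' where H: "finite H" "H \<noteq> {}" "h = gt H E'" by (rule gt_cases)
  obtain f where f: "inj_on f G" "f ` G \<subseteq> H" "\<forall>x\<in>G. \<forall>y\<in>G. E x y \<longrightarrow> E' (f x) (f y)"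
    using gh unfolding G(3) H(3) embeddable_gt_iff[OF G(1,2) H(1,2)] by blast
  \<comment> \<open>A numbering of \<open>H\<close> gives its places; those of \<open>G\<close> are
    pulled back along \<open>f\<close>, so that \<open>f\<close> preserves places.\<close>
  obtain k where k: "bij_betw k H {0..<card H}" using ex_bij_betw_finite_nat[OF H(1)] by blast
  define M where "M = card G + card H + 8"
  have kM: "Suc (k v) < M" if "v \<in> H" for v
  proof -
    have "k v < card H" using k that by (auto simp: bij_betw_def)
    then show ?thesis by (simp add: M_def)
  qed
  have kinj: "inj_on k H" using k by (simp add: bij_betw_def)
  have fH: "f v \<in> H" if "v \<in> G" for v using f(2) that by blast
  have inj: "inj_on (k \<circ> f) G" by (rule comp_inj_on[OF f(1) inj_on_subset[OF kinj f(2)]])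
  have cg: "coded M G E (k \<circ> f) \<and> code (frame_type M) (coded.code_type M G E (k \<circ> f)) g"
    unfolding G(3) by (rule code_complete[OF G(1,2) inj]) (use kM fH in \<open>simp_all add: M_def\<close>)
  have ch: "coded M H E' k \<and> code (frame_type M) (coded.code_type M H E' k) h"
    unfolding H(3) by (rule code_complete[OF H(1,2) kinj]) (use kM in \<open>simp_all add: M_def\<close>)
  have "compare (frame_type M) (coded.code_type M G E (k \<circ> f)) (coded.code_type M H E' k)"
    by (rule compare_complete[OF conjunct1[OF cg] conjunct1[OF ch] f(1) fH]) (use f(3) in simp_all)
  then show "\<exists>t q r. code t q g \<and> code t r h \<and> compare t q r" using cg ch by blast
next
  assume "\<exists>t q r. code t q g \<and> code t r h \<and> compare t q r"
  then obtain t q r where tqr: "code t q g" "code t r h" "compare t q r" by blast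
  obtain M G E p where c: "coded M G E p" "t = frame_type M" "q = coded.code_type M G E p"
    "g = gt G E" by (rule code_sound[OF tqr(1)])
  obtain N H E' p' where c': "coded N H E' p'" "t = frame_type N" "r = coded.code_type N H E' p'"
    "h = gt H E'" by (rule code_sound[OF tqr(2)])
  have pos: "0 < M" "0 < N" using coded.M[OF c(1)] coded.M[OF c'(1)] by simp_all
  \<comment> \<open>The frame type determines its size, so a common \<open>t\<close> means a common
    range of places.\<close>
  have "card {..<M} = card {..<N}"
  proof (rule gt_card_eq)
    show "gt {..<M} (<) = gt {..<N} (<)" using c(2) c'(2) by (simp add: frame_type_def)
  qed (use pos in \<open>auto simp: lessThan_empty_iff\<close>)
  then have "N = M" by simp
  then show "g \<preceq> h"
    using compare_sound[OF c(1), of H E' p'] c c' tqr(3) by simp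
qed

section \<open>Definability\<close>

context
  fixes cs :: "digraph_type list"
  assumes cs: "set cs = small_types"
begin

lemma definable_has_loop: "definable (\<sqsubseteq>) cs (\<lambda>e. has_loop (e i))"
  unfolding has_loop_def by (rule definable_pat[OF cs]) simp_all

lemma definable_has_nonloop: "definable (\<sqsubseteq>) cs (\<lambda>e. has_nonloop (e i))"
  unfolding has_nonloop_def by (rule definable_pat[OF cs]) simp_all

lemma definable_same_place: "definable (\<sqsubseteq>) cs (\<lambda>e. same_place (e i))"
  unfolding same_place_def by (rule definable_pat[OF cs]) simp_all

lemma definable_forward: "definable (\<sqsubseteq>) cs (\<lambda>e. forward (e i))"
  unfolding forward_def by (rule definable_pat[OF cs]) simp_all

lemma definable_backward: "definable (\<sqsubseteq>) cs (\<lambda>e. backward (e i))"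
  unfolding backward_def by (rule definable_pat[OF cs]) simp_all

text \<open>These rules expect every variable in the form \<open>e i\<close>. The shifted premises
  of \<open>definable_ex\<close> and \<open>definable_all\<close> preserve that form, so after
  unfolding a definition its definability follows by backward chaining along its syntax.\<close>

lemmas connectives =
  definable_le definable_eq definable_not definable_conj definable_disj definable_imp definable_iff
  definable_ex definable_all definable_has_loop definable_has_nonloop definable_same_place
  definable_forward definable_backward

lemma definable_pattern_classes:
  "definable (\<sqsubseteq>) cs (\<lambda>e. loops_apart (e i))" "definable (\<sqsubseteq>) cs (\<lambda>e. tour (e i))"
  "definable (\<sqsubseteq>) cs (\<lambda>e. indep (e i))" "definable (\<sqsubseteq>) cs (\<lambda>e. attached (e i))"
  "definable (\<sqsubseteq>) cs (\<lambda>e. dominating (e i))"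
  unfolding loops_apart_def tour_def indep_def attached_def dominating_def
  by (intro connectives definable_pat[OF cs]; simp)+

lemma definable_cover: "definable (\<sqsubseteq>) cs (\<lambda>e. cover (e i) (e j))"
  unfolding cover_def by (intro connectives)

lemma definable_ext:
  "definable (\<sqsubseteq>) cs (\<lambda>e. ext1 (e i) (e j) (e k))" "definable (\<sqsubseteq>) cs (\<lambda>e. ext2 (e i) (e j) (e k))"
  unfolding ext1_def ext2_def by (intro connectives definable_cover)+

lemma definable_lift: "definable (\<sqsubseteq>) cs (\<lambda>e. lift (e i) (e j))"
  unfolding lift_def by (intro connectives definable_cover)

lemma definable_code_in:
  "definable (\<sqsubseteq>) cs (\<lambda>e. code_in (e i) (e j) (e k) (e l) (e m) (e n))"
  unfolding code_in_def maximal_def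
  by (intro connectives definable_pattern_classes definable_ext)

lemma definable_code: "definable (\<sqsubseteq>) cs (\<lambda>e. code (e i) (e j) (e k))"
  unfolding code_def by (intro connectives definable_code_in definable_ext)

lemma definable_compare: "definable (\<sqsubseteq>) cs (\<lambda>e. compare (e i) (e j) (e k))"
  unfolding compare_def by (intro connectives definable_ext definable_lift)

lemma definable_embeddable: "definable (\<sqsubseteq>) cs (\<lambda>e. e i \<preceq> e j)"
  unfolding embeddable_iff_code by (intro connectives definable_code definable_compare)

end

theorem theorem1:
  shows "\<exists>Cs :: digraph_type list.
    fo_definable (\<sqsubseteq>) Cs 2 {[G, G'] | G G'. G \<preceq> G'} \<and>
    (\<forall>n R. fo_definable (\<preceq>) [] n R \<longrightarrow> fo_definable (\<sqsubseteq>) Cs n R)"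
proof -
  obtain Cs where Cs: "set Cs = small_types" using finite_list[OF finite_small_types] by blast
  have emb: "definable (\<sqsubseteq>) Cs (\<lambda>e. e i \<preceq> e j)" for i j by (rule definable_embeddable[OF Cs])
  have "fo_definable (\<sqsubseteq>) Cs 2 {as. length as = 2 \<and> as ! 0 \<preceq> as ! 1}"
    by (rule definable_imp_fo_definable[OF emb]) simp
  moreover have "{as. length as = 2 \<and> as ! 0 \<preceq> as ! 1} = {[G, G'] | G G'. G \<preceq> G'}"
    by (auto simp: numeral_2_eq_2 length_Suc_conv)
  ultimately have "fo_definable (\<sqsubseteq>) Cs 2 {[G, G'] | G G'. G \<preceq> G'}" by simp
  moreover have "fo_definable (\<sqsubseteq>) Cs n R" if "fo_definable (\<preceq>) [] n R" for n R
    by (rule fo_definable_reduct[OF emb that])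
  ultimately show ?thesis by blast
qed

end
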